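(* Given $n$ positive integers $m_1,\dots,m_n$, let $N=n+\sum_{j=1}^nm_j$. There exist two countable families of compact Lagrangian immersions, $\Phi_p$ (indexed by $p\in\mathbb{N}$) and $\Phi_{q,r}$ (indexed by pairs of integers $0<q<r$), of $$\mathbb{T}^n\times\prod_{j=1}^n\mathbb{S}^{m_j}$$ into $\mathbb{C}^N$ which are H-minimal and non-trivial, i.e. non-minimal and whose mean curvature vector is not parallel.
   Context: $\mathbb{T}^n=(\mathbb{S}^1)^n$ is the $n$-torus. An immersion of an $N$-manifold into $\mathbb{C}^N$ is Lagrangian if it pulls back the standard symplectic form to $0$. The mean curvature vector is $H=\frac1N\mathrm{trace}\,\sigma$, $\sigma$ the second fundamental form; the immersion is minimal if $H\equiv0$ and has parallel mean curvature vector if $\nabla^\perp H=0$. A Lagrangian immersion is H-minimal (Hamiltonian-minimal) if it is a critical point of the volume for compactly supported Hamiltonian variations; equivalently $\mathrm{div}\,JH=0$ for the induced metric, where $J$ is multiplication by $i$. *)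

theory Defs
  imports "HOL-Analysis.Analysis"
begin

section \<open>Smooth maps\<close>

text \<open>Intended for open \<open>S\<close> and Euclidean domains, where \<open>Ck_on k f S\<close> is the usual \<open>C\<^sup>k\<close> notion:
  all iterated directional derivatives up to order \<open>k\<close> exist and are continuous.\<close>

primrec Ck_on :: "nat \<Rightarrow> ('a::real_normed_vector \<Rightarrow> 'b::real_normed_vector) \<Rightarrow> 'a set \<Rightarrow> bool" where
  "Ck_on 0 f S \<longleftrightarrow> continuous_on S f"
| "Ck_on (Suc k) f S \<longleftrightarrow>
     (\<forall>x\<in>S. f differentiable (at x)) \<and>
     (\<forall>v. Ck_on k (\<lambda>x. frechet_derivative f (at x) v) S)"

definition smooth_on_open ::
  "('a::euclidean_space \<Rightarrow> 'b::real_normed_vector) \<Rightarrow> 'a set \<Rightarrow> bool" where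
  "smooth_on_open f S \<longleftrightarrow> open S \<and> (\<forall>k. Ck_on k f S)"

text \<open>A map on an arbitrary subset \<open>M\<close> of a Euclidean space is smooth if it locally extends to
  smooth maps on open sets.  For a submanifold \<open>M\<close> these are the smooth maps of the manifold.\<close>

definition smooth_map :: "('a::euclidean_space \<Rightarrow> 'b::real_normed_vector) \<Rightarrow> 'a set \<Rightarrow> bool" where
  "smooth_map f M \<longleftrightarrow>
     (\<forall>x\<in>M. \<exists>V g. x \<in> V \<and> smooth_on_open g V \<and> (\<forall>y\<in>V \<inter> M. g y = f y))"

section \<open>Local parametrizations of a submanifold\<close>

text \<open>Smooth regular parametrizations \<open>\<phi>: U \<rightarrow> M\<close> of relatively open pieces of a subset \<open>M\<close>; they
  cover \<open>M\<close> exactly when \<open>M\<close> is an embedded submanifold of dimension \<open>CARD('N)\<close>.\<close>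

definition local_param ::
  "'e::euclidean_space set \<Rightarrow> (real^'N::finite) set \<Rightarrow> (real^'N \<Rightarrow> 'e) \<Rightarrow> bool" where
  "local_param M U \<phi> \<longleftrightarrow>
     smooth_on_open \<phi> U \<and>
     (\<forall>u\<in>U. inj (frechet_derivative \<phi> (at u))) \<and>
     openin (top_of_set M) (\<phi> ` U) \<and>
     (\<exists>\<psi>. homeomorphism U (\<phi> ` U) \<phi> \<psi>)"

section \<open>Geometry of an immersion in coordinates\<close>

definition partial :: "'N::finite \<Rightarrow> (real^'N \<Rightarrow> 'v::real_normed_vector) \<Rightarrow> real^'N \<Rightarrow> 'v" where
  "partial i F u = frechet_derivative F (at u) (axis i 1)"

definition induced_metric :: "(real^'N::finite \<Rightarrow> 'v::real_inner) \<Rightarrow> real^'N \<Rightarrow> real^'N^'N" where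
  "induced_metric F u = (\<chi> i j. partial i F u \<bullet> partial j F u)"

definition inverse_metric :: "(real^'N::finite \<Rightarrow> 'v::real_inner) \<Rightarrow> real^'N \<Rightarrow> real^'N^'N" where
  "inverse_metric F u = matrix_inv (induced_metric F u)"

definition normal_part :: "(real^'N::finite \<Rightarrow> 'v::real_inner) \<Rightarrow> real^'N \<Rightarrow> 'v \<Rightarrow> 'v" where
  "normal_part F u v =
     v - (\<Sum>i\<in>UNIV. \<Sum>j\<in>UNIV. (inverse_metric F u $ i $ j * (v \<bullet> partial j F u)) *\<^sub>R partial i F u)"

definition second_fundamental_form ::
  "(real^'N::finite \<Rightarrow> 'v::real_inner) \<Rightarrow> real^'N \<Rightarrow> 'N \<Rightarrow> 'N \<Rightarrow> 'v" where
  "second_fundamental_form F u i j = normal_part F u (partial i (partial j F) u)"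

definition mean_curvature :: "(real^'N::finite \<Rightarrow> 'v::real_inner) \<Rightarrow> real^'N \<Rightarrow> 'v" where
  "mean_curvature F u = (1 / real CARD('N)) *\<^sub>R
     (\<Sum>i\<in>UNIV. \<Sum>j\<in>UNIV. inverse_metric F u $ i $ j *\<^sub>R second_fundamental_form F u i j)"

definition normal_derivative_mean_curvature ::
  "(real^'N::finite \<Rightarrow> 'v::real_inner) \<Rightarrow> real^'N \<Rightarrow> 'N \<Rightarrow> 'v" where
  "normal_derivative_mean_curvature F u k = normal_part F u (partial k (mean_curvature F) u)"

definition volume_density :: "(real^'N::finite \<Rightarrow> 'v::real_inner) \<Rightarrow> real^'N \<Rightarrow> real" where
  "volume_density F u = sqrt (det (induced_metric F u))"

section \<open>Lagrangian immersions into complex Euclidean space\<close>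

text \<open>The real inner product of \<open>complex^'N\<close> is the real part of the Hermitian product.\<close>

definition J :: "complex^'N::finite \<Rightarrow> complex^'N" where
  "J v = (\<chi> i. \<i> * v $ i)"

definition symplectic_form :: "complex^'N::finite \<Rightarrow> complex^'N \<Rightarrow> real" where
  "symplectic_form v w = J v \<bullet> w"

definition immersion :: "'e::euclidean_space set \<Rightarrow> ('e \<Rightarrow> complex^'N::finite) \<Rightarrow> bool" where
  "immersion M \<Phi> \<longleftrightarrow> smooth_map \<Phi> M \<and>
     (\<forall>(U :: (real^'N) set) \<phi>. local_param M U \<phi> \<longrightarrow>
        (\<forall>u\<in>U. inj (frechet_derivative (\<Phi> \<circ> \<phi>) (at u))))"

definition lagrangian_immersion :: "'e::euclidean_space set \<Rightarrow> ('e \<Rightarrow> complex^'N::finite) \<Rightarrow> bool" where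
  "lagrangian_immersion M \<Phi> \<longleftrightarrow> immersion M \<Phi> \<and>
     (\<forall>(U :: (real^'N) set) \<phi>. local_param M U \<phi> \<longrightarrow>
        (\<forall>u\<in>U. \<forall>v w. symplectic_form (frechet_derivative (\<Phi> \<circ> \<phi>) (at u) v)
                                        (frechet_derivative (\<Phi> \<circ> \<phi>) (at u) w) = 0))"

definition minimal_immersion :: "'e::euclidean_space set \<Rightarrow> ('e \<Rightarrow> complex^'N::finite) \<Rightarrow> bool" where
  "minimal_immersion M \<Phi> \<longleftrightarrow> immersion M \<Phi> \<and>
     (\<forall>(U :: (real^'N) set) \<phi>. local_param M U \<phi> \<longrightarrow>
        (\<forall>u\<in>U. mean_curvature (\<Phi> \<circ> \<phi>) u = 0))"

definition parallel_mean_curvature :: "'e::euclidean_space set \<Rightarrow> ('e \<Rightarrow> complex^'N::finite) \<Rightarrow> bool" where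
  "parallel_mean_curvature M \<Phi> \<longleftrightarrow> immersion M \<Phi> \<and>
     (\<forall>(U :: (real^'N) set) \<phi>. local_param M U \<phi> \<longrightarrow>
        (\<forall>u\<in>U. \<forall>k. normal_derivative_mean_curvature (\<Phi> \<circ> \<phi>) u k = 0))"

section \<open>Volume and Hamiltonian variations\<close>

text \<open>A finite smooth partition of unity \<open>\<rho> i\<close> (\<open>i < K\<close>) on \<open>M\<close>, each \<open>\<rho> i\<close> being supported in a
  compact subset of the parametrized piece \<open>\<phi> i ` U i\<close>.\<close>

definition partition_of_unity ::
  "'e::euclidean_space set \<Rightarrow> nat \<Rightarrow> (nat \<Rightarrow> (real^'N::finite) set) \<Rightarrow> (nat \<Rightarrow> real^'N \<Rightarrow> 'e) \<Rightarrow>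
   (nat \<Rightarrow> 'e \<Rightarrow> real) \<Rightarrow> bool" where
  "partition_of_unity M K U \<phi> \<rho> \<longleftrightarrow>
     (\<forall>i<K. local_param M (U i) (\<phi> i) \<and> smooth_map (\<rho> i) M \<and> (\<forall>x\<in>M. 0 \<le> \<rho> i x) \<and>
        (\<exists>C. compact C \<and> C \<subseteq> \<phi> i ` U i \<and> (\<forall>x\<in>M - C. \<rho> i x = 0))) \<and>
     (\<forall>x\<in>M. (\<Sum>i<K. \<rho> i x) = 1)"

text \<open>The volume of a compact \<open>M\<close> in the metric induced by \<open>\<Phi>\<close>, computed in a partition of unity.
  Its value does not depend on that choice; below we quantify over all choices.\<close>

definition volume ::
  "nat \<Rightarrow> (nat \<Rightarrow> (real^'N::finite) set) \<Rightarrow> (nat \<Rightarrow> real^'N \<Rightarrow> 'e) \<Rightarrow> (nat \<Rightarrow> 'e \<Rightarrow> real) \<Rightarrow>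
   ('e::euclidean_space \<Rightarrow> complex^'N) \<Rightarrow> real" where
  "volume K U \<phi> \<rho> \<Phi> =
     (\<Sum>i<K. integral (U i) (\<lambda>u. \<rho> i (\<phi> i u) * volume_density (\<Phi> \<circ> \<phi> i) u))"

text \<open>A smooth variation \<open>\<Gamma> t\<close> (\<open>\<bar>t\<bar> < \<epsilon>\<close>) of \<open>\<Phi>\<close> is Hamiltonian if its variation field
  \<open>V = d/dt \<Gamma> t\<close> at \<open>t = 0\<close> satisfies \<open>\<omega>(V, d\<Phi> w) = df(w)\<close> for some smooth function \<open>f\<close> on \<open>M\<close>;
  for a Lagrangian \<open>\<Phi>\<close> this says that the normal part of \<open>V\<close> is \<open>J \<nabla>f\<close> up to the sign of \<open>f\<close>.
  Compactness of supports is no condition here, as \<open>M\<close> will be compact; \<open>\<Gamma> t\<close> is then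
  automatically an immersion for small \<open>t\<close>.\<close>

definition hamiltonian_variation ::
  "'e::euclidean_space set \<Rightarrow> ('e \<Rightarrow> complex^'N::finite) \<Rightarrow> real \<Rightarrow> (real \<Rightarrow> 'e \<Rightarrow> complex^'N) \<Rightarrow> bool" where
  "hamiltonian_variation M \<Phi> \<epsilon> \<Gamma> \<longleftrightarrow>
     0 < \<epsilon> \<and>
     smooth_map (\<lambda>(t, x). \<Gamma> t x) ({-\<epsilon><..<\<epsilon>} \<times> M) \<and>
     (\<forall>x\<in>M. \<Gamma> 0 x = \<Phi> x) \<and>
     (\<exists>f :: 'e \<Rightarrow> real. smooth_map f M \<and>
        (\<forall>(U :: (real^'N) set) \<phi>. local_param M U \<phi> \<longrightarrow>
           (\<forall>u\<in>U. \<forall>w.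
              symplectic_form (vector_derivative (\<lambda>t. \<Gamma> t (\<phi> u)) (at 0))
                              (frechet_derivative (\<Phi> \<circ> \<phi>) (at u) w)
              = frechet_derivative (f \<circ> \<phi>) (at u) w)))"

definition H_minimal :: "'e::euclidean_space set \<Rightarrow> ('e \<Rightarrow> complex^'N::finite) \<Rightarrow> bool" where
  "H_minimal M \<Phi> \<longleftrightarrow> lagrangian_immersion M \<Phi> \<and>
     (\<forall>\<epsilon> \<Gamma>. hamiltonian_variation M \<Phi> \<epsilon> \<Gamma> \<longrightarrow>
        (\<forall>K (U :: nat \<Rightarrow> (real^'N) set) \<phi> \<rho>. partition_of_unity M K U \<phi> \<rho> \<longrightarrow>
           ((\<lambda>t. volume K U \<phi> \<rho> (\<Gamma> t)) has_real_derivative 0) (at 0)))"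

definition nontrivial_H_minimal ::
  "'e::euclidean_space set \<Rightarrow> ('e \<Rightarrow> complex^'N::finite) \<Rightarrow> bool" where
  "nontrivial_H_minimal M \<Phi> \<longleftrightarrow>
     H_minimal M \<Phi> \<and> \<not> minimal_immersion M \<Phi> \<and> \<not> parallel_mean_curvature M \<Phi>"

section \<open>The product of a torus and spheres\<close>

text \<open>The Cartesian coordinates of the product of the spaces containing the spheres are indexed by
  \<open>'d\<close>, and \<open>b i\<close> is the factor to which coordinate \<open>i\<close> belongs.  If
  \<open>card {i. b i = j} = m j + 1\<close>, the \<open>j\<close>-th factor is the unit sphere of dimension \<open>m j\<close>.\<close>

definition torus_times_spheres ::
  "('d::finite \<Rightarrow> 'n::finite) \<Rightarrow> ((complex^'n) \<times> (real^'d)) set" where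
  "torus_times_spheres b =
     {z. \<forall>j. norm (z $ j) = 1} \<times> {x. \<forall>j. (\<Sum>i | b i = j. (x $ i)\<^sup>2) = 1}"

lemma compact_torus_times_spheres:
  fixes b :: "'d::finite \<Rightarrow> 'n::finite"
  shows "compact (torus_times_spheres b)"
proof -
  let ?T = "{z :: complex^'n. \<forall>j. norm (z $ j) = 1}"
  let ?S = "{x :: real^'d. \<forall>j. (\<Sum>i | b i = j. (x $ i)\<^sup>2) = 1}"
  have "closed ?T"
    by (intro closed_Collect_all closed_Collect_eq continuous_intros)
  moreover have "bounded ?T"
    unfolding bounded_iff
    by (rule exI[of _ "sqrt (real CARD('n))"]) (simp add: norm_vec_def L2_set_def)
  moreover have "closed ?S"
    by (intro closed_Collect_all closed_Collect_eq continuous_intros)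
  moreover have "bounded ?S"
  proof -
    have "\<bar>x $ i\<bar> \<le> 1" if x: "x \<in> ?S" for x i
    proof -
      have "(x $ i)\<^sup>2 \<le> (\<Sum>k | b k = b i. (x $ k)\<^sup>2)"
        by (rule member_le_sum) auto
      with x show ?thesis by (simp add: abs_square_le_1)
    qed
    then have "norm x \<le> (\<Sum>i\<in>(UNIV::'d set). 1)" if "x \<in> ?S" for x
      using that by (intro order.trans[OF norm_le_l1_cart] sum_mono) blast
    then show ?thesis unfolding bounded_iff by blast
  qed
  ultimately show ?thesis
    unfolding torus_times_spheres_def
    by (intro compact_Times) (simp_all add: compact_eq_bounded_closed)
qed

end

theory Submission
  imports Defs
begin

text \<open>
  Let every coordinate \<open>k\<close> of \<open>\<complex>\<^sup>N\<close> have a positive integer weight \<open>g\<^sub>k\<close> and belong to one of the \<open>n\<close>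
  factors, the one with index \<open>b\<^sub>k\<close>.  The immersions are the maps
  \<open>(z, x) \<mapsto> (z\<^bsub>b\<^sub>k\<^esub> ^ g\<^sub>k * x\<^sub>k / sqrt g\<^sub>k)\<^sub>k\<close>, in which the torus rotates a product of real ellipsoids
  \<open>\<Sum>\<^sub>k g\<^sub>k u\<^sub>k\<^sup>2 = 1\<close>, with \<open>k\<close> in one factor, with the speeds \<open>g\<^sub>k\<close>.  They are Lagrangian, because the vector \<open>(g\<^sub>k u\<^sub>k)\<^sub>k\<close> is normal
  to the ellipsoid.

  Let \<open>\<theta>\<^sub>j\<close> be the angle of \<open>z\<^sub>j\<close>, and over the coordinates \<open>k\<close> of the factor \<open>j\<close> let \<open>s\<^sub>j = \<Sum>\<^sub>k g\<^sub>k\<close> and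
  \<open>r\<^sub>j = \<Sum>\<^sub>k g\<^sub>k x\<^sub>k\<^sup>2\<close>.  The Lagrangian angle is \<open>\<beta> = \<Sum>\<^sub>j s\<^sub>j \<theta>\<^sub>j\<close> up to a constant.  The rotation fields
  \<open>\<partial>/\<partial>\<theta>\<^sub>j\<close> are orthogonal to each other and to the spheres and have the squared lengths \<open>r\<^sub>j\<close>, so that
  \<open>\<nabla>\<beta> = \<Sum>\<^sub>j (s\<^sub>j / r\<^sub>j) \<partial>/\<partial>\<theta>\<^sub>j\<close>.  This field is divergence free: the rotation fields are Killing fields,
  and the rotations do not change the \<open>r\<^sub>j\<close>.  Since \<open>N H = J \<nabla>\<beta>\<close>, the first variation of the volume for
  a Hamiltonian \<open>f\<close> is, up to sign, the integral of \<open>df(\<nabla>\<beta>) = div (f \<nabla>\<beta>)\<close>, which is zero.  A parallel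
  mean curvature vector would have constant length, but \<open>\<bar>\<nabla>\<beta>\<bar>\<^sup>2 = \<Sum>\<^sub>j s\<^sub>j\<^sup>2 / r\<^sub>j\<close> varies as soon as two
  coordinates of some sphere have different weights.  With the weight \<open>c\<close> at one coordinate of each
  sphere and the weight \<open>a \<noteq> c\<close> at the others, \<open>a\<close> and \<open>c\<close> can be read off from the map;
  \<open>(a, c) = (p + 2, 1)\<close> and \<open>(a, c) = (q, r)\<close> give the two families.

  The first variation is computed with complex determinants instead of the second fundamental form.
  If \<open>A\<close> is the complex Jacobian matrix of the map in a chart, the volume density and
  \<open>\<bar>det A\<bar>\<close> have the same derivative at a Lagrangian immersion (\<open>has_derivative_sqrt_det_gram\<close>).
  Expanding the derivative of \<open>det A\<close> along columns gives a divergence and a term with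
  \<open>d\<beta>\<close> (\<open>divergence_identity\<close>), and for Hamiltonian variations this term is a divergence, too.
  The sum over a partition of unity vanishes by \<open>divergence_theorem_partition_of_unity\<close>.  The result is
  the criterion \<open>H_minimal_if_angle_gradient_divergence_free\<close>; together with \<open>mean_curvature_eq\<close> it yields
  \<open>nontrivial_H_minimal_criterion\<close>, whose hypotheses are then verified for the weighted immersions.
\<close>

section \<open>Calculus of smooth maps\<close>

lemma frechet_derivative_eqI:
  "(f has_derivative f') (at x) \<Longrightarrow> frechet_derivative f (at x) = f'"
  by (rule frechet_derivative_at[symmetric])

lemma Ck_on_cong:
  assumes "open S" and "\<And>x. x \<in> S \<Longrightarrow> f x = g x"
  shows "Ck_on k f S \<longleftrightarrow> Ck_on k g S"
proof -
  have imp: "Ck_on k g S" if "Ck_on k f S" "\<And>x. x \<in> S \<Longrightarrow> f x = g x" for f g :: "'a \<Rightarrow> 'b"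
    using that
  proof (induction k arbitrary: f g)
    case 0
    then show ?case by (simp cong: continuous_on_cong)
  next
    case (Suc k)
    have d: "f differentiable at x" if "x \<in> S" for x
      using Suc.prems that by simp
    have "frechet_derivative f (at x) = frechet_derivative g (at x)" if "x \<in> S" for x
      by (rule frechet_derivative_transform_within_open[OF d[OF that] \<open>open S\<close> that Suc.prems(2)])
    moreover have "g differentiable at x" if "x \<in> S" for x
    proof -
      have "(f has_derivative frechet_derivative f (at x)) (at x)"
        using d[OF that] frechet_derivative_works by blast
      then have "(g has_derivative frechet_derivative f (at x)) (at x)"
        by (rule has_derivative_transform_within_open[OF _ \<open>open S\<close> that Suc.prems(2)])
      then show ?thesis unfolding differentiable_def by blast
    qed
    moreover have "Ck_on k (\<lambda>x. frechet_derivative g (at x) v) S" for v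
    proof (rule Suc.IH)
      show "Ck_on k (\<lambda>x. frechet_derivative f (at x) v) S" using Suc.prems(1) by simp
    qed (simp add: calculation(1))
    ultimately show ?case by simp
  qed
  show ?thesis using imp[of f g] imp[of g f] assms(2) by auto
qed

lemma Ck_on_SucI:
  assumes "open S" and "\<And>x. x \<in> S \<Longrightarrow> (f has_derivative f' x) (at x)"
    and "\<And>v. Ck_on k (\<lambda>x. f' x v) S"
  shows "Ck_on (Suc k) f S"
proof -
  have "Ck_on k (\<lambda>x. frechet_derivative f (at x) v) S" for v
    using assms(3)[of v] by (rule Ck_on_cong[THEN iffD1, OF assms(1), rotated])
      (simp add: frechet_derivative_eqI[OF assms(2)])
  then show ?thesis
    using assms(2) by (auto simp: differentiable_def)
qed

lemma Ck_on_subset: "Ck_on k f S \<Longrightarrow> T \<subseteq> S \<Longrightarrow> Ck_on k f T"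
  by (induction k arbitrary: f) (auto intro: continuous_on_subset)

lemma Ck_on_SucD: "Ck_on (Suc k) f S \<Longrightarrow> Ck_on k f S"
proof (induction k arbitrary: f)
  case 0
  then show ?case
    by (auto intro!: continuous_at_imp_continuous_on differentiable_imp_continuous_within)
qed auto

lemma Ck_on_const: "Ck_on k (\<lambda>x. c) S"
  by (induction k arbitrary: c) auto

lemma Ck_on_bounded_linear:
  assumes "bounded_linear f" shows "Ck_on k f S"
proof (cases k)
  case 0
  then show ?thesis using assms by (simp add: linear_continuous_on)
next
  case (Suc j)
  have "(f has_derivative f) (at x)" for x
    using assms by (rule bounded_linear_imp_has_derivative)
  then have "frechet_derivative f (at x) = f" "f differentiable (at x)" for x
    by (auto simp: differentiable_def intro: frechet_derivative_eqI)
  then show ?thesis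
    using Suc by (simp add: Ck_on_const)
qed

lemma Ck_on_add:
  assumes "open S" shows "Ck_on k f S \<Longrightarrow> Ck_on k g S \<Longrightarrow> Ck_on k (\<lambda>x. f x + g x) S"
proof (induction k arbitrary: f g)
  case 0
  then show ?case by (simp add: continuous_on_add)
next
  case (Suc k)
  have *: "((\<lambda>x. f x + g x) has_derivative
      (\<lambda>v. frechet_derivative f (at x) v + frechet_derivative g (at x) v)) (at x)" if "x \<in> S" for x
    using Suc.prems that
    by (intro has_derivative_add) (auto simp: frechet_derivative_works[symmetric])
  have "Ck_on k (\<lambda>x. frechet_derivative f (at x) v + frechet_derivative g (at x) v) S" for v
    using Suc by auto
  then show ?case using * by (intro Ck_on_SucI[OF \<open>open S\<close>])
qed

lemma Ck_on_bounded_bilinear: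
  fixes f :: "'a::real_normed_vector \<Rightarrow> 'b::real_normed_vector"
    and g :: "'a \<Rightarrow> 'c::real_normed_vector"
  assumes "open S" and "bounded_bilinear h"
  shows "Ck_on k f S \<Longrightarrow> Ck_on k g S \<Longrightarrow> Ck_on k (\<lambda>x. h (f x) (g x)) S"
proof (induction k arbitrary: f g)
  case 0
  then show ?case using bounded_bilinear.continuous_on[OF assms(2)] by simp
next
  case (Suc k)
  have *: "((\<lambda>x. h (f x) (g x)) has_derivative
      (\<lambda>v. h (f x) (frechet_derivative g (at x) v) + h (frechet_derivative f (at x) v) (g x))) (at x)"
    if "x \<in> S" for x
    using Suc.prems that
    by (intro bounded_bilinear.FDERIV[OF assms(2)]) (auto simp: frechet_derivative_works[symmetric])
  have "Ck_on k (\<lambda>x. h (f x) (frechet_derivative g (at x) v) + h (frechet_derivative f (at x) v) (g x)) S" for v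
    using Suc.prems Ck_on_SucD[of k f S] Ck_on_SucD[of k g S]
    by (intro Ck_on_add[OF \<open>open S\<close>] Suc.IH) auto
  then show ?case using * by (intro Ck_on_SucI[OF \<open>open S\<close>])
qed

lemma Ck_on_sum:
  assumes "open S" and "\<And>i. i \<in> I \<Longrightarrow> Ck_on k (f i) S"
  shows "Ck_on k (\<lambda>x. \<Sum>i\<in>I. f i x) S"
  using assms(2) by (induction I rule: infinite_finite_induct)
    (auto simp: Ck_on_const intro!: Ck_on_add[OF assms(1)])

lemma linear_eq_sum_Basis:
  fixes f :: "'a::euclidean_space \<Rightarrow> 'b::real_vector"
  assumes "linear f"
  shows "f v = (\<Sum>b\<in>Basis. (v \<bullet> b) *\<^sub>R f b)"
  using euclidean_representation[of v] linear_sum[OF assms] linear_scale[OF assms]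
  by (metis (no_types, lifting) sum.cong)

text \<open>By the chain rule and expansion in a basis, the derivatives of the composition are sums of products of
  maps to which the induction hypothesis applies.\<close>

lemma Ck_on_compose:
  fixes f :: "'a::real_normed_vector \<Rightarrow> 'b::euclidean_space"
    and g :: "'b \<Rightarrow> 'c::real_normed_vector"
  assumes "open S" and "f ` S \<subseteq> T"
  shows "Ck_on k f S \<Longrightarrow> Ck_on k g T \<Longrightarrow> Ck_on k (\<lambda>x. g (f x)) S"
proof (induction k arbitrary: g)
  case 0
  then show ?case using assms(2) by (auto intro: continuous_on_compose2)
next
  case (Suc k)
  have *: "((\<lambda>x. g (f x)) has_derivative
      (\<lambda>v. frechet_derivative g (at (f x)) (frechet_derivative f (at x) v))) (at x)"
    if "x \<in> S" for x
    using Suc.prems that assms(2)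
    by (intro has_derivative_compose[of f _ x UNIV g, simplified])
       (auto simp: frechet_derivative_works[symmetric])
  have "linear (frechet_derivative g (at (f x)))" if "x \<in> S" for x
    using Suc.prems that assms(2) by (intro linear_frechet_derivative) auto
  then have eq: "frechet_derivative g (at (f x)) (frechet_derivative f (at x) v) =
      (\<Sum>b\<in>Basis. (frechet_derivative f (at x) v \<bullet> b) *\<^sub>R frechet_derivative g (at (f x)) b)"
    if "x \<in> S" for x v
    using that linear_eq_sum_Basis by blast
  have "Ck_on k (\<lambda>x. \<Sum>b\<in>Basis. (frechet_derivative f (at x) v \<bullet> b) *\<^sub>R
      frechet_derivative g (at (f x)) b) S" for v
    using Suc.prems
    by (intro Ck_on_sum Ck_on_bounded_bilinear[OF _ bounded_bilinear_scaleR]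
          Ck_on_bounded_bilinear[OF _ bounded_bilinear_inner] Suc.IH Ck_on_SucD[of k f] Ck_on_const assms(1)) auto
  then have "Ck_on k (\<lambda>x. frechet_derivative g (at (f x)) (frechet_derivative f (at x) v)) S" for v
    using Ck_on_cong[OF assms(1) eq] by simp
  then show ?case using * by (intro Ck_on_SucI[OF \<open>open S\<close>])
qed

named_theorems smooth_intros

lemma smooth_on_open_openD: "smooth_on_open f S \<Longrightarrow> open S"
  by (simp add: smooth_on_open_def)

lemma smooth_on_open_cong:
  "smooth_on_open f S \<Longrightarrow> (\<And>x. x \<in> S \<Longrightarrow> f x = g x) \<Longrightarrow> smooth_on_open g S"
  unfolding smooth_on_open_def using Ck_on_cong by blast

lemma smooth_on_open_subset: "smooth_on_open f S \<Longrightarrow> T \<subseteq> S \<Longrightarrow> open T \<Longrightarrow> smooth_on_open f T"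
  unfolding smooth_on_open_def using Ck_on_subset by blast

lemma smooth_on_open_local:
  assumes "open S" and "\<And>x. x \<in> S \<Longrightarrow> \<exists>T. x \<in> T \<and> smooth_on_open f T"
  shows "smooth_on_open f S"
proof -
  have loc: "Ck_on k f S" if "\<And>x. x \<in> S \<Longrightarrow> \<exists>T. x \<in> T \<and> open T \<and> Ck_on k f T" for k
    using that
  proof (induction k arbitrary: f)
    case 0
    show ?case
      unfolding Ck_on.simps
    proof (intro continuous_at_imp_continuous_on ballI)
      fix x assume "x \<in> S"
      then obtain T where "x \<in> T" "open T" "continuous_on T f"
        using 0 by auto
      then show "isCont f x" by (simp add: continuous_on_eq_continuous_at)
    qed
  next
    case (Suc k)
    have "f differentiable at x" if "x \<in> S" for x
      using Suc.prems[OF that] by auto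
    moreover have "Ck_on k (\<lambda>x. frechet_derivative f (at x) v) S" for v
      using Suc.prems by (intro Suc.IH) fastforce
    ultimately show ?case by simp
  qed
  show ?thesis
    unfolding smooth_on_open_def
    using assms by (metis loc smooth_on_open_def)
qed

lemma smooth_on_open_differentiable:
  "smooth_on_open f S \<Longrightarrow> x \<in> S \<Longrightarrow> f differentiable (at x)"
  unfolding smooth_on_open_def by (metis Ck_on.simps(2))

lemma smooth_on_open_has_derivative:
  "smooth_on_open f S \<Longrightarrow> x \<in> S \<Longrightarrow> (f has_derivative frechet_derivative f (at x)) (at x)"
  using smooth_on_open_differentiable frechet_derivative_works by blast

lemma smooth_on_open_continuous_on: "smooth_on_open f S \<Longrightarrow> continuous_on S f"
  unfolding smooth_on_open_def by (metis Ck_on.simps(1))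

lemma smooth_on_open_derivative:
  "smooth_on_open f S \<Longrightarrow> smooth_on_open (\<lambda>x. frechet_derivative f (at x) v) S"
  unfolding smooth_on_open_def by (metis Ck_on.simps(2))

lemma smooth_on_open_const[smooth_intros]: "open S \<Longrightarrow> smooth_on_open (\<lambda>x. c) S"
  by (simp add: smooth_on_open_def Ck_on_const)

lemma smooth_on_open_linear:
  "bounded_linear f \<Longrightarrow> open S \<Longrightarrow> smooth_on_open f S"
  by (simp add: smooth_on_open_def Ck_on_bounded_linear)

lemma smooth_on_open_ident[smooth_intros]: "open S \<Longrightarrow> smooth_on_open (\<lambda>x. x) S"
  by (rule smooth_on_open_linear[OF bounded_linear_ident])

lemma smooth_on_open_add[smooth_intros]:
  "smooth_on_open f S \<Longrightarrow> smooth_on_open g S \<Longrightarrow> smooth_on_open (\<lambda>x. f x + g x) S"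
  unfolding smooth_on_open_def by (auto intro: Ck_on_add)

lemma smooth_on_open_bilinear:
  "bounded_bilinear h \<Longrightarrow> smooth_on_open f S \<Longrightarrow> smooth_on_open g S \<Longrightarrow>
     smooth_on_open (\<lambda>x. h (f x) (g x)) S"
  unfolding smooth_on_open_def by (auto intro: Ck_on_bounded_bilinear)

lemma smooth_on_open_compose:
  fixes f :: "'a::euclidean_space \<Rightarrow> 'b::euclidean_space"
  shows "smooth_on_open g T \<Longrightarrow> smooth_on_open f S \<Longrightarrow> f ` S \<subseteq> T \<Longrightarrow> smooth_on_open (\<lambda>x. g (f x)) S"
  unfolding smooth_on_open_def using Ck_on_compose by blast

lemma smooth_on_open_linear_compose:
  fixes f :: "'a::euclidean_space \<Rightarrow> 'b::euclidean_space"
  assumes "bounded_linear h" "smooth_on_open f S"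
  shows "smooth_on_open (\<lambda>x. h (f x)) S"
  by (rule smooth_on_open_compose[OF smooth_on_open_linear[OF assms(1) open_UNIV] assms(2)]) simp

lemmas smooth_on_open_mult[smooth_intros] = smooth_on_open_bilinear[OF bounded_bilinear_mult]
lemmas smooth_on_open_scaleR[smooth_intros] = smooth_on_open_bilinear[OF bounded_bilinear_scaleR]
lemmas smooth_on_open_inner[smooth_intros] = smooth_on_open_bilinear[OF bounded_bilinear_inner]
lemmas smooth_on_open_uminus[smooth_intros] = smooth_on_open_linear_compose[OF bounded_linear_minus[OF bounded_linear_ident]]
lemmas smooth_on_open_fst[smooth_intros] = smooth_on_open_linear_compose[OF bounded_linear_fst]
lemmas smooth_on_open_snd[smooth_intros] = smooth_on_open_linear_compose[OF bounded_linear_snd]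
lemmas smooth_on_open_vec_nth[smooth_intros] = smooth_on_open_linear_compose[OF bounded_linear_vec_nth]
lemmas smooth_on_open_Re[smooth_intros] = smooth_on_open_linear_compose[OF bounded_linear_Re]
lemmas smooth_on_open_of_real[smooth_intros] =
  smooth_on_open_linear_compose[OF bounded_linear_of_real]

lemma smooth_on_open_diff[smooth_intros]:
  fixes f :: "'a::euclidean_space \<Rightarrow> 'b::euclidean_space"
  shows "smooth_on_open f S \<Longrightarrow> smooth_on_open g S \<Longrightarrow> smooth_on_open (\<lambda>x. f x - g x) S"
  using smooth_on_open_add[OF _ smooth_on_open_uminus] by fastforce

lemma smooth_on_open_sum[smooth_intros]:
  "open S \<Longrightarrow> (\<And>i. i \<in> I \<Longrightarrow> smooth_on_open (f i) S) \<Longrightarrow> smooth_on_open (\<lambda>x. \<Sum>i\<in>I. f i x) S"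
  unfolding smooth_on_open_def by (auto intro: Ck_on_sum)

lemma smooth_on_open_prod[smooth_intros]:
  fixes f :: "'i \<Rightarrow> 'a::euclidean_space \<Rightarrow> 'b::real_normed_field"
  assumes "open S" "\<And>i. i \<in> I \<Longrightarrow> smooth_on_open (f i) S"
  shows "smooth_on_open (\<lambda>x. \<Prod>i\<in>I. f i x) S"
  using assms(2) by (induction I rule: infinite_finite_induct)
    (auto intro!: smooth_intros assms(1))

lemma smooth_on_open_power[smooth_intros]:
  fixes f :: "'a::euclidean_space \<Rightarrow> 'b::real_normed_field"
  shows "smooth_on_open f S \<Longrightarrow> smooth_on_open (\<lambda>x. f x ^ n) S"
  by (induction n) (auto intro!: smooth_intros dest: smooth_on_open_openD)

lemma smooth_on_open_vec_lambda[smooth_intros]: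
  fixes f :: "'i::finite \<Rightarrow> 'a::euclidean_space \<Rightarrow> 'b::euclidean_space"
  assumes "open S" "\<And>i. smooth_on_open (f i) S"
  shows "smooth_on_open (\<lambda>x. \<chi> i. f i x) S"
proof -
  have lin: "bounded_linear (axis i :: 'b \<Rightarrow> 'b^'i)" for i
    by (intro linear_conv_bounded_linear[THEN iffD1] linearI) (auto simp: axis_def vec_eq_iff)
  have eq: "(\<Sum>i\<in>UNIV. axis i (f i x)) = (\<chi> i. f i x)" for x
    by (simp add: vec_eq_iff axis_def sum_component if_distrib[of "\<lambda>z. z = _"] cong: if_cong)
  have "smooth_on_open (\<lambda>x. \<Sum>i\<in>UNIV. axis i (f i x)) S"
    by (intro smooth_on_open_sum smooth_on_open_linear_compose[OF lin] assms)
  then show ?thesis unfolding eq .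
qed

lemma smooth_on_open_Pair[smooth_intros]:
  fixes f :: "'a::euclidean_space \<Rightarrow> 'b::euclidean_space" and g :: "'a \<Rightarrow> 'c::euclidean_space"
  assumes "smooth_on_open f S" "smooth_on_open g S"
  shows "smooth_on_open (\<lambda>x. (f x, g x)) S"
proof -
  have 1: "bounded_linear (\<lambda>x. (x, 0 :: 'c))" for x :: 'b
    by (intro bounded_linear_Pair bounded_linear_ident bounded_linear_zero)
  have 2: "bounded_linear (\<lambda>x. (0 :: 'b, x))" for x :: 'c
    by (intro bounded_linear_Pair bounded_linear_ident bounded_linear_zero)
  have "smooth_on_open (\<lambda>x. (f x, 0) + (0, g x)) S"
    by (intro smooth_on_open_add smooth_on_open_linear_compose[OF 1] smooth_on_open_linear_compose[OF 2] assms)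
  then show ?thesis by simp
qed

lemma smooth_on_open_derivative_apply[smooth_intros]:
  fixes f :: "'a::euclidean_space \<Rightarrow> 'b::euclidean_space"
  assumes "smooth_on_open f S" "smooth_on_open g S"
  shows "smooth_on_open (\<lambda>x. frechet_derivative f (at x) (g x)) S"
proof (rule smooth_on_open_cong)
  show "smooth_on_open (\<lambda>x. \<Sum>b\<in>Basis. (g x \<bullet> b) *\<^sub>R frechet_derivative f (at x) b) S"
    by (intro smooth_intros smooth_on_open_derivative assms smooth_on_open_openD[OF assms(1)])
next
  fix x assume "x \<in> S"
  then show "(\<Sum>b\<in>Basis. (g x \<bullet> b) *\<^sub>R frechet_derivative f (at x) b) = frechet_derivative f (at x) (g x)"
    using smooth_on_open_differentiable[OF assms(1)]
    by (intro linear_eq_sum_Basis[symmetric] linear_frechet_derivative)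
qed

text \<open>The derivative of \<open>inverse\<close>, and likewise that of \<open>sqrt\<close> and of \<open>cis\<close> below, is a product of the map
  itself and of smooth maps, so that induction on the order applies.\<close>

lemma smooth_on_open_inverse_at: "smooth_on_open (inverse :: 'a::{real_normed_field,euclidean_space} \<Rightarrow> 'a) (- {0})"
proof -
  have "Ck_on k (inverse :: 'a \<Rightarrow> 'a) (- {0})" for k
  proof (induction k)
    case 0
    then show ?case by (auto intro!: continuous_intros)
  next
    case (Suc k)
    have *: "(inverse has_derivative (\<lambda>h. - (inverse x * h * inverse x))) (at x)" if "x \<noteq> 0" for x :: 'a
      using that by (rule has_derivative_inverse')
    have "Ck_on k (\<lambda>x :: 'a. - (inverse x * v * inverse x)) (- {0})" for v
      by (intro Ck_on_compose[OF _ _ _ Ck_on_bounded_linear[OF bounded_linear_minus[OF bounded_linear_ident], of _ UNIV]]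
          Ck_on_bounded_bilinear[OF _ bounded_bilinear_mult] Suc Ck_on_const) auto
    then show ?case using * by (intro Ck_on_SucI) auto
  qed
  then show ?thesis by (auto simp: smooth_on_open_def open_Compl)
qed

lemma smooth_on_open_inverse[smooth_intros]:
  fixes f :: "'a::euclidean_space \<Rightarrow> 'b::{real_normed_field,euclidean_space}"
  assumes "smooth_on_open f S" "\<And>x. x \<in> S \<Longrightarrow> f x \<noteq> 0"
  shows "smooth_on_open (\<lambda>x. inverse (f x)) S"
  by (rule smooth_on_open_compose[OF smooth_on_open_inverse_at assms(1)]) (use assms(2) in auto)

lemma smooth_on_open_divide[smooth_intros]:
  fixes f :: "'a::euclidean_space \<Rightarrow> 'b::{real_normed_field,euclidean_space}"
  assumes "smooth_on_open f S" "smooth_on_open g S" "\<And>x. x \<in> S \<Longrightarrow> g x \<noteq> 0"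
  shows "smooth_on_open (\<lambda>x. f x / g x) S"
  unfolding divide_inverse by (intro smooth_intros assms)

lemma smooth_on_open_sqrt_at: "smooth_on_open sqrt {0<..}"
proof -
  have "Ck_on k sqrt {0<..}" for k
  proof (induction k)
    case 0
    then show ?case by (auto intro!: continuous_intros)
  next
    case (Suc k)
    have *: "(sqrt has_derivative (\<lambda>h. h * (inverse (sqrt x) / 2))) (at x)" if "x > 0" for x
      using DERIV_real_sqrt[OF that] unfolding has_field_derivative_def
      by (rule has_derivative_eq_rhs) (simp add: fun_eq_iff)
    have "Ck_on k inverse (- {0 :: real})"
      using smooth_on_open_inverse_at[where 'a = real] by (simp add: smooth_on_open_def)
    then have "Ck_on k (\<lambda>x. inverse (sqrt x)) {0<..}"
      by (intro Ck_on_compose[OF _ _ Suc]) auto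
    then have "Ck_on k (\<lambda>x. v * (inverse (sqrt x) * (1/2))) {0<..}" for v
      by (intro Ck_on_bounded_bilinear[OF _ bounded_bilinear_mult] Ck_on_const) auto
    then show ?case using * by (intro Ck_on_SucI) auto
  qed
  then show ?thesis by (auto simp: smooth_on_open_def)
qed

lemma smooth_on_open_sqrt[smooth_intros]:
  assumes "smooth_on_open f S" "\<And>x. x \<in> S \<Longrightarrow> f x > 0"
  shows "smooth_on_open (\<lambda>x. sqrt (f x)) S"
  by (rule smooth_on_open_compose[OF smooth_on_open_sqrt_at assms(1)]) (use assms(2) in auto)

lemma smooth_on_open_cis[smooth_intros]:
  assumes "smooth_on_open f S"
  shows "smooth_on_open (\<lambda>x. cis (f x)) S"
proof -
  have "Ck_on k (\<lambda>x. c * cis x) UNIV" for k c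
  proof (induction k arbitrary: c)
    case 0
    then show ?case by (auto intro!: continuous_intros)
  next
    case (Suc k)
    have *: "((\<lambda>x. c * cis x) has_derivative (\<lambda>h. (c * of_real h * \<i>) * cis x)) (at x)" for x
      by (auto intro!: derivative_eq_intros simp: scaleR_conv_of_real mult_ac)
    then show ?case using Suc by (intro Ck_on_SucI) auto
  qed
  from this[of _ 1] have "smooth_on_open cis UNIV"
    by (simp add: smooth_on_open_def)
  then show ?thesis
    by (rule smooth_on_open_compose[OF _ assms]) simp
qed

lemma smooth_on_open_det[smooth_intros]:
  fixes A :: "'a::euclidean_space \<Rightarrow> 'b::{real_normed_field,euclidean_space}^'n^'n"
  assumes "open S" "\<And>i j. smooth_on_open (\<lambda>x. A x $ i $ j) S"
  shows "smooth_on_open (\<lambda>x. det (A x)) S"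
  unfolding det_def by (intro smooth_intros assms)


subsection \<open>Symmetry of second derivatives\<close>

lemma has_real_derivative_along_line:
  fixes f :: "'a::euclidean_space \<Rightarrow> real"
  assumes "smooth_on_open f S" "y + r *\<^sub>R v \<in> S"
  shows "((\<lambda>r. f (y + r *\<^sub>R v)) has_real_derivative frechet_derivative f (at (y + r *\<^sub>R v)) v) (at r)"
proof -
  have lin: "linear (frechet_derivative f (at (y + r *\<^sub>R v)))"
    using smooth_on_open_differentiable[OF assms] by (rule linear_frechet_derivative)
  have "((\<lambda>r. y + r *\<^sub>R v) has_derivative (\<lambda>h. h *\<^sub>R v)) (at r)"
    by (auto intro!: derivative_eq_intros)
  from has_derivative_compose[OF this smooth_on_open_has_derivative[OF assms]]
  show ?thesis
    unfolding has_field_derivative_def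
    by (rule has_derivative_eq_rhs) (simp add: fun_eq_iff linear_scale[OF lin])
qed

text \<open>Two applications of the mean value theorem write the second difference of \<open>f\<close> over a
  parallelogram as a mixed second derivative at an intermediate point.\<close>

lemma second_difference_eq_second_derivative:
  fixes f :: "'a::euclidean_space \<Rightarrow> real"
  assumes f: "smooth_on_open f S" and "0 < s"
    and S: "\<And>a b. 0 \<le> a \<Longrightarrow> a \<le> s \<Longrightarrow> 0 \<le> b \<Longrightarrow> b \<le> s \<Longrightarrow> x + a *\<^sub>R v + b *\<^sub>R w \<in> S"
  obtains a b where "0 < a" "a < s" "0 < b" "b < s"
    "f (x + s *\<^sub>R v + s *\<^sub>R w) - f (x + s *\<^sub>R v) - f (x + s *\<^sub>R w) + f x =
       s\<^sup>2 * frechet_derivative (\<lambda>y. frechet_derivative f (at y) v) (at (x + a *\<^sub>R v + b *\<^sub>R w)) w"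
proof -
  let ?D = "\<lambda>y. frechet_derivative f (at y) v"
  have D: "smooth_on_open ?D S" using f by (rule smooth_on_open_derivative)
  have 1: "((\<lambda>r. f (x + r *\<^sub>R v + s *\<^sub>R w) - f (x + r *\<^sub>R v)) has_real_derivative
      ?D (x + r *\<^sub>R v + s *\<^sub>R w) - ?D (x + r *\<^sub>R v)) (at r)" if "0 \<le> r" "r \<le> s" for r
  proof (rule DERIV_diff)
    have "(x + s *\<^sub>R w) + r *\<^sub>R v \<in> S" using S[of r s] that \<open>0 < s\<close> by (simp add: algebra_simps)
    from has_real_derivative_along_line[OF f this]
    show "((\<lambda>r. f (x + r *\<^sub>R v + s *\<^sub>R w)) has_real_derivative ?D (x + r *\<^sub>R v + s *\<^sub>R w)) (at r)"
      by (simp add: algebra_simps)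
    show "((\<lambda>r. f (x + r *\<^sub>R v)) has_real_derivative ?D (x + r *\<^sub>R v)) (at r)"
      using S[of r 0] that \<open>0 < s\<close> by (intro has_real_derivative_along_line[OF f]) simp
  qed
  from MVT2[OF \<open>0 < s\<close> this] obtain a where a: "0 < a" "a < s"
    "f (x + s *\<^sub>R v + s *\<^sub>R w) - f (x + s *\<^sub>R v) - (f (x + s *\<^sub>R w) - f x) =
       s * (?D (x + a *\<^sub>R v + s *\<^sub>R w) - ?D (x + a *\<^sub>R v))"
    by auto
  have 2: "((\<lambda>r. ?D (x + a *\<^sub>R v + r *\<^sub>R w)) has_real_derivative
      frechet_derivative ?D (at (x + a *\<^sub>R v + r *\<^sub>R w)) w) (at r)" if "0 \<le> r" "r \<le> s" for r
    using S[of a r] that a by (intro has_real_derivative_along_line[OF D]) simp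
  from MVT2[OF \<open>0 < s\<close> this] obtain b where b: "0 < b" "b < s"
    "?D (x + a *\<^sub>R v + s *\<^sub>R w) - ?D (x + a *\<^sub>R v) =
       s * frechet_derivative ?D (at (x + a *\<^sub>R v + b *\<^sub>R w)) w"
    by auto
  show thesis
    using a b by (intro that[of a b]) (auto simp: power2_eq_square algebra_simps)
qed

text \<open>By continuity, both mixed derivatives are limits of the same second difference divided by \<open>s\<^sup>2\<close>.\<close>

lemma symmetric_second_derivative_real:
  fixes f :: "'a::euclidean_space \<Rightarrow> real"
  assumes f: "smooth_on_open f S" and "x \<in> S"
  shows "frechet_derivative (\<lambda>y. frechet_derivative f (at y) v) (at x) w =
         frechet_derivative (\<lambda>y. frechet_derivative f (at y) w) (at x) v" (is "?g v w x = ?g w v x")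
proof (rule ccontr)
  assume ne: "?g v w x \<noteq> ?g w v x"
  define e where "e = \<bar>?g v w x - ?g w v x\<bar> / 2"
  have "e > 0" using ne by (simp add: e_def)
  have "\<exists>d>0. \<forall>y. dist y x < d \<longrightarrow> dist (?g v w y) (?g v w x) < e" for v w
  proof -
    have "continuous_on S (?g v w)"
      by (intro smooth_on_open_continuous_on smooth_on_open_derivative f)
    then have "isCont (?g v w) x"
      using \<open>x \<in> S\<close> smooth_on_open_openD[OF f] continuous_on_eq_continuous_at by blast
    then show ?thesis using \<open>e > 0\<close> by (auto simp: continuous_at_eps_delta)
  qed
  then obtain d1 d2 where d: "d1 > 0" "d2 > 0"
      "\<And>y. dist y x < d1 \<Longrightarrow> dist (?g v w y) (?g v w x) < e"
      "\<And>y. dist y x < d2 \<Longrightarrow> dist (?g w v y) (?g w v x) < e"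
    by meson
  obtain d0 where d0: "d0 > 0" "ball x d0 \<subseteq> S"
    using smooth_on_open_openD[OF f] \<open>x \<in> S\<close> open_contains_ball by blast
  define d where "d = min d0 (min d1 d2)"
  define s where "s = d / (norm v + norm w + 1)"
  have pos: "norm v + norm w + 1 > 0" using norm_ge_zero[of v] norm_ge_zero[of w] by linarith
  have "s > 0" using d(1,2) d0(1) pos by (simp add: s_def d_def)
  have near: "dist (x + a *\<^sub>R v + b *\<^sub>R w) x < d" "dist (x + a *\<^sub>R w + b *\<^sub>R v) x < d"
    if "0 \<le> a" "a \<le> s" "0 \<le> b" "b \<le> s" for a b
  proof -
    have *: "dist (x + a *\<^sub>R v + b *\<^sub>R w) x < d" if "0 \<le> a" "a \<le> s" "0 \<le> b" "b \<le> s" for a b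
    proof -
      have "dist (x + a *\<^sub>R v + b *\<^sub>R w) x \<le> a * norm v + b * norm w"
        using norm_triangle_ineq[of "a *\<^sub>R v" "b *\<^sub>R w"] that by (simp add: dist_norm add.assoc)
      also have "\<dots> \<le> s * norm v + s * norm w"
        using that by (intro add_mono mult_right_mono) auto
      also have "\<dots> < s * (norm v + norm w + 1)" using \<open>s > 0\<close> by (simp add: algebra_simps)
      also have "\<dots> = d" using pos by (simp add: s_def)
      finally show ?thesis .
    qed
    show "dist (x + a *\<^sub>R v + b *\<^sub>R w) x < d" by (rule *) fact+
    have "dist (x + b *\<^sub>R v + a *\<^sub>R w) x < d" by (rule *) fact+
    then show "dist (x + a *\<^sub>R w + b *\<^sub>R v) x < d" by (simp add: algebra_simps)
  qed
  have inS: "y \<in> S" if "dist y x < d" for y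
    using that d0(2) by (auto simp: d_def dist_commute subset_iff)
  obtain a b where ab: "0 < a" "a < s" "0 < b" "b < s"
    "f (x + s *\<^sub>R v + s *\<^sub>R w) - f (x + s *\<^sub>R v) - f (x + s *\<^sub>R w) + f x = s\<^sup>2 * ?g v w (x + a *\<^sub>R v + b *\<^sub>R w)"
    using near(1) inS by (auto intro: second_difference_eq_second_derivative[OF f \<open>s > 0\<close>, of x v w])
  obtain a' b' where ab': "0 < a'" "a' < s" "0 < b'" "b' < s"
    "f (x + s *\<^sub>R w + s *\<^sub>R v) - f (x + s *\<^sub>R w) - f (x + s *\<^sub>R v) + f x = s\<^sup>2 * ?g w v (x + a' *\<^sub>R w + b' *\<^sub>R v)"
    using near(2) inS by (auto intro: second_difference_eq_second_derivative[OF f \<open>s > 0\<close>, of x w v])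
  have "s\<^sup>2 * ?g v w (x + a *\<^sub>R v + b *\<^sub>R w) = s\<^sup>2 * ?g w v (x + a' *\<^sub>R w + b' *\<^sub>R v)"
  proof -
    have "x + s *\<^sub>R v + s *\<^sub>R w = x + s *\<^sub>R w + s *\<^sub>R v" by (simp add: add_ac)
    from ab(5)[unfolded this] ab'(5) show ?thesis by linarith
  qed
  then have 1: "?g v w (x + a *\<^sub>R v + b *\<^sub>R w) = ?g w v (x + a' *\<^sub>R w + b' *\<^sub>R v)"
    using \<open>s > 0\<close> by simp
  have 2: "dist (?g v w (x + a *\<^sub>R v + b *\<^sub>R w)) (?g v w x) < e"
    using near(1)[of a b] ab by (intro d(3)) (simp add: d_def)
  have 3: "dist (?g w v (x + a' *\<^sub>R w + b' *\<^sub>R v)) (?g w v x) < e"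
    using near(2)[of a' b'] ab' by (intro d(4)) (simp add: d_def)
  have "False" if "P = Q" "dist P p < e" "dist Q q < e" "2 * e = \<bar>p - q\<bar>" for P Q p q :: real
    using that unfolding dist_real_def by linarith
  from this[OF 1 2 3] show False
    by (simp add: e_def)
qed

lemma frechet_derivative_linear_compose:
  assumes "bounded_linear h" "f differentiable (at x)"
  shows "frechet_derivative (\<lambda>y. h (f y)) (at x) v = h (frechet_derivative f (at x) v)"
proof -
  have "((\<lambda>y. h (f y)) has_derivative (\<lambda>v. h (frechet_derivative f (at x) v))) (at x)"
    by (rule bounded_linear.has_derivative[OF assms(1) assms(2)[unfolded frechet_derivative_works]])
  then show ?thesis by (simp add: frechet_derivative_eqI)
qed

lemma symmetric_second_derivative:
  fixes f :: "'a::euclidean_space \<Rightarrow> 'b::euclidean_space"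
  assumes f: "smooth_on_open f S" and "x \<in> S"
  shows "frechet_derivative (\<lambda>y. frechet_derivative f (at y) v) (at x) w =
         frechet_derivative (\<lambda>y. frechet_derivative f (at y) w) (at x) v"
proof (rule euclidean_eqI)
  fix b :: 'b assume "b \<in> Basis"
  have lin: "bounded_linear (\<lambda>z. z \<bullet> b)" by (rule bounded_linear_inner_left)
  have fb: "smooth_on_open (\<lambda>y. f y \<bullet> b) S"
    by (rule smooth_on_open_inner[OF f smooth_on_open_const[OF smooth_on_open_openD[OF f]]])
  have *: "frechet_derivative (\<lambda>y. frechet_derivative (\<lambda>y. f y \<bullet> b) (at y) v) (at x) w =
      frechet_derivative (\<lambda>y. frechet_derivative f (at y) v) (at x) w \<bullet> b" for v w
  proof -
    have "frechet_derivative (\<lambda>y. frechet_derivative (\<lambda>y. f y \<bullet> b) (at y) v) (at x) =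
        frechet_derivative (\<lambda>y. frechet_derivative f (at y) v \<bullet> b) (at x)"
    proof (rule frechet_derivative_transform_within_open)
      show "(\<lambda>y. frechet_derivative (\<lambda>y. f y \<bullet> b) (at y) v) differentiable at x"
        by (rule smooth_on_open_differentiable[OF smooth_on_open_derivative[OF fb] \<open>x \<in> S\<close>])
      show "frechet_derivative (\<lambda>y. f y \<bullet> b) (at y) v = frechet_derivative f (at y) v \<bullet> b" if "y \<in> S" for y
        by (rule frechet_derivative_linear_compose[OF lin smooth_on_open_differentiable[OF f that]])
    qed (use smooth_on_open_openD[OF f] \<open>x \<in> S\<close> in auto)
    then show ?thesis
      using smooth_on_open_differentiable[OF smooth_on_open_derivative[OF f] \<open>x \<in> S\<close>]
      by (simp add: frechet_derivative_linear_compose[OF lin])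
  qed
  show "frechet_derivative (\<lambda>y. frechet_derivative f (at y) v) (at x) w \<bullet> b =
        frechet_derivative (\<lambda>y. frechet_derivative f (at y) w) (at x) v \<bullet> b"
    using symmetric_second_derivative_real[OF fb \<open>x \<in> S\<close>, of v w] unfolding * .
qed

section \<open>Integration in Euclidean space\<close>

subsection \<open>Functions with compact support\<close>

lemma smooth_on_open_extend_zero:
  fixes f :: "'a::euclidean_space \<Rightarrow> 'b::real_normed_vector"
  assumes "smooth_on_open f U" "closed K" "K \<subseteq> U" "\<And>u. u \<in> U - K \<Longrightarrow> f u = 0"
  shows "smooth_on_open (\<lambda>u. if u \<in> U then f u else 0) UNIV"
proof (rule smooth_on_open_local[OF open_UNIV])
  fix x :: 'a
  show "\<exists>T. x \<in> T \<and> smooth_on_open (\<lambda>u. if u \<in> U then f u else 0) T"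
  proof (cases "x \<in> U")
    case True
    have "smooth_on_open (\<lambda>u. if u \<in> U then f u else 0) U"
      by (rule smooth_on_open_cong[OF assms(1)]) simp
    with True show ?thesis by blast
  next
    case False
    have "smooth_on_open (\<lambda>u. 0 :: 'b) (- K)"
      using assms(2) by (intro smooth_on_open_const) (simp add: open_Compl)
    then have "smooth_on_open (\<lambda>u. if u \<in> U then f u else 0) (- K)"
      by (rule smooth_on_open_cong) (use assms(4) in auto)
    with False assms(3) show ?thesis by blast
  qed
qed

lemma continuous_compact_support_integrable:
  fixes f :: "'a::euclidean_space \<Rightarrow> real"
  assumes "continuous_on UNIV f" "compact K" "\<And>u. u \<notin> K \<Longrightarrow> f u = 0"
  shows "f integrable_on UNIV"
proof -
  obtain a b where ab: "K \<subseteq> cbox a b"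
    using compact_imp_bounded[OF assms(2)] bounded_subset_cbox_symmetric by blast
  have "f integrable_on cbox a b"
    using continuous_on_subset[OF assms(1) subset_UNIV] by (rule integrable_continuous)
  then show ?thesis
    by (rule integrable_on_superset) (use ab assms(3) in auto)
qed

lemma continuous_compact_support_absolutely_integrable:
  fixes f :: "'a::euclidean_space \<Rightarrow> real"
  assumes "continuous_on UNIV f" "compact K" "\<And>u. u \<notin> K \<Longrightarrow> f u = 0"
  shows "f absolutely_integrable_on UNIV"
  unfolding absolutely_integrable_on_def
  using assms by (auto intro!: continuous_compact_support_integrable[of _ K] continuous_intros)

lemma integral_eq_cbox:
  fixes f :: "'a::euclidean_space \<Rightarrow> real"
  assumes "\<And>u. u \<notin> cbox a b \<Longrightarrow> f u = 0"
  shows "integral UNIV f = integral (cbox a b) f"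
proof -
  have "integral (cbox a b) f = integral UNIV (\<lambda>u. if u \<in> cbox a b then f u else 0)"
    by (rule integral_restrict_UNIV[symmetric])
  also have "\<dots> = integral UNIV f"
    by (rule integral_cong) (use assms in auto)
  finally show ?thesis ..
qed

subsection \<open>Differentiation under the integral sign\<close>

text \<open>By the tube lemma, \<open>W\<close> contains \<open>{t} \<times> K\<close> for all small \<open>t\<close>.  For these \<open>t\<close> the extension of the
  integrand by zero is smooth on the whole space, and the integral becomes one over a fixed box.\<close>

lemma leibniz_rule_compact_support:
  fixes q :: "real \<Rightarrow> 'a::euclidean_space \<Rightarrow> real"
  assumes smooth: "smooth_on_open (\<lambda>(t, u). q t u) W"
    and U: "open U" and K: "compact K" "K \<subseteq> U" "{0} \<times> K \<subseteq> W"
    and zero: "\<And>t u. u \<in> U - K \<Longrightarrow> q t u = 0"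
  shows "((\<lambda>t. integral U (q t)) has_real_derivative
      integral U (\<lambda>u. if u \<in> K then frechet_derivative (\<lambda>(t, u). q t u) (at (0, u)) (1, 0) else 0)) (at 0)"
proof -
  define Q where "Q z = (if snd z \<in> K then (\<lambda>(t, u). q t u) z else 0)" for z :: "real \<times> 'a"
  have "open W" using smooth by (rule smooth_on_open_openD)
  obtain X0 where X0: "0 \<in> X0" "open X0" "X0 \<times> K \<subseteq> W"
    using Elementary_Topology.tube_lemma[OF K(1) \<open>open W\<close> K(3)] by blast
  obtain \<delta> where \<delta>: "\<delta> > 0" "ball 0 \<delta> \<subseteq> X0"
    using X0 open_contains_ball by blast
  define I where "I = {-\<delta><..<\<delta>}"
  have I: "I \<subseteq> X0" "0 \<in> I" "open I" "convex I"
    using \<delta> by (auto simp: I_def subset_iff dist_real_def)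
  have Q: "smooth_on_open Q (I \<times> UNIV)"
  proof (rule smooth_on_open_local)
    show "open (I \<times> (UNIV :: 'a set))" using I by (intro open_Times) auto
    fix z :: "real \<times> 'a" assume z: "z \<in> I \<times> UNIV"
    show "\<exists>T. z \<in> T \<and> smooth_on_open Q T"
    proof (cases "snd z \<in> K")
      case True
      have "open (W \<inter> UNIV \<times> U)" using \<open>open W\<close> U by (intro open_Int open_Times open_UNIV)
      then have "smooth_on_open (\<lambda>(t, u). q t u) (W \<inter> UNIV \<times> U)"
        by (rule smooth_on_open_subset[OF smooth Int_lower1])
      then have "smooth_on_open Q (W \<inter> UNIV \<times> U)"
        by (rule smooth_on_open_cong) (use zero in \<open>auto simp: Q_def\<close>)
      moreover have "z \<in> W \<inter> UNIV \<times> U"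
      proof -
        have "fst z \<in> X0" using z I(1) by auto
        then have "z \<in> X0 \<times> K" using True by (simp add: mem_Times_iff)
        then have "z \<in> W" using X0(3) by (rule subsetD[rotated])
        moreover have "snd z \<in> U" using True K(2) by (rule subsetD[rotated])
        ultimately show ?thesis by (simp add: mem_Times_iff)
      qed
      ultimately show ?thesis by (intro exI[of _ "W \<inter> UNIV \<times> U"] conjI)
    next
      case False
      have "open (- K)" using K(1) by (simp add: compact_imp_closed open_Compl)
      then have "smooth_on_open (\<lambda>z. 0 :: real) ((UNIV :: real set) \<times> - K)"
        by (intro smooth_on_open_const open_Times open_UNIV)
      then have "smooth_on_open Q (UNIV \<times> - K)"
        by (rule smooth_on_open_cong) (auto simp: Q_def)
      moreover have "z \<in> UNIV \<times> - K" using False by (simp add: mem_Times_iff)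
      ultimately show ?thesis by (intro exI[of _ "UNIV \<times> - K"] conjI)
    qed
  qed
  let ?D = "\<lambda>z. frechet_derivative Q (at z) (1, 0)"
  obtain a b where ab: "K \<subseteq> cbox a b"
    using compact_imp_bounded[OF K(1)] bounded_subset_cbox_symmetric by blast
  have der: "((\<lambda>t. Q (t, u)) has_real_derivative ?D (t, u)) (at t)" if "t \<in> I" for t u
  proof -
    have lin: "linear (frechet_derivative Q (at (t, u)))"
      using that by (intro linear_frechet_derivative smooth_on_open_differentiable[OF Q]) auto
    have 1: "((\<lambda>t. (t, u)) has_derivative (\<lambda>h. (h, 0))) (at t)"
      by (auto intro!: derivative_eq_intros)
    have 2: "((\<lambda>t. Q (t, u)) has_derivative (\<lambda>h. frechet_derivative Q (at (t, u)) (h, 0))) (at t)"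
      using that by (intro has_derivative_compose[OF 1] smooth_on_open_has_derivative[OF Q]) auto
    have 3: "frechet_derivative Q (at (t, u)) (h, 0) = ?D (t, u) * h" for h
      using linear_scale[OF lin, of h "(1, 0)"] by simp
    show ?thesis
      unfolding has_field_derivative_def
      by (rule has_derivative_eq_rhs[OF 2]) (rule ext, rule 3)
  qed
  have leib: "((\<lambda>t. integral (cbox a b) (\<lambda>u. Q (t, u))) has_field_derivative
      integral (cbox a b) (\<lambda>u. ?D (0, u))) (at 0 within I)"
  proof (rule leibniz_rule_field_derivative)
    show "((\<lambda>t. Q (t, u)) has_real_derivative ?D (t, u)) (at t within I)" if "t \<in> I" for t u
      using der[OF that] by (rule has_field_derivative_at_within)
    show "(\<lambda>u. Q (t, u)) integrable_on cbox a b" if "t \<in> I" for t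
    proof (rule integrable_continuous)
      show "continuous_on (cbox a b) (\<lambda>u. Q (t, u))"
        using that
        by (intro continuous_on_compose2[OF smooth_on_open_continuous_on[OF Q]] continuous_intros) auto
    qed
    show "continuous_on (I \<times> cbox a b) (\<lambda>(t, u). ?D (t, u))"
      using smooth_on_open_continuous_on[OF smooth_on_open_derivative[OF Q, of "(1, 0)"]]
      by (rule continuous_on_subset[THEN continuous_on_eq]) auto
  qed (use I in auto)
  have "((\<lambda>t. integral (cbox a b) (\<lambda>u. Q (t, u))) has_field_derivative
      integral (cbox a b) (\<lambda>u. ?D (0, u))) (at 0)"
    using leib unfolding at_within_open[OF I(2,3)] .
  moreover have "integral U (q t) = integral (cbox a b) (\<lambda>u. Q (t, u))" for t
  proof -
    have "integral U (q t) = integral UNIV (\<lambda>u. if u \<in> U then q t u else 0)"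
      by (rule integral_restrict_UNIV[symmetric])
    also have "\<dots> = integral UNIV (\<lambda>u. Q (t, u))"
      by (rule integral_cong) (use zero K(2) in \<open>auto simp: Q_def\<close>)
    also have "\<dots> = integral (cbox a b) (\<lambda>u. Q (t, u))"
      by (rule integral_eq_cbox) (use ab in \<open>auto simp: Q_def\<close>)
    finally show ?thesis .
  qed
  moreover have "integral (cbox a b) (\<lambda>u. ?D (0, u)) = integral U (\<lambda>u. if u \<in> K then frechet_derivative (\<lambda>(t, u). q t u) (at (0, u)) (1, 0) else 0)"
  proof -
    have "?D (0, u) = (if u \<in> K then frechet_derivative (\<lambda>(t, u). q t u) (at (0, u)) (1, 0) else 0)" for u
    proof (cases "u \<in> K")
      case True
      have "frechet_derivative (\<lambda>(t, u). q t u) (at (0, u)) = frechet_derivative Q (at (0, u))"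
      proof (rule frechet_derivative_transform_within_open)
        show "(\<lambda>(t, u). q t u) differentiable at (0, u)"
          using True K(3) by (intro smooth_on_open_differentiable[OF smooth]) auto
        show "open (W \<inter> UNIV \<times> U)" using \<open>open W\<close> U by (intro open_Int open_Times) auto
        show "(0, u) \<in> W \<inter> UNIV \<times> U" using True K by auto
        show "(\<lambda>(t, u). q t u) z = Q z" if "z \<in> W \<inter> UNIV \<times> U" for z
          using that zero by (auto simp: Q_def)
      qed
      with True show ?thesis by simp
    next
      case False
      have "((\<lambda>t. Q (t, u)) has_real_derivative 0) (at 0)"
        using False by (simp add: Q_def)
      with der[OF I(2)] have "?D (0, u) = 0" by (rule DERIV_unique)
      with False show ?thesis by simp
    qed
    then have "integral (cbox a b) (\<lambda>u. ?D (0, u)) = integral (cbox a b)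
        (\<lambda>u. if u \<in> K then frechet_derivative (\<lambda>(t, u). q t u) (at (0, u)) (1, 0) else 0)"
      by simp
    also have "\<dots> = integral UNIV (\<lambda>u. if u \<in> K then frechet_derivative (\<lambda>(t, u). q t u) (at (0, u)) (1, 0) else 0)"
      by (rule integral_eq_cbox[symmetric]) (use ab in auto)
    also have "\<dots> = integral UNIV (\<lambda>u. if u \<in> U then if u \<in> K then frechet_derivative (\<lambda>(t, u). q t u) (at (0, u)) (1, 0) else 0 else 0)"
      by (rule integral_cong) (use K(2) in auto)
    also have "\<dots> = integral U (\<lambda>u. if u \<in> K then frechet_derivative (\<lambda>(t, u). q t u) (at (0, u)) (1, 0) else 0)"
      by (rule integral_restrict_UNIV)
    finally show ?thesis .
  qed
  ultimately show ?thesis by simp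
qed

text \<open>The integral of a translate of \<open>h\<close> does not depend on the translation.\<close>

lemma integral_derivative_compact_support:
  fixes h :: "'a::euclidean_space \<Rightarrow> real"
  assumes h: "smooth_on_open h UNIV" and K: "compact K" "\<And>u. u \<notin> K \<Longrightarrow> h u = 0"
  shows "integral UNIV (\<lambda>u. frechet_derivative h (at u) v) = 0"
proof -
  let ?D = "\<lambda>u. frechet_derivative h (at u) v"
  obtain B where B: "\<And>u. u \<in> K \<Longrightarrow> norm u \<le> B"
    using compact_imp_bounded[OF K(1)] by (auto simp: bounded_iff)
  obtain c where c: "cball (0 :: 'a) (B + norm v) \<subseteq> cbox (-c) c"
    using bounded_subset_cbox_symmetric[OF bounded_cball] by blast
  define I where "I = {-1<..<1 :: real}"
  have out: "h (u + s *\<^sub>R v) = 0" if "u \<notin> cbox (-c) c" "s \<in> I" for u s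
  proof (rule K(2), rule notI)
    assume "u + s *\<^sub>R v \<in> K"
    then have "norm (u + s *\<^sub>R v) \<le> B" by (rule B)
    moreover have "norm (s *\<^sub>R v) \<le> norm v"
      using that(2) by (auto simp: I_def mult_left_le_one_le)
    ultimately have "norm u \<le> B + norm v"
      using norm_triangle_ineq4[of "u + s *\<^sub>R v" "s *\<^sub>R v"] by simp
    then show False using that(1) c by (auto simp: subset_iff)
  qed
  have der: "((\<lambda>s. h (u + s *\<^sub>R v)) has_real_derivative ?D (u + s *\<^sub>R v)) (at s)" for u s
    by (rule has_real_derivative_along_line[OF h]) simp
  have 0: "((\<lambda>s. integral (cbox (-c) c) (\<lambda>u. h (u + s *\<^sub>R v))) has_field_derivative
      integral (cbox (-c) c) (\<lambda>u. ?D (u + 0 *\<^sub>R v))) (at 0 within I)"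
  proof (rule leibniz_rule_field_derivative)
    show "((\<lambda>s. h (u + s *\<^sub>R v)) has_real_derivative ?D (u + s *\<^sub>R v)) (at s within I)" for s u
      using der by (rule has_field_derivative_at_within)
    show "(\<lambda>u. h (u + s *\<^sub>R v)) integrable_on cbox (-c) c" for s
      by (intro integrable_continuous continuous_on_compose2[OF smooth_on_open_continuous_on[OF h]]
          continuous_intros) auto
    show "continuous_on (I \<times> cbox (-c) c) (\<lambda>(s, u). ?D (u + s *\<^sub>R v))"
      unfolding split_beta
      by (intro continuous_on_compose2[OF smooth_on_open_continuous_on[OF smooth_on_open_derivative[OF h]]]
          continuous_intros) auto
  qed (auto simp: I_def)
  have 1: "((\<lambda>s. integral (cbox (-c) c) (\<lambda>u. h (u + s *\<^sub>R v))) has_field_derivative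
      integral (cbox (-c) c) ?D) (at 0)"
  proof -
    have "at 0 within I = at 0" by (rule at_within_open) (auto simp: I_def)
    with 0 show ?thesis by (simp only: scaleR_zero_left add_0_right)
  qed
  have const: "integral (cbox (-c) c) (\<lambda>u. h (u + s *\<^sub>R v)) = integral UNIV h" if "s \<in> I" for s
  proof -
    have "integral (cbox (-c) c) (\<lambda>u. h (u + s *\<^sub>R v)) = integral (cbox (-c) c) (h \<circ> ((+) (s *\<^sub>R v)))"
      by (simp add: o_def add.commute)
    also have "\<dots> = integral (cbox (-c + s *\<^sub>R v) (c + s *\<^sub>R v)) h"
      by (rule integral_shift_cbox_plus)
    also have "\<dots> = integral UNIV h"
    proof (rule integral_eq_cbox[symmetric])
      fix u assume "u \<notin> cbox (-c + s *\<^sub>R v) (c + s *\<^sub>R v)"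
      then have "u - s *\<^sub>R v \<notin> cbox (-c) c"
        by (auto simp: mem_box algebra_simps)
      from out[OF this that] show "h u = 0" by simp
    qed
    finally show ?thesis .
  qed
  have "((\<lambda>s. integral (cbox (-c) c) (\<lambda>u. h (u + s *\<^sub>R v))) has_field_derivative 0) (at 0)"
  proof (rule has_field_derivative_transform_within_open)
    show "((\<lambda>s. integral UNIV h) has_field_derivative 0) (at 0)" by simp
    show "integral UNIV h = integral (cbox (-c) c) (\<lambda>u. h (u + s *\<^sub>R v))" if "s \<in> I" for s
      using const[OF that] by (rule sym)
  qed (simp_all add: I_def)
  then have "integral (cbox (-c) c) ?D = 0"
    using 1 DERIV_unique by blast
  moreover have "integral UNIV ?D = integral (cbox (-c) c) ?D"
  proof (rule integral_eq_cbox)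
    fix u assume "u \<notin> cbox (-c) c"
    have "((\<lambda>s. h (u + s *\<^sub>R v)) has_field_derivative 0) (at 0)"
    proof (rule has_field_derivative_transform_within_open)
      show "((\<lambda>s :: real. 0 :: real) has_field_derivative 0) (at 0)" by simp
      show "0 = h (u + s *\<^sub>R v)" if "s \<in> I" for s
        using out[OF \<open>u \<notin> cbox (-c) c\<close> that] by simp
    qed (simp_all add: I_def)
    from DERIV_unique[OF der[of u 0] this] show "?D u = 0" by simp
  qed
  ultimately show ?thesis by simp
qed

subsection \<open>Change of variables\<close>

text \<open>A copy of a finite type, well-ordered by an enumeration.  Relabelling the coordinates preserves
  boxes and their contents, hence integrals.  In this way the change of variables theorem for
  well-ordered index types carries over to all finite ones.\<close>

typedef 'n enumerated = "UNIV :: 'n set" ..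

instance enumerated :: (finite) finite
proof
  have "(UNIV :: 'a enumerated set) = Abs_enumerated ` UNIV"
    by (metis Rep_enumerated_inverse UNIV_eq_I rangeI)
  then show "finite (UNIV :: 'a enumerated set)" by (metis finite finite_imageI)
qed

definition enumeration_index :: "'n::finite enumerated \<Rightarrow> nat" where
  "enumeration_index = (SOME f. inj f)"

lemma inj_enumeration_index: "inj (enumeration_index :: 'n::finite enumerated \<Rightarrow> nat)"
proof -
  have "\<exists>f :: 'n enumerated \<Rightarrow> nat. inj f"
    using finite_imp_inj_to_nat_seg[of "UNIV :: 'n enumerated set"] by auto
  then show ?thesis unfolding enumeration_index_def by (rule someI_ex)
qed

instantiation enumerated :: (finite) wellorder
begin

definition less_eq_enumerated :: "'a enumerated \<Rightarrow> 'a enumerated \<Rightarrow> bool" where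
  "less_eq_enumerated x y \<longleftrightarrow> enumeration_index x \<le> enumeration_index y"

definition less_enumerated :: "'a enumerated \<Rightarrow> 'a enumerated \<Rightarrow> bool" where
  "less_enumerated x y \<longleftrightarrow> enumeration_index x < enumeration_index y"

instance
proof
  fix P :: "'a enumerated \<Rightarrow> bool" and a
  assume "\<And>x. (\<And>y. y < x \<Longrightarrow> P y) \<Longrightarrow> P x"
  then show "P a"
    unfolding less_enumerated_def
    by (induction a rule: measure_induct_rule[of enumeration_index]) blast
qed (auto simp: less_eq_enumerated_def less_enumerated_def dest: injD[OF inj_enumeration_index])

end

definition relabel :: "real^'n::finite \<Rightarrow> real^'n enumerated" where
  "relabel x = (\<chi> i. x $ Rep_enumerated i)"

definition unlabel :: "real^'n enumerated \<Rightarrow> real^'n::finite" where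
  "unlabel x = (\<chi> i. x $ Abs_enumerated i)"

lemma relabel_unlabel [simp]: "relabel (unlabel x) = x"
  by (simp add: relabel_def unlabel_def vec_eq_iff Rep_enumerated_inverse)

lemma unlabel_relabel [simp]: "unlabel (relabel x) = x"
  by (simp add: relabel_def unlabel_def vec_eq_iff Abs_enumerated_inverse)

lemma linear_relabel: "linear relabel"
  by (intro linearI) (simp_all add: relabel_def vec_eq_iff)

lemma linear_unlabel: "linear unlabel"
  by (intro linearI) (simp_all add: unlabel_def vec_eq_iff)

lemma bij_Rep_enumerated: "bij Rep_enumerated"
  by (metis Abs_enumerated_inverse Rep_enumerated_inverse UNIV_I bijI')

lemma bij_Abs_enumerated: "bij Abs_enumerated"
  by (metis Abs_enumerated_inverse Rep_enumerated_inverse UNIV_I bijI')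

lemma relabel_cbox: "relabel ` cbox a b = cbox (relabel a) (relabel b)"
proof -
  have "relabel x \<in> cbox (relabel a) (relabel b) \<longleftrightarrow> x \<in> cbox a b" for x
  proof -
    have "(\<forall>i. P (Rep_enumerated i)) \<longleftrightarrow> (\<forall>k. P k)" for P :: "'a \<Rightarrow> bool"
      by (metis Abs_enumerated_inverse UNIV_I)
    then show ?thesis by (simp add: mem_box_cart relabel_def)
  qed
  then show ?thesis
    by (auto simp: image_iff) (metis relabel_unlabel)
qed

lemma unlabel_cbox: "unlabel ` cbox a b = cbox (unlabel a) (unlabel b)"
proof -
  have "unlabel ` cbox a b = unlabel ` relabel ` cbox (unlabel a) (unlabel b)"
    by (simp add: relabel_cbox)
  then show ?thesis by (simp add: image_image)
qed

lemma content_unlabel_cbox: "measure lborel (cbox (unlabel a) (unlabel b)) = measure lborel (cbox a b)"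
proof -
  have "(\<Prod>i\<in>UNIV. unlabel b $ i - unlabel a $ i) = (\<Prod>i\<in>UNIV. b $ i - a $ i)"
    unfolding unlabel_def
    using prod.reindex_bij_betw[OF bij_Abs_enumerated[unfolded bij_betw_def[symmetric]], of "\<lambda>i. b $ i - a $ i"]
    by simp
  moreover have "cbox (unlabel a) (unlabel b) = {} \<longleftrightarrow> cbox a b = {}"
    using unlabel_cbox[of a b] by auto
  ultimately show ?thesis
    by (simp add: content_cbox_if_cart)
qed

lemma norm_unlabel: "norm (unlabel x) = norm x"
proof -
  have "(\<Sum>i\<in>UNIV. (unlabel x $ i)\<^sup>2) = (\<Sum>i\<in>UNIV. (x $ i)\<^sup>2)"
    unfolding unlabel_def
    using sum.reindex_bij_betw[OF bij_Abs_enumerated, of "\<lambda>i. (x $ i)\<^sup>2"] by simp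
  then show ?thesis by (simp add: norm_vec_def L2_set_def)
qed

lemma norm_relabel: "norm (relabel x) = norm x"
  using norm_unlabel[of "relabel x"] by simp

lemma has_integral_unlabel_cbox:
  fixes f :: "real^'n::finite \<Rightarrow> real"
  assumes "(f has_integral i) (cbox (unlabel a) (unlabel b))"
  shows "((\<lambda>x. f (unlabel x)) has_integral i) (cbox a b)"
proof -
  have "((\<lambda>x. f (unlabel x)) has_integral (1 / 1) *\<^sub>R i) (relabel ` cbox (unlabel a) (unlabel b))"
  proof (rule has_integral_twiddle)
    show "continuous (at x) unlabel" for x
      by (simp add: linear_continuous_at linear_conv_bounded_linear[symmetric] linear_unlabel)
    show "measure lborel (unlabel ` cbox u v) = 1 * measure lborel (cbox u v)" for u v :: "real^'n enumerated"
      by (simp add: unlabel_cbox content_unlabel_cbox)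
  qed (use assms in \<open>auto simp: unlabel_cbox relabel_cbox\<close>)
  then show ?thesis by (simp add: relabel_cbox)
qed

lemma has_integral_relabel_cbox:
  fixes f :: "real^'n::finite enumerated \<Rightarrow> real"
  assumes "(f has_integral i) (cbox (relabel a) (relabel b))"
  shows "((\<lambda>x. f (relabel x)) has_integral i) (cbox a b)"
proof -
  have "((\<lambda>x. f (relabel x)) has_integral (1 / 1) *\<^sub>R i) (unlabel ` cbox (relabel a) (relabel b))"
  proof (rule has_integral_twiddle)
    show "continuous (at x) relabel" for x
      by (simp add: linear_continuous_at linear_conv_bounded_linear[symmetric] linear_relabel)
    show "measure lborel (relabel ` cbox u v) = 1 * measure lborel (cbox u v)" for u v :: "real^'n"
      using content_unlabel_cbox[of "relabel u" "relabel v"] by (simp add: relabel_cbox)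
  qed (use assms in \<open>auto simp: unlabel_cbox relabel_cbox\<close>)
  then show ?thesis by (simp add: unlabel_cbox)
qed

lemma has_integral_unlabel_iff:
  fixes f :: "real^'n::finite \<Rightarrow> real"
  shows "((\<lambda>x. f (unlabel x)) has_integral i) (relabel ` S) \<longleftrightarrow> (f has_integral i) S"
proof -
  have mem: "x \<in> relabel ` S \<longleftrightarrow> unlabel x \<in> S" for x
    by (metis image_iff relabel_unlabel unlabel_relabel)
  have 1: "((\<lambda>x. if x \<in> relabel ` S then f (unlabel x) else 0) has_integral i) (cbox a b) \<longleftrightarrow>
      ((\<lambda>x. if x \<in> S then f x else 0) has_integral i) (cbox (unlabel a) (unlabel b))" for a b i
    using has_integral_unlabel_cbox[of "\<lambda>x. if x \<in> S then f x else 0" i a b]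
      has_integral_relabel_cbox[of "\<lambda>x. if x \<in> relabel ` S then f (unlabel x) else 0" i "unlabel a" "unlabel b"]
    by (auto simp: mem cong: if_cong)
  have ball: "ball 0 B \<subseteq> cbox a b \<longleftrightarrow> ball 0 B \<subseteq> cbox (unlabel a) (unlabel b)" for B and a b :: "real^'n enumerated"
  proof -
    have *: "ball (0 :: real^'n) B = unlabel ` ball 0 B"
    proof (intro set_eqI iffI)
      fix x :: "real^'n" assume "x \<in> ball 0 B"
      then have "relabel x \<in> ball 0 B" by (simp add: norm_relabel)
      then have "unlabel (relabel x) \<in> unlabel ` ball 0 B" by (rule imageI)
      then show "x \<in> unlabel ` ball 0 B" by (simp only: unlabel_relabel)
    next
      fix x :: "real^'n" assume "x \<in> unlabel ` ball 0 B"
      then show "x \<in> ball 0 B" by (elim imageE) (simp add: norm_unlabel)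
    qed
    have "inj (unlabel :: real^'n enumerated \<Rightarrow> real^'n)"
      by (rule inj_on_inverseI[of _ relabel]) simp
    then show ?thesis
      unfolding * unlabel_cbox[symmetric] by (simp add: inj_image_subset_iff)
  qed
  have all: "(\<forall>a b. P (unlabel a) (unlabel b)) \<longleftrightarrow> (\<forall>a b. P a b)" for P :: "real^'n \<Rightarrow> real^'n \<Rightarrow> bool"
    by (metis unlabel_relabel)
  have "(\<forall>a b. ball 0 B \<subseteq> cbox a b \<longrightarrow>
       (\<exists>z. ((\<lambda>x. if x \<in> relabel ` S then f (unlabel x) else 0) has_integral z) (cbox a b) \<and> norm (z - i) < e)) \<longleftrightarrow>
     (\<forall>a b. ball 0 B \<subseteq> cbox a b \<longrightarrow>
       (\<exists>z. ((\<lambda>x. if x \<in> S then f x else 0) has_integral z) (cbox a b) \<and> norm (z - i) < e))" for B e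
    unfolding 1 ball by (rule all)
  then show ?thesis
    unfolding has_integral'[of _ _ S] has_integral'[of _ _ "relabel ` S"] by simp
qed

lemma integrable_unlabel_iff:
  fixes f :: "real^'n::finite \<Rightarrow> real"
  shows "(\<lambda>x. f (unlabel x)) integrable_on (relabel ` S) \<longleftrightarrow> f integrable_on S"
  unfolding integrable_on_def by (simp add: has_integral_unlabel_iff)

lemma absolutely_integrable_unlabel_iff:
  fixes f :: "real^'n::finite \<Rightarrow> real"
  shows "(\<lambda>x. f (unlabel x)) absolutely_integrable_on (relabel ` S) \<longleftrightarrow> f absolutely_integrable_on S"
  unfolding absolutely_integrable_on_def
  using integrable_unlabel_iff[of f S] integrable_unlabel_iff[of "\<lambda>x. norm (f x)" S] by simp

lemma integral_unlabel:
  fixes f :: "real^'n::finite \<Rightarrow> real"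
  shows "integral (relabel ` S) (\<lambda>x. f (unlabel x)) = integral S f"
  unfolding integral_def by (simp add: has_integral_unlabel_iff integrable_unlabel_iff)

text \<open>Conjugation by \<open>f\<close> is a bijection between the permutations of the two index types, and it preserves
  signs.\<close>

lemma det_reindex:
  fixes A :: "'a::comm_ring_1^'n::finite^'n" and f :: "'m::finite \<Rightarrow> 'n"
  assumes "bij f"
  shows "det (\<chi> i j. A $ f i $ f j) = det A"
proof -
  have inj: "inj f" "inj (inv f)" and f: "f (inv f x) = x" "inv f (f y) = y" for x y
    using assms by (auto simp: bij_is_inj bij_imp_bij_inv surj_f_inv_f bij_is_surj)
  have 1: "map_permutation UNIV f p = f \<circ> p \<circ> inv f" for p
    using bij_is_surj[OF assms] by (simp add: map_permutation_def fun_eq_iff)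
  have 2: "map_permutation UNIV (inv f) p = inv f \<circ> p \<circ> f" for p
    using bij_is_surj[OF bij_imp_bij_inv[OF assms]] inv_inv_eq[OF assms]
    by (simp add: map_permutation_def fun_eq_iff)
  have perm: "map_permutation UNIV f p permutes UNIV" if "p permutes UNIV" for p
    using assms that by (rule map_permutation_permutes)
  have perm': "map_permutation UNIV (inv f) p permutes UNIV" if "p permutes UNIV" for p
    using bij_imp_bij_inv[OF assms] that by (rule map_permutation_permutes)
  have "(\<Prod>i\<in>UNIV. A $ f i $ f (p i)) = (\<Prod>i\<in>UNIV. A $ i $ map_permutation UNIV f p i)" for p
    using prod.reindex_bij_betw[OF assms, of "\<lambda>i. A $ i $ map_permutation UNIV f p i"]
    by (simp add: 1 f)
  then have "det (\<chi> i j. A $ f i $ f j) = (\<Sum>p\<in>{p. p permutes UNIV}. of_int (sign (map_permutation UNIV f p)) *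
      (\<Prod>i\<in>UNIV. A $ i $ map_permutation UNIV f p i))"
    unfolding det_def using inj(1) by (intro sum.cong refl) (simp add: sign_map_permutation)
  also have "\<dots> = det A"
    unfolding det_def
    by (rule sum.reindex_bij_witness[where i = "map_permutation UNIV (inv f)" and j = "map_permutation UNIV f"])
       (auto simp: perm perm', auto simp: 1 2 fun_eq_iff f)
  finally show ?thesis .
qed

theorem change_of_variables:
  fixes f :: "real^'n::finite \<Rightarrow> real" and g :: "real^'n \<Rightarrow> real^'n"
  assumes "open S" and der: "\<And>x. x \<in> S \<Longrightarrow> (g has_derivative g' x) (at x)" and inj: "inj_on g S"
    and int: "(\<lambda>x. \<bar>det (matrix (g' x))\<bar> * f (g x)) absolutely_integrable_on S"
  shows "integral (g ` S) f = integral S (\<lambda>x. \<bar>det (matrix (g' x))\<bar> * f (g x))"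
proof -
  let ?S = "relabel ` S"
  define G where "G x = relabel (g (unlabel x))" for x
  define G' where "G' x v = relabel (g' (unlabel x) (unlabel v))" for x v
  define F :: "real^'n enumerated \<Rightarrow> real^1" where "F x = vec (f (unlabel x))" for x
  have "?S = unlabel -` S"
    by (auto simp: image_iff) (metis relabel_unlabel)
  then have "open ?S"
    using \<open>open S\<close> by (simp add: continuous_open_vimage linear_continuous_at linear_conv_bounded_linear[symmetric] linear_unlabel)
  then have S: "?S \<in> sets lebesgue" by (simp add: borel_open)
  have derG: "(G has_derivative G' x) (at x within ?S)" if "x \<in> ?S" for x
  proof -
    have bl: "bounded_linear (unlabel :: real^'n enumerated \<Rightarrow> real^'n)" "bounded_linear (relabel :: real^'n \<Rightarrow> _)"
      by (simp_all add: linear_conv_bounded_linear[symmetric] linear_unlabel linear_relabel)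
    have "unlabel x \<in> S" using that by auto
    have "((\<lambda>x. g (unlabel x)) has_derivative (\<lambda>v. g' (unlabel x) (unlabel v))) (at x within ?S)"
      by (rule has_derivative_compose[OF bounded_linear_imp_has_derivative[OF bl(1)] der[OF \<open>unlabel x \<in> S\<close>]])
    then show ?thesis
      unfolding G_def G'_def by (rule bounded_linear.has_derivative[OF bl(2)])
  qed
  have injG: "inj_on G ?S"
    using inj by (auto simp: inj_on_def G_def) (metis unlabel_relabel)
  have lin: "linear (g' x)" if "x \<in> S" for x
    using der[OF that] by (rule has_derivative_linear)
  have det: "det (matrix (G' x)) = det (matrix (g' (unlabel x)))" for x
  proof -
    have ax: "unlabel (axis j 1) = axis (Rep_enumerated j) 1" for j
      by (auto simp: unlabel_def axis_def vec_eq_iff Abs_enumerated_inverse Rep_enumerated_inverse)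
    have "matrix (G' x) = (\<chi> i j. matrix (g' (unlabel x)) $ Rep_enumerated i $ Rep_enumerated j)"
      by (simp add: matrix_def G'_def ax relabel_def vec_eq_iff)
    then show ?thesis by (simp add: det_reindex[OF bij_Rep_enumerated])
  qed
  let ?h = "\<lambda>x. \<bar>det (matrix (g' x))\<bar> * f (g x)"
  have h: "\<bar>det (matrix (G' x))\<bar> *\<^sub>R F (G x) = vec (?h (unlabel x))" for x
    by (simp add: det F_def G_def vec_eq_iff)
  have abs: "(\<lambda>x. \<bar>det (matrix (G' x))\<bar> *\<^sub>R F (G x)) absolutely_integrable_on ?S"
    unfolding h absolutely_integrable_on_1_iff
    using absolutely_integrable_unlabel_iff[of S ?h, THEN iffD2, OF int] by simp
  have val: "integral ?S (\<lambda>x. \<bar>det (matrix (G' x))\<bar> *\<^sub>R F (G x)) = vec (integral S ?h)"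
    unfolding h integral_on_1_eq using integral_unlabel[of S ?h] by simp
  have "integral (G ` ?S) F = vec (integral S ?h)"
    using has_absolute_integral_change_of_variables[OF S derG injG, of F "vec (integral S ?h)"] abs val by blast
  moreover have "G ` ?S = relabel ` g ` S"
    by (auto simp: G_def image_image)
  moreover have "integral (relabel ` g ` S) F = vec (integral (g ` S) f)"
    unfolding F_def integral_on_1_eq by (simp add: integral_unlabel)
  ultimately show ?thesis by (simp add: vec_eq_iff)
qed

section \<open>Charts of a submanifold\<close>

lemma local_paramD:
  assumes "local_param M U \<phi>"
  shows "smooth_on_open \<phi> U" "open U" "continuous_on U \<phi>" "inj_on \<phi> U" "\<phi> ` U \<subseteq> M"
    and "\<And>u. u \<in> U \<Longrightarrow> inj (frechet_derivative \<phi> (at u))"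
    and "continuous_on (\<phi> ` U) (inv_into U \<phi>)"
    and "\<exists>T. open T \<and> \<phi> ` U = M \<inter> T"
proof -
  show 1: "smooth_on_open \<phi> U" and "\<And>u. u \<in> U \<Longrightarrow> inj (frechet_derivative \<phi> (at u))"
    using assms by (auto simp: local_param_def)
  show "open U" "continuous_on U \<phi>"
    using 1 smooth_on_open_openD smooth_on_open_continuous_on by blast+
  show "\<phi> ` U \<subseteq> M"
    using assms unfolding local_param_def by (metis openin_subset topspace_euclidean_subtopology)
  show "\<exists>T. open T \<and> \<phi> ` U = M \<inter> T"
    using assms unfolding local_param_def openin_open by blast
  obtain \<psi> where \<psi>: "homeomorphism U (\<phi> ` U) \<phi> \<psi>"
    using assms unfolding local_param_def by blast
  show inj: "inj_on \<phi> U"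
    by (rule inj_on_inverseI[of _ \<psi>]) (rule homeomorphism_apply1[OF \<psi>])
  have "continuous_on (\<phi> ` U) \<psi>" using \<psi> by (rule homeomorphism_cont2)
  then show "continuous_on (\<phi> ` U) (inv_into U \<phi>)"
    by (rule continuous_on_eq) (use homeomorphism_apply1[OF \<psi>] inj in auto)
qed

lemma smooth_map_chart:
  assumes f: "smooth_map f M" and c: "local_param M U \<phi>"
  shows "smooth_on_open (\<lambda>u. f (\<phi> u)) U"
proof (rule smooth_on_open_local)
  show "open U" by (rule local_paramD[OF c])
  fix u assume u: "u \<in> U"
  then have "\<phi> u \<in> M" using local_paramD(5)[OF c] by blast
  then obtain V g where V: "\<phi> u \<in> V" "smooth_on_open g V" "\<And>y. y \<in> V \<inter> M \<Longrightarrow> g y = f y"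
    using f unfolding smooth_map_def by metis
  have "open (U \<inter> \<phi> -` V)"
    by (rule continuous_open_preimage[OF local_paramD(3,2)[OF c] smooth_on_open_openD[OF V(2)]])
  then have "smooth_on_open (\<lambda>u. g (\<phi> u)) (U \<inter> \<phi> -` V)"
    by (intro smooth_on_open_compose[OF V(2)] smooth_on_open_subset[OF local_paramD(1)[OF c]]) auto
  then have "smooth_on_open (\<lambda>u. f (\<phi> u)) (U \<inter> \<phi> -` V)"
    by (rule smooth_on_open_cong) (use V(3) local_paramD(5)[OF c] in auto)
  moreover have "u \<in> U \<inter> \<phi> -` V" using u V(1) by simp
  ultimately show "\<exists>T. u \<in> T \<and> smooth_on_open (\<lambda>u. f (\<phi> u)) T"
    by (intro exI[of _ "U \<inter> \<phi> -` V"] conjI)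
qed

lemma frechet_derivative_extension:
  assumes c: "local_param M U \<phi>" and "u \<in> U" and V: "\<phi> u \<in> V" "smooth_on_open g V" "\<And>y. y \<in> V \<inter> M \<Longrightarrow> g y = f y"
  shows "frechet_derivative (\<lambda>u. f (\<phi> u)) (at u) v = frechet_derivative g (at (\<phi> u)) (frechet_derivative \<phi> (at u) v)"
proof -
  have op: "open (U \<inter> \<phi> -` V)"
    by (rule continuous_open_preimage[OF local_paramD(3,2)[OF c] smooth_on_open_openD[OF V(2)]])
  have "((\<lambda>u. g (\<phi> u)) has_derivative (\<lambda>v. frechet_derivative g (at (\<phi> u)) (frechet_derivative \<phi> (at u) v))) (at u)"
    by (rule has_derivative_compose[OF smooth_on_open_has_derivative[OF local_paramD(1)[OF c] \<open>u \<in> U\<close>]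
          smooth_on_open_has_derivative[OF V(2,1)]])
  then have "((\<lambda>u. f (\<phi> u)) has_derivative (\<lambda>v. frechet_derivative g (at (\<phi> u)) (frechet_derivative \<phi> (at u) v))) (at u)"
    by (rule has_derivative_transform_within_open[OF _ op]) (use assms local_paramD(5)[OF c] in auto)
  then show ?thesis by (simp add: frechet_derivative_eqI)
qed

text \<open>Near the common point both composites are composites with one smooth map of the ambient space.\<close>

lemma frechet_derivative_change_of_charts:
  assumes f: "smooth_map f M" and c: "local_param M U \<phi>" and c': "local_param M U' \<phi>'"
    and u: "u \<in> U" "u' \<in> U'" "\<phi> u = \<phi>' u'"
    and L: "\<And>v. frechet_derivative \<phi> (at u) v = frechet_derivative \<phi>' (at u') (L v)"
  shows "frechet_derivative (\<lambda>u. f (\<phi> u)) (at u) v = frechet_derivative (\<lambda>u. f (\<phi>' u)) (at u') (L v)"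
proof -
  have "\<phi> u \<in> M" using u(1) local_paramD(5)[OF c] by blast
  then obtain V g where V: "\<phi> u \<in> V" "smooth_on_open g V" "\<And>y. y \<in> V \<inter> M \<Longrightarrow> g y = f y"
    using f unfolding smooth_map_def by metis
  have V': "\<phi>' u' \<in> V" using V(1) u(3) by simp
  have "frechet_derivative (\<lambda>u. f (\<phi> u)) (at u) v = frechet_derivative g (at (\<phi> u)) (frechet_derivative \<phi> (at u) v)"
    by (rule frechet_derivative_extension[OF c u(1) V])
  moreover have "frechet_derivative (\<lambda>u. f (\<phi>' u)) (at u') (L v) =
      frechet_derivative g (at (\<phi>' u')) (frechet_derivative \<phi>' (at u') (L v))"
    by (rule frechet_derivative_extension[OF c' u(2) V' V(2,3)])
  ultimately show ?thesis by (simp only: L u(3))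
qed

text \<open>A continuous lift of \<open>f\<close> through \<open>g\<close> is differentiable where \<open>g\<close> is immersive: a left inverse
  of \<open>g'\<close> recovers the increment of the lift from that of \<open>f\<close> up to terms of higher order.\<close>

lemma has_derivative_lift:
  fixes f :: "'a::euclidean_space \<Rightarrow> 'e::euclidean_space" and g :: "'b::euclidean_space \<Rightarrow> 'e"
  assumes f: "(f has_derivative f') (at x)" and g: "(g has_derivative g') (at (\<tau> x))"
    and inj: "inj g'" and cont: "isCont \<tau> x"
    and S: "open S" "x \<in> S" "\<And>y. y \<in> S \<Longrightarrow> g (\<tau> y) = f y"
  obtains L where "(\<tau> has_derivative L) (at x)" "\<And>v. g' (L v) = f' v"
proof -
  have "linear g'" using g by (rule has_derivative_linear)
  then obtain h where h: "linear h" "h \<circ> g' = id"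
    using linear_injective_left_inverse inj by blast
  define L where "L v = h (f' v)" for v
  have blf: "bounded_linear f'" using f by (rule has_derivative_bounded_linear)
  have blh: "bounded_linear h" using h(1) by (simp add: linear_conv_bounded_linear)
  have blL: "bounded_linear L" unfolding L_def by (rule bounded_linear_compose[OF blh blf])
  obtain C where C: "C > 0" "\<And>v. norm (h v) \<le> norm v * C" using bounded_linear.pos_bounded[OF blh] by blast
  obtain B where B: "B > 0" "\<And>v. norm (L v) \<le> norm v * B" using bounded_linear.pos_bounded[OF blL] by blast
  have main: "\<exists>d>0. \<forall>y. norm (y - x) < d \<longrightarrow> norm (\<tau> y - \<tau> x - L (y - x)) \<le> e * norm (y - x)" if "e > 0" for e
  proof -
    \<comment> \<open>The first bound absorbs the increment of \<open>\<tau>\<close> on the right side of its own estimate.\<close>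
    define \<epsilon> where "\<epsilon> = min (1 / (2 * C)) (e / (C * (2 + 2 * B)))"
    have \<epsilon>: "\<epsilon> > 0" "C * \<epsilon> \<le> 1 / 2" "C * \<epsilon> * (2 + 2 * B) \<le> e"
    proof -
      show "\<epsilon> > 0" using C(1) B(1) that by (simp add: \<epsilon>_def)
      have "C * \<epsilon> \<le> C * (1 / (2 * C))" using C(1) by (intro mult_left_mono) (auto simp: \<epsilon>_def)
      then show "C * \<epsilon> \<le> 1 / 2" using C(1) by simp
      have "C * \<epsilon> * (2 + 2 * B) \<le> C * (e / (C * (2 + 2 * B))) * (2 + 2 * B)"
        using C(1) B(1) by (intro mult_right_mono mult_left_mono) (auto simp: \<epsilon>_def)
      then show "C * \<epsilon> * (2 + 2 * B) \<le> e" using C(1) B(1) by simp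
    qed
    obtain d1 where d1: "d1 > 0" "\<And>y. norm (y - x) < d1 \<Longrightarrow> norm (f y - f x - f' (y - x)) \<le> \<epsilon> * norm (y - x)"
      using f \<epsilon>(1) unfolding has_derivative_at_alt by blast
    obtain d2 where d2: "d2 > 0" "\<And>z. norm (z - \<tau> x) < d2 \<Longrightarrow>
        norm (g z - g (\<tau> x) - g' (z - \<tau> x)) \<le> \<epsilon> * norm (z - \<tau> x)"
      using g \<epsilon>(1) unfolding has_derivative_at_alt by blast
    obtain d3 where d3: "d3 > 0" "\<And>y. norm (y - x) < d3 \<Longrightarrow> norm (\<tau> y - \<tau> x) < d2"
      using cont d2(1) unfolding continuous_at_eps_delta dist_norm by blast
    obtain d4 where d4: "d4 > 0" "ball x d4 \<subseteq> S"
      using S(1,2) open_contains_ball by blast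
    show ?thesis
    proof (intro exI[of _ "min (min d1 d3) d4"] conjI allI impI)
      show "min (min d1 d3) d4 > 0" using d1(1) d3(1) d4(1) by simp
      fix y assume y: "norm (y - x) < min (min d1 d3) d4"
      have "y \<in> S" using y d4(2) by (auto simp: dist_norm norm_minus_commute subset_iff)
      define k where "k = y - x"
      define \<Delta> where "\<Delta> = \<tau> y - \<tau> x"
      define r1 where "r1 = f y - f x - f' k"
      define r2 where "r2 = g (\<tau> y) - g (\<tau> x) - g' \<Delta>"
      have r: "norm r1 \<le> \<epsilon> * norm k" "norm r2 \<le> \<epsilon> * norm \<Delta>"
        using d1(2)[of y] d2(2)[of "\<tau> y"] d3(2)[of y] y unfolding r1_def r2_def k_def \<Delta>_def by auto
      have "g' \<Delta> = f' k + (r1 - r2)"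
        using S(3)[OF \<open>y \<in> S\<close>] S(3)[OF S(2)] by (simp add: r1_def r2_def)
      then have "h (g' \<Delta>) = h (f' k) + h (r1 - r2)"
        using linear_add[OF h(1)] by simp
      then have \<Delta>: "\<Delta> - L k = h (r1 - r2)"
        using h(2) by (simp add: L_def fun_eq_iff)
      have "norm (\<Delta> - L k) \<le> norm (r1 - r2) * C"
        unfolding \<Delta> by (rule C(2))
      also have "\<dots> \<le> (\<epsilon> * norm k + \<epsilon> * norm \<Delta>) * C"
        using C(1) r norm_triangle_ineq4[of r1 r2] by (intro mult_right_mono) auto
      finally have 1: "norm (\<Delta> - L k) \<le> C * \<epsilon> * norm k + C * \<epsilon> * norm \<Delta>"
        by (simp add: algebra_simps)
      have "norm \<Delta> \<le> norm (L k) + norm (\<Delta> - L k)"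
        using norm_triangle_ineq[of "L k" "\<Delta> - L k"] by simp
      also have "\<dots> \<le> norm k * B + (1 / 2 * norm k + 1 / 2 * norm \<Delta>)"
        using B(2)[of k] 1 mult_right_mono[OF \<epsilon>(2) norm_ge_zero[of k]] mult_right_mono[OF \<epsilon>(2) norm_ge_zero[of \<Delta>]] by linarith
      finally have "norm \<Delta> \<le> (1 + 2 * B) * norm k" by (simp add: algebra_simps)
      then have "C * \<epsilon> * norm \<Delta> \<le> C * \<epsilon> * ((1 + 2 * B) * norm k)"
        using C(1) \<epsilon>(1) by (intro mult_left_mono) auto
      with 1 have "norm (\<Delta> - L k) \<le> C * \<epsilon> * (2 + 2 * B) * norm k"
        by (simp add: algebra_simps)
      also have "\<dots> \<le> e * norm k" using \<epsilon>(3) by (intro mult_right_mono) auto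
      finally show "norm (\<tau> y - \<tau> x - L (y - x)) \<le> e * norm (y - x)"
        by (simp add: \<Delta>_def k_def)
    qed
  qed
  have L: "(\<tau> has_derivative L) (at x)"
    unfolding has_derivative_at_alt using blL main by blast
  have "((\<lambda>y. g (\<tau> y)) has_derivative (\<lambda>v. g' (L v))) (at x)"
    by (rule has_derivative_compose[OF L g])
  then have "(f has_derivative (\<lambda>v. g' (L v))) (at x)"
    by (rule has_derivative_transform_within_open[OF _ S])
  then have "g' (L v) = f' v" for v
    using f has_derivative_unique by metis
  with L show thesis by (rule that)
qed

lemma integral_eq_subset:
  fixes f :: "'a::euclidean_space \<Rightarrow> real"
  assumes "S \<subseteq> T" "\<And>u. u \<in> T - S \<Longrightarrow> f u = 0"
  shows "integral T f = integral S f"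
proof -
  have "integral T f = integral UNIV (\<lambda>u. if u \<in> T then f u else 0)"
    by (rule integral_restrict_UNIV[symmetric])
  also have "\<dots> = integral UNIV (\<lambda>u. if u \<in> S then f u else 0)"
    by (rule integral_cong) (use assms in auto)
  also have "\<dots> = integral S f" by (rule integral_restrict_UNIV)
  finally show ?thesis .
qed

text \<open>Integrals of densities do not depend on the chart: the change of coordinates is a lift of one
  chart through the other, hence differentiable by \<open>has_derivative_lift\<close>.  The hypothesis on \<open>p\<close> and \<open>p'\<close> is the
  transformation law of densities, with \<open>L\<close> the differential of the change of coordinates.\<close>

lemma integral_change_of_charts:
  fixes \<phi> \<phi>' :: "real^'N::finite \<Rightarrow> 'e::euclidean_space"
  assumes c: "local_param M U \<phi>" and c': "local_param M U' \<phi>'"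
    and trans: "\<And>u u' L. u \<in> U \<Longrightarrow> u' \<in> U' \<Longrightarrow> \<phi> u = \<phi>' u' \<Longrightarrow> linear L \<Longrightarrow>
      (\<And>v. frechet_derivative \<phi> (at u) v = frechet_derivative \<phi>' (at u') (L v)) \<Longrightarrow>
      p u = \<bar>det (matrix L)\<bar> * p' u'"
    and zero: "\<And>u. u \<in> U \<Longrightarrow> \<phi> u \<notin> \<phi>' ` U' \<Longrightarrow> p u = 0"
    and zero': "\<And>u. u \<in> U' \<Longrightarrow> \<phi>' u \<notin> \<phi> ` U \<Longrightarrow> p' u = 0"
    and int: "p absolutely_integrable_on U"
  shows "integral U p = integral U' p'"
proof -
  define \<tau> where "\<tau> u = inv_into U' \<phi>' (\<phi> u)" for u
  define S where "S = {u \<in> U. \<phi> u \<in> \<phi>' ` U'}"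
  obtain T where T: "open T" "\<phi>' ` U' = M \<inter> T" using local_paramD(8)[OF c'] by blast
  have "S = U \<inter> \<phi> -` T" using T(2) local_paramD(5)[OF c] by (auto simp: S_def)
  then have "open S"
    using continuous_open_preimage[OF local_paramD(3,2)[OF c] T(1)] by simp
  have \<tau>: "\<tau> u \<in> U'" "\<phi>' (\<tau> u) = \<phi> u" if "u \<in> S" for u
    using that unfolding S_def \<tau>_def by (auto intro: inv_into_into f_inv_into_f)
  have "continuous_on S \<tau>"
    unfolding \<tau>_def
    by (rule continuous_on_compose2[OF local_paramD(7)[OF c'] continuous_on_subset[OF local_paramD(3)[OF c]]])
       (auto simp: S_def)
  then have cont: "isCont \<tau> u" if "u \<in> S" for u
    using \<open>open S\<close> that continuous_on_eq_continuous_at by blast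
  have "\<exists>L. (\<tau> has_derivative L) (at u) \<and>
      (\<forall>v. frechet_derivative \<phi>' (at (\<tau> u)) (L v) = frechet_derivative \<phi> (at u) v)" if u: "u \<in> S" for u
  proof -
    have "u \<in> U" using u by (simp add: S_def)
    obtain L where "(\<tau> has_derivative L) (at u)"
      "\<And>v. frechet_derivative \<phi>' (at (\<tau> u)) (L v) = frechet_derivative \<phi> (at u) v"
      using has_derivative_lift[OF smooth_on_open_has_derivative[OF local_paramD(1)[OF c] \<open>u \<in> U\<close>]
          smooth_on_open_has_derivative[OF local_paramD(1)[OF c'] \<tau>(1)[OF u]]
          local_paramD(6)[OF c' \<tau>(1)[OF u]] cont[OF u] \<open>open S\<close> u \<tau>(2)] by blast
    then show ?thesis by blast
  qed
  then obtain L where L: "\<And>u. u \<in> S \<Longrightarrow> (\<tau> has_derivative L u) (at u)"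
      "\<And>u v. u \<in> S \<Longrightarrow> frechet_derivative \<phi>' (at (\<tau> u)) (L u v) = frechet_derivative \<phi> (at u) v"
    by metis
  have inj: "inj_on \<tau> S"
  proof (rule inj_onI)
    fix u v assume "u \<in> S" "v \<in> S" "\<tau> u = \<tau> v"
    then have "\<phi> u = \<phi> v" using \<tau>(2) by metis
    then show "u = v"
      using local_paramD(4)[OF c] \<open>u \<in> S\<close> \<open>v \<in> S\<close> by (auto simp: S_def dest: inj_onD)
  qed
  have p: "p u = \<bar>det (matrix (L u))\<bar> * p' (\<tau> u)" if "u \<in> S" for u
    using that \<tau>[OF that] L(2)[OF that] has_derivative_linear[OF L(1)[OF that]]
    by (intro trans) (auto simp: S_def)
  have "S \<subseteq> U" by (auto simp: S_def)
  have "p absolutely_integrable_on S"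
    by (rule set_integrable_subset[OF int _ \<open>S \<subseteq> U\<close>]) (simp add: borel_open \<open>open S\<close>)
  then have int': "(\<lambda>u. \<bar>det (matrix (L u))\<bar> * p' (\<tau> u)) absolutely_integrable_on S"
    using set_integrable_cong[of lebesgue lebesgue S S p, OF refl refl p] by simp
  have img: "\<tau> ` S = {u \<in> U'. \<phi>' u \<in> \<phi> ` U}"
  proof (intro equalityI subsetI)
    fix w assume "w \<in> \<tau> ` S"
    then show "w \<in> {u \<in> U'. \<phi>' u \<in> \<phi> ` U}" using \<tau> \<open>S \<subseteq> U\<close> by auto
  next
    fix w assume "w \<in> {u \<in> U'. \<phi>' u \<in> \<phi> ` U}"
    then obtain u where u: "w \<in> U'" "u \<in> U" "\<phi>' w = \<phi> u" by auto
    then have "u \<in> S" by (auto simp: S_def intro: image_eqI[of _ _ w])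
    moreover have "\<tau> u = w"
      using u local_paramD(4)[OF c'] by (simp add: \<tau>_def u(3)[symmetric])
    ultimately show "w \<in> \<tau> ` S" by blast
  qed
  have "integral U p = integral S p"
    using \<open>S \<subseteq> U\<close> zero by (intro integral_eq_subset) (auto simp: S_def)
  also have "\<dots> = integral S (\<lambda>u. \<bar>det (matrix (L u))\<bar> * p' (\<tau> u))"
    by (rule integral_cong) (rule p)
  also have "\<dots> = integral (\<tau> ` S) p'"
    by (rule change_of_variables[OF \<open>open S\<close> L(1) inj int', symmetric])
  also have "\<dots> = integral U' p'"
    unfolding img using zero' by (intro integral_eq_subset[symmetric]) auto
  finally show ?thesis .
qed

lemma frechet_derivative_zero_on_open:
  assumes "open S" "x \<in> S" "\<And>y. y \<in> S \<Longrightarrow> f y = 0"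
  shows "frechet_derivative f (at x) = (\<lambda>v. 0)"
proof -
  have "((\<lambda>y. 0) has_derivative (\<lambda>v. 0)) (at x)" by simp
  then have "(f has_derivative (\<lambda>v. 0)) (at x)"
    by (rule has_derivative_transform_within_open[OF _ assms(1,2)]) (simp add: assms(3))
  then show ?thesis by (rule frechet_derivative_eqI)
qed

lemma smooth_compact_support_absolutely_integrable:
  fixes f :: "'a::euclidean_space \<Rightarrow> real"
  assumes "smooth_on_open f U" "compact K" "K \<subseteq> U" "\<And>u. u \<in> U - K \<Longrightarrow> f u = 0"
  shows "f absolutely_integrable_on U"
proof -
  let ?F = "\<lambda>u. if u \<in> U then f u else 0"
  have "smooth_on_open ?F UNIV"
    using assms by (intro smooth_on_open_extend_zero[of f U K]) (auto simp: compact_imp_closed)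
  then have "?F absolutely_integrable_on UNIV"
    using assms by (intro continuous_compact_support_absolutely_integrable[of _ K] smooth_on_open_continuous_on) auto
  then show ?thesis by (simp add: absolutely_integrable_restrict_UNIV)
qed

lemma integral_derivative_compact_support_on:
  fixes f :: "'a::euclidean_space \<Rightarrow> real"
  assumes f: "smooth_on_open f U" and K: "compact K" "K \<subseteq> U" "\<And>u. u \<in> U - K \<Longrightarrow> f u = 0"
  shows "integral U (\<lambda>u. frechet_derivative f (at u) v) = 0"
proof -
  let ?F = "\<lambda>u. if u \<in> U then f u else 0"
  have F: "smooth_on_open ?F UNIV"
    using assms by (intro smooth_on_open_extend_zero[of f U K]) (auto simp: compact_imp_closed)
  have "frechet_derivative ?F (at u) = frechet_derivative f (at u)" if "u \<in> U" for u
    by (rule frechet_derivative_transform_within_open[OF smooth_on_open_differentiable[OF F] smooth_on_open_openD[OF f] that]) auto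
  moreover have "frechet_derivative ?F (at u) v = 0" if "u \<notin> U" for u
  proof -
    have "open (- K)" using K(1) by (simp add: compact_imp_closed open_Compl)
    then have "frechet_derivative ?F (at u) = (\<lambda>v. 0)"
      by (rule frechet_derivative_zero_on_open) (use that K in auto)
    then show ?thesis by simp
  qed
  ultimately have "integral U (\<lambda>u. frechet_derivative f (at u) v) = integral UNIV (\<lambda>u. frechet_derivative ?F (at u) v)"
    by (subst integral_eq_subset[of U UNIV]) (auto intro!: integral_cong)
  also have "\<dots> = 0"
    using K by (intro integral_derivative_compact_support[OF F, of K]) auto
  finally show ?thesis .
qed

lemma linear_eq_sum_axis:
  fixes f :: "real^'n::finite \<Rightarrow> 'b::real_vector"
  assumes "linear f"
  shows "f v = (\<Sum>i\<in>UNIV. (v $ i) *\<^sub>R f (axis i 1))"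
proof -
  have "v = (\<Sum>i\<in>UNIV. (v $ i) *\<^sub>R axis i 1)"
    using basis_expansion[of v] by (simp add: scalar_mult_eq_scaleR)
  then have "f v = f (\<Sum>i\<in>UNIV. (v $ i) *\<^sub>R axis i 1)" by simp
  also have "\<dots> = (\<Sum>i\<in>UNIV. (v $ i) *\<^sub>R f (axis i 1))"
    by (simp add: linear_sum[OF assms] linear_scale[OF assms])
  finally show ?thesis .
qed

lemma partial_mult:
  fixes f g :: "real^'N::finite \<Rightarrow> 'b::real_normed_algebra"
  assumes "f differentiable (at u)" "g differentiable (at u)"
  shows "partial a (\<lambda>u. f u * g u) u = f u * partial a g u + partial a f u * g u"
proof -
  have "((\<lambda>u. f u * g u) has_derivative
      (\<lambda>v. f u * frechet_derivative g (at u) v + frechet_derivative f (at u) v * g u)) (at u)"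
    using assms by (intro has_derivative_mult) (simp_all add: frechet_derivative_works[symmetric])
  then show ?thesis by (simp add: partial_def frechet_derivative_eqI)
qed

section \<open>The divergence theorem for a partition of unity\<close>

lemma partition_of_unityD:
  assumes "partition_of_unity M K U \<phi> \<rho>"
  shows "\<And>i. i < K \<Longrightarrow> local_param M (U i) (\<phi> i)" "\<And>i. i < K \<Longrightarrow> smooth_map (\<rho> i) M"
    and "\<And>x. x \<in> M \<Longrightarrow> (\<Sum>i<K. \<rho> i x) = 1"
    and "\<And>i. i < K \<Longrightarrow> \<exists>C. compact C \<and> C \<subseteq> \<phi> i ` U i \<and> (\<forall>x\<in>M - C. \<rho> i x = 0)"
  using assms unfolding partition_of_unity_def by auto

lemma chart_compact_support:
  assumes "local_param M U \<phi>" "compact C" "C \<subseteq> \<phi> ` U"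
  obtains K where "compact K" "K \<subseteq> U" "\<And>u. u \<in> U - K \<Longrightarrow> \<phi> u \<in> M - C"
proof
  show "compact (inv_into U \<phi> ` C)"
    using assms by (intro compact_continuous_image continuous_on_subset[OF local_paramD(7)])
  show "inv_into U \<phi> ` C \<subseteq> U" using assms(3) by (auto intro: inv_into_into)
  fix u assume u: "u \<in> U - inv_into U \<phi> ` C"
  have "\<phi> u \<notin> C"
  proof
    assume "\<phi> u \<in> C"
    then have "inv_into U \<phi> (\<phi> u) \<in> inv_into U \<phi> ` C" by (rule imageI)
    then show False using u local_paramD(4)[OF assms(1)] by simp
  qed
  then show "\<phi> u \<in> M - C" using u local_paramD(5)[OF assms(1)] by auto
qed

text \<open>The summand of the chart \<open>i\<close> is, by partial integration, minus the integral of
  \<open>d\<rho>\<^sub>i(Y)\<close> against the density.  Insert \<open>\<Sum>\<^sub>j \<rho>\<^sub>j = 1\<close>, compute the integral of \<open>\<rho>\<^sub>j d\<rho>\<^sub>i(Y)\<close> in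
  the chart \<open>j\<close> instead of \<open>i\<close>, and sum over \<open>i\<close> first: \<open>\<Sum>\<^sub>i d\<rho>\<^sub>i = 0\<close>.\<close>

theorem divergence_theorem_partition_of_unity:
  fixes U :: "nat \<Rightarrow> (real^'N::finite) set" and \<phi> :: "nat \<Rightarrow> real^'N \<Rightarrow> 'e::euclidean_space"
    and n :: "nat \<Rightarrow> real^'N \<Rightarrow> real" and Y :: "nat \<Rightarrow> real^'N \<Rightarrow> real^'N"
  assumes P: "partition_of_unity M K U \<phi> \<rho>"
    and n: "\<And>i. i < K \<Longrightarrow> smooth_on_open (n i) (U i)"
    and Y: "\<And>i. i < K \<Longrightarrow> smooth_on_open (Y i) (U i)"
    and trans: "\<And>i j u u' L. i < K \<Longrightarrow> j < K \<Longrightarrow> u \<in> U i \<Longrightarrow> u' \<in> U j \<Longrightarrow> \<phi> i u = \<phi> j u' \<Longrightarrow> linear L \<Longrightarrow>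
      (\<And>v. frechet_derivative (\<phi> i) (at u) v = frechet_derivative (\<phi> j) (at u') (L v)) \<Longrightarrow>
      n i u = \<bar>det (matrix L)\<bar> * n j u' \<and> Y j u' = L (Y i u)"
  shows "(\<Sum>i<K. integral (U i) (\<lambda>u. \<rho> i (\<phi> i u) * (\<Sum>a\<in>UNIV. partial a (\<lambda>u. n i u * Y i u $ a) u))) = 0"
proof -
  note chart = partition_of_unityD(1)[OF P]
  define r where "r i k u = \<rho> i (\<phi> k u)" for i k u
  define D where "D i k u = frechet_derivative (r i k) (at u) (Y k u)" for i k u
  define T where "T i j k u = r j k u * (n k u * D i k u)" for i j k u
  have r: "smooth_on_open (r i k) (U k)" if "i < K" "k < K" for i k
    unfolding r_def using that by (intro smooth_map_chart[OF partition_of_unityD(2)[OF P]] chart)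
  have D: "smooth_on_open (D i k) (U k)" if "i < K" "k < K" for i k
    unfolding D_def using that by (intro smooth_on_open_derivative_apply r Y)
  have T: "smooth_on_open (T i j k) (U k)" if "i < K" "j < K" "k < K" for i j k
    unfolding T_def using that by (intro smooth_intros r n D)
  have "\<exists>C. \<forall>i<K. compact (C i) \<and> C i \<subseteq> \<phi> i ` U i \<and> (\<forall>x\<in>M - C i. \<rho> i x = 0)"
    using partition_of_unityD(4)[OF P] by metis
  then obtain C where CC: "\<forall>i<K. compact (C i) \<and> C i \<subseteq> \<phi> i ` U i \<and> (\<forall>x\<in>M - C i. \<rho> i x = 0)"
    by (elim exE)
  have C: "compact (C i)" "C i \<subseteq> \<phi> i ` U i" "\<And>x. x \<in> M - C i \<Longrightarrow> \<rho> i x = 0" if "i < K" for i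
    using CC that by simp_all
  have "\<exists>Z. i < K \<longrightarrow> compact Z \<and> Z \<subseteq> U i \<and> (\<forall>u \<in> U i - Z. \<phi> i u \<in> M - C i)" for i
  proof (cases "i < K")
    case True
    obtain Z where "compact Z" "Z \<subseteq> U i" "\<And>u. u \<in> U i - Z \<Longrightarrow> \<phi> i u \<in> M - C i"
      using chart_compact_support[OF chart[OF True] C(1,2)[OF True]] by metis
    then show ?thesis by (intro exI[of _ Z]) simp
  qed simp
  then obtain Z where ZZ: "\<forall>i. i < K \<longrightarrow> compact (Z i) \<and> Z i \<subseteq> U i \<and> (\<forall>u \<in> U i - Z i. \<phi> i u \<in> M - C i)"
    by metis
  have Z: "compact (Z i)" "Z i \<subseteq> U i" "\<And>u. u \<in> U i - Z i \<Longrightarrow> \<phi> i u \<in> M - C i" if "i < K" for i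
    using ZZ that by simp_all
  have inM: "\<phi> k u \<in> M" if "k < K" "u \<in> U k" for k u
    using local_paramD(5)[OF chart[OF that(1)]] that(2) by blast
  have r0: "r i i u = 0" if "i < K" "u \<in> U i - Z i" for i u
    unfolding r_def using C(3)[OF that(1) Z(3)[OF that]] .
  have Dout: "D i k u = 0" if "i < K" "k < K" "u \<in> U k" "\<phi> k u \<notin> C i" for i k u
  proof -
    have "open (U k \<inter> \<phi> k -` (- C i))"
      using local_paramD(2,3)[OF chart[OF that(2)]] C(1)[OF that(1)]
      by (intro continuous_open_preimage) (auto simp: compact_imp_closed open_Compl)
    then have "frechet_derivative (r i k) (at u) = (\<lambda>v. 0)"
      by (rule frechet_derivative_zero_on_open) (use that inM C(3) in \<open>auto simp: r_def\<close>)
    then show ?thesis by (simp add: D_def)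
  qed
  have int: "(T i j k) absolutely_integrable_on U k" if "i < K" "j < K" "k = i \<or> k = j" for i j k
  proof (rule smooth_compact_support_absolutely_integrable[of _ _ "Z k"])
    show "T i j k u = 0" if "u \<in> U k - Z k" for u
      using that \<open>i < K\<close> \<open>j < K\<close> \<open>k = i \<or> k = j\<close> r0[of j u] Dout[of i i u] Z(3)[of i u] by (auto simp: T_def)
  next
    have "k < K" using that by auto
    then show "smooth_on_open (T i j k) (U k)" "compact (Z k)" "Z k \<subseteq> U k"
      using that(1,2) by (simp_all add: T Z)
  qed
  have parts: "integral (U i) (\<lambda>u. r i i u * (\<Sum>a\<in>UNIV. partial a (\<lambda>u. n i u * Y i u $ a) u)) =
      - (\<Sum>j<K. integral (U i) (T i j i))" if i: "i < K" for i
  proof -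
    let ?h = "\<lambda>a u. r i i u * (n i u * Y i u $ a)"
    have h: "smooth_on_open (?h a) (U i)" for a
      using i by (intro smooth_intros r n Y)
    have hint: "(\<lambda>u. partial a (?h a) u) integrable_on U i" for a
    proof -
      have "(\<lambda>u. frechet_derivative (?h a) (at u) (axis a 1)) absolutely_integrable_on U i"
      proof (rule smooth_compact_support_absolutely_integrable[of _ _ "Z i"])
        have op: "open (U i - Z i)"
          using local_paramD(2)[OF chart[OF i]] Z(1)[OF i] by (simp add: compact_imp_closed open_Diff)
        show "frechet_derivative (?h a) (at u) (axis a 1) = 0" if "u \<in> U i - Z i" for u
          using frechet_derivative_zero_on_open[OF op that, of "?h a"] r0[OF i] by simp
      qed (use i Z smooth_on_open_derivative[OF h] in auto)
      then show ?thesis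
        unfolding partial_def by (simp add: absolutely_integrable_on_def)
    qed
    have pt: "r i i u * (\<Sum>a\<in>UNIV. partial a (\<lambda>u. n i u * Y i u $ a) u) =
        (\<Sum>a\<in>UNIV. partial a (?h a) u) - (\<Sum>j<K. T i j i u)" if u: "u \<in> U i" for u
    proof -
      have "partial a (?h a) u = r i i u * partial a (\<lambda>u. n i u * Y i u $ a) u + partial a (r i i) u * (n i u * Y i u $ a)" for a
        using i u by (intro partial_mult smooth_on_open_differentiable[of _ "U i"] smooth_intros r n Y)
      then have "(\<Sum>a\<in>UNIV. partial a (?h a) u) = r i i u * (\<Sum>a\<in>UNIV. partial a (\<lambda>u. n i u * Y i u $ a) u) +
          n i u * (\<Sum>a\<in>UNIV. Y i u $ a * partial a (r i i) u)"
        by (simp add: sum.distrib sum_distrib_left mult_ac)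
      also have "(\<Sum>a\<in>UNIV. Y i u $ a * partial a (r i i) u) = D i i u"
        unfolding D_def partial_def
        using linear_eq_sum_axis[OF linear_frechet_derivative[OF smooth_on_open_differentiable[OF r[OF i i] u]], of "Y i u"] by simp
      also have "n i u * D i i u = (\<Sum>j<K. T i j i u)"
        using partition_of_unityD(3)[OF P inM[OF i u]] unfolding T_def r_def sum_distrib_right[symmetric] by simp
      finally show ?thesis by simp
    qed
    have Tint: "(T i j i) integrable_on U i" if "j < K" for j
      using int[OF i that, of i] by (simp add: absolutely_integrable_on_def)
    have "integral (U i) (\<lambda>u. r i i u * (\<Sum>a\<in>UNIV. partial a (\<lambda>u. n i u * Y i u $ a) u)) =
        integral (U i) (\<lambda>u. (\<Sum>a\<in>UNIV. partial a (?h a) u) - (\<Sum>j<K. T i j i u))"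
      by (rule integral_cong) (rule pt)
    also have "\<dots> = integral (U i) (\<lambda>u. \<Sum>a\<in>UNIV. partial a (?h a) u) - integral (U i) (\<lambda>u. \<Sum>j<K. T i j i u)"
      using hint Tint by (intro integral_diff integrable_sum) auto
    also have "integral (U i) (\<lambda>u. \<Sum>a\<in>UNIV. partial a (?h a) u) = (\<Sum>a\<in>UNIV. integral (U i) (partial a (?h a)))"
      using hint by (intro integral_sum) auto
    also have "\<dots> = 0"
      unfolding partial_def using i Z r0[OF i]
      by (intro sum.neutral ballI integral_derivative_compact_support_on[OF h, of "Z i"]) auto
    also have "integral (U i) (\<lambda>u. \<Sum>j<K. T i j i u) = (\<Sum>j<K. integral (U i) (T i j i))"
      using Tint by (intro integral_sum) auto
    finally show ?thesis by simp
  qed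
  have swap: "integral (U i) (T i j i) = integral (U j) (T i j j)" if ij: "i < K" "j < K" for i j
  proof (rule integral_change_of_charts[OF chart[OF ij(1)] chart[OF ij(2)]])
    show "T i j i absolutely_integrable_on U i" using int[OF ij] by simp
    show "T i j i u = 0" if "u \<in> U i" "\<phi> i u \<notin> \<phi> j ` U j" for u
    proof -
      have "\<phi> i u \<in> M - C j" using that C(2)[OF ij(2)] inM[OF ij(1) that(1)] by blast
      then show ?thesis using C(3)[OF ij(2)] by (simp add: T_def r_def)
    qed
    show "T i j j u = 0" if "u \<in> U j" "\<phi> j u \<notin> \<phi> i ` U i" for u
    proof -
      have "\<phi> j u \<notin> C i" using that C(2)[OF ij(1)] by blast
      then show ?thesis using Dout[OF ij that(1)] by (simp add: T_def)
    qed
    fix u u' and L :: "real^'N \<Rightarrow> real^'N"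
    assume u: "u \<in> U i" "u' \<in> U j" "\<phi> i u = \<phi> j u'" "linear L"
      and L: "\<And>v. frechet_derivative (\<phi> i) (at u) v = frechet_derivative (\<phi> j) (at u') (L v)"
    have nY: "n i u = \<bar>det (matrix L)\<bar> * n j u'" "Y j u' = L (Y i u)"
      using trans[OF ij u L] by auto
    have "D i i u = D i j u'"
      unfolding D_def r_def nY(2)
      by (rule frechet_derivative_change_of_charts[OF partition_of_unityD(2)[OF P ij(1)] chart[OF ij(1)] chart[OF ij(2)] u(1,2,3) L])
    then show "T i j i u = \<bar>det (matrix L)\<bar> * T i j j u'"
      by (simp add: T_def nY(1) r_def u(3))
  qed
  have zero: "(\<Sum>i<K. T i j j u) = 0" if j: "j < K" "u \<in> U j" for j u
  proof -
    have "((\<lambda>u. \<Sum>i<K. r i j u) has_derivative (\<lambda>v. \<Sum>i<K. frechet_derivative (r i j) (at u) v)) (at u)"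
      using j by (intro has_derivative_sum smooth_on_open_has_derivative[OF r]) auto
    then have "((\<lambda>u. 1) has_derivative (\<lambda>v. \<Sum>i<K. frechet_derivative (r i j) (at u) v)) (at u)"
      by (rule has_derivative_transform_within_open[OF _ local_paramD(2)[OF chart[OF j(1)]] j(2)])
         (use partition_of_unityD(3)[OF P inM[OF j(1)]] in \<open>simp add: r_def\<close>)
    then have "(\<lambda>v. \<Sum>i<K. frechet_derivative (r i j) (at u) v) = (\<lambda>v. 0)"
      using has_derivative_unique has_derivative_const by blast
    then have "(\<Sum>i<K. D i j u) = 0" unfolding D_def by (rule fun_cong)
    then show ?thesis unfolding T_def by (simp add: sum_distrib_left[symmetric])
  qed
  have "(\<Sum>i<K. integral (U i) (\<lambda>u. r i i u * (\<Sum>a\<in>UNIV. partial a (\<lambda>u. n i u * Y i u $ a) u))) =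
      - (\<Sum>i<K. \<Sum>j<K. integral (U j) (T i j j))"
  proof -
    have "(\<Sum>j<K. integral (U i) (T i j i)) = (\<Sum>j<K. integral (U j) (T i j j))" if "i < K" for i
      using swap[OF that] by (intro sum.cong refl) simp
    then have "integral (U i) (\<lambda>u. r i i u * (\<Sum>a\<in>UNIV. partial a (\<lambda>u. n i u * Y i u $ a) u)) =
        - (\<Sum>j<K. integral (U j) (T i j j))" if "i < K" for i
      using parts[OF that] that by simp
    then show ?thesis by (simp add: sum_negf)
  qed
  also have "(\<Sum>i<K. \<Sum>j<K. integral (U j) (T i j j)) = (\<Sum>j<K. \<Sum>i<K. integral (U j) (T i j j))"
    by (rule sum.swap)
  also have "\<dots> = (\<Sum>j<K. integral (U j) (\<lambda>u. \<Sum>i<K. T i j j u))"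
    using int by (intro sum.cong refl integral_sum[symmetric]) (auto simp: absolutely_integrable_on_def)
  also have "\<dots> = (\<Sum>j<K. integral (U j) (\<lambda>u. 0))"
    by (intro sum.cong refl integral_cong) (simp add: zero)
  finally show ?thesis by (simp add: r_def)
qed

section \<open>Differential calculus of determinants\<close>

definition replace_column :: "'a^'n^'m \<Rightarrow> 'n \<Rightarrow> 'a^'m \<Rightarrow> 'a^'n^'m" where
  "replace_column A a c = (\<chi> i j. if j = a then c $ i else A $ i $ j)"

lemma det_replace_column:
  fixes A :: "'a::comm_ring_1^'n::finite^'n"
  shows "det (replace_column A a c) =
    (\<Sum>p\<in>{p. p permutes UNIV}. of_int (sign p) * (c $ p a * (\<Prod>i\<in>UNIV - {a}. A $ p i $ i)))"
proof -
  have "det (replace_column A a c) = det (transpose (replace_column A a c))"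
    by (rule det_transpose[symmetric])
  also have "\<dots> = (\<Sum>p\<in>{p. p permutes UNIV}. of_int (sign p) *
      (\<Prod>i\<in>UNIV. if i = a then c $ p i else A $ p i $ i))"
    by (simp add: det_def transpose_def replace_column_def)
  also have "\<dots> = (\<Sum>p\<in>{p. p permutes UNIV}. of_int (sign p) * (c $ p a * (\<Prod>i\<in>UNIV - {a}. A $ p i $ i)))"
    by (intro sum.cong refl) (subst prod.remove[of UNIV a], auto intro!: prod.cong)
  finally show ?thesis .
qed

lemma det_replace_column_add:
  fixes A :: "'a::comm_ring_1^'n::finite^'n"
  shows "det (replace_column A a (c + d)) = det (replace_column A a c) + det (replace_column A a d)"
  by (simp add: det_replace_column sum.distrib[symmetric] algebra_simps)

lemma det_replace_column_scale:
  fixes A :: "'a::comm_ring_1^'n::finite^'n"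
  shows "det (replace_column A a (k *s c)) = k * det (replace_column A a c)"
  by (simp add: det_replace_column sum_distrib_left mult_ac)

lemma det_replace_column_sum:
  fixes A :: "'a::comm_ring_1^'n::finite^'n"
  shows "det (replace_column A a (\<Sum>x\<in>S. c x)) = (\<Sum>x\<in>S. det (replace_column A a (c x)))"
proof (induction S rule: infinite_finite_induct)
  case (insert x S)
  then show ?case by (simp add: det_replace_column_add)
qed (simp_all add: det_replace_column)

lemma det_replace_column_cramer:
  fixes A :: "'a::field^'n::finite^'n"
  shows "det (replace_column A a (A *v x)) = x $ a * det A"
  unfolding replace_column_def by (rule cramer_lemma)

text \<open>The product rule, applied to the Leibniz formula, replaces one column after the other by its
  derivative.\<close>

lemma has_derivative_det:
  fixes A :: "'x::real_normed_vector \<Rightarrow> 'a::real_normed_field^'n::finite^'n"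
  assumes "\<And>i j. ((\<lambda>x. A x $ i $ j) has_derivative (\<lambda>v. A' v $ i $ j)) (at x)"
  shows "((\<lambda>x. det (A x)) has_derivative (\<lambda>v. \<Sum>a\<in>UNIV. det (replace_column (A x) a (column a (A' v))))) (at x)"
proof -
  have det: "det B = (\<Sum>p\<in>{p. p permutes UNIV}. of_int (sign p) * (\<Prod>i\<in>UNIV. B $ p i $ i))"
    for B :: "'a^'n^'n"
    using det_transpose[of B] by (simp add: det_def transpose_def)
  have "((\<lambda>x. det (A x)) has_derivative (\<lambda>v. \<Sum>p\<in>{p. p permutes UNIV}. of_int (sign p) *
      (\<Sum>a\<in>UNIV. A' v $ p a $ a * (\<Prod>i\<in>UNIV - {a}. A x $ p i $ i)))) (at x)"
    unfolding det
    by (intro has_derivative_sum has_derivative_mult_right has_derivative_prod assms)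
  moreover have "(\<Sum>p\<in>{p. p permutes UNIV}. of_int (sign p) *
      (\<Sum>a\<in>UNIV. A' v $ p a $ a * (\<Prod>i\<in>UNIV - {a}. A x $ p i $ i))) =
      (\<Sum>a\<in>UNIV. det (replace_column (A x) a (column a (A' v))))" for v
    unfolding det_replace_column sum_distrib_left
    by (subst sum.swap) (simp add: column_def)
  ultimately show ?thesis by simp
qed

lemma det_cnj:
  fixes A :: "complex^'n::finite^'n"
  shows "det (\<chi> i j. cnj (A $ i $ j)) = cnj (det A)"
  by (simp add: det_def)

lemma det_of_real:
  fixes A :: "real^'n::finite^'n"
  shows "det (\<chi> i j. complex_of_real (A $ i $ j)) = complex_of_real (det A)"
  by (simp add: det_def)

lemma transpose_eqI: "(\<And>i j. M $ j $ i = N $ i $ j) \<Longrightarrow> transpose M = N"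
  by (simp add: transpose_def vec_eq_iff)

text \<open>Transposition fixes \<open>det\<close> and \<open>G\<close> but changes the sign of \<open>K\<close>.\<close>

lemma det_derivative_antisymmetric_eq_0:
  fixes G K :: "complex^'n::finite^'n"
  assumes G: "transpose G = G" and K: "transpose K = - K"
  shows "(\<Sum>a\<in>UNIV. det (replace_column G a (column a K))) = 0"
proof -
  let ?\<delta> = "\<lambda>X. \<Sum>a\<in>UNIV. det (replace_column G a (column a X))"
  have der: "((\<lambda>t :: real. det (\<chi> i j. G $ i $ j + of_real t * X $ i $ j)) has_derivative
      (\<lambda>t. ?\<delta> (\<chi> i j. of_real t * X $ i $ j))) (at 0)" for X :: "complex^'n^'n"
  proof -
    have "((\<lambda>t :: real. det (\<chi> i j. G $ i $ j + of_real t * X $ i $ j)) has_derivative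
      (\<lambda>t. \<Sum>a\<in>UNIV. det (replace_column (\<chi> i j. G $ i $ j + of_real 0 * X $ i $ j) a
        (column a (\<chi> i j. of_real t * X $ i $ j))))) (at 0)"
      by (rule has_derivative_det) (auto intro!: derivative_eq_intros)
    then show ?thesis by simp
  qed
  have Gij: "G $ j $ i = G $ i $ j" and Kij: "K $ j $ i = - (K $ i $ j)" for i j
    using arg_cong[OF G, of "\<lambda>M. M $ i $ j"] arg_cong[OF K, of "\<lambda>M. M $ i $ j"]
    by (simp_all add: transpose_def)
  have "det (\<chi> i j. G $ i $ j + of_real t * K $ i $ j) = det (\<chi> i j. G $ i $ j + of_real t * (- K) $ i $ j)" for t :: real
  proof -
    have "transpose (\<chi> i j. G $ i $ j + of_real t * K $ i $ j) = (\<chi> i j. G $ i $ j + of_real t * (- K) $ i $ j)"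
    proof -
      have "G $ j $ i + of_real t * K $ j $ i = G $ i $ j + of_real t * (- K) $ i $ j" for i j
        by (subst Gij, subst Kij) simp
      then show ?thesis by (intro transpose_eqI) simp
    qed
    then show ?thesis using det_transpose[of "\<chi> i j. G $ i $ j + of_real t * K $ i $ j"] by simp
  qed
  then have "(\<lambda>t :: real. det (\<chi> i j. G $ i $ j + of_real t * K $ i $ j)) = (\<lambda>t. det (\<chi> i j. G $ i $ j + of_real t * (- K) $ i $ j))"
    by (rule ext)
  then have der': "((\<lambda>t :: real. det (\<chi> i j. G $ i $ j + of_real t * K $ i $ j)) has_derivative
      (\<lambda>t. ?\<delta> (\<chi> i j. of_real t * (- K) $ i $ j))) (at 0)"
    using der[of "- K"] by simp
  have one: "(\<chi> i j. complex_of_real 1 * X $ i $ j) = X" for X :: "complex^'n^'n"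
    by (simp add: vec_eq_iff)
  have "?\<delta> K = ?\<delta> (- K)"
    using fun_cong[OF has_derivative_unique[OF der[of K] der'], of 1] unfolding one .
  also have "column a (- K) = (- 1) *s column a K" for a
    by (simp add: column_def vec_eq_iff)
  then have "?\<delta> (- K) = - ?\<delta> K"
    by (simp only: det_replace_column_scale) (simp add: sum_negf)
  finally show ?thesis by simp
qed

text \<open>To first order at a matrix with real Gram matrix, the imaginary part of the Gram matrix does
  not contribute to its determinant; so \<open>\<bar>det A\<bar>\<close> has the same derivative as the volume density.\<close>

lemma has_derivative_sqrt_det_gram:
  fixes A :: "real \<Rightarrow> complex^'n::finite^'n"
  assumes A: "\<And>i j. ((\<lambda>t. A t $ i $ j) has_vector_derivative A' $ i $ j) (at 0)"
    and real: "\<And>i j. Im (\<Sum>k\<in>UNIV. cnj (A 0 $ k $ i) * A 0 $ k $ j) = 0"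
    and nz: "det (A 0) \<noteq> 0"
    and d': "d' = (\<Sum>a\<in>UNIV. det (replace_column (A 0) a (column a A')))"
  shows "((\<lambda>t. sqrt (det (\<chi> i j. \<Sum>k\<in>UNIV. A t $ k $ i \<bullet> A t $ k $ j))) has_real_derivative
      Re (cnj (det (A 0)) * d') / cmod (det (A 0))) (at 0)"
proof -
  define h where "h t = (\<chi> i j. \<Sum>k\<in>UNIV. cnj (A t $ k $ i) * A t $ k $ j)" for t
  define g where "g t = (\<chi> i j. \<Sum>k\<in>UNIV. A t $ k $ i \<bullet> A t $ k $ j)" for t
  define h' where "h' = (\<chi> i j. \<Sum>k\<in>UNIV. cnj (A 0 $ k $ i) * A' $ k $ j + cnj (A' $ k $ i) * A 0 $ k $ j)"
  define R where "R = (\<chi> i j. complex_of_real (Re (h' $ i $ j)))"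
  define K where "K = (\<chi> i j. complex_of_real (Im (h' $ i $ j)))"
  let ?d = "det (A 0)"
  let ?G = "\<lambda>t. \<chi> i j. complex_of_real (g t $ i $ j)"
  let ?\<delta> = "\<lambda>X. \<Sum>a\<in>UNIV. det (replace_column (h 0) a (column a X))"
  have g_h: "g t $ i $ j = Re (h t $ i $ j)" for t i j
    by (simp add: g_def h_def inner_complex_def)
  have h0: "?G 0 = h 0"
    using real by (simp add: vec_eq_iff g_h complex_eq_iff) (simp add: h_def)
  have A_der: "((\<lambda>t. A t $ i $ j) has_derivative (\<lambda>t. t *\<^sub>R (A' $ i $ j))) (at 0)" for i j
    using A by (simp add: has_vector_derivative_def)
  have h_der: "((\<lambda>t. h t $ i $ j) has_derivative (\<lambda>t. (t *\<^sub>R h') $ i $ j)) (at 0)" for i j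
  proof -
    have "((\<lambda>t. \<Sum>k\<in>UNIV. cnj (A t $ k $ i) * A t $ k $ j) has_derivative
        (\<lambda>t. \<Sum>k\<in>UNIV. cnj (A 0 $ k $ i) * (t *\<^sub>R A' $ k $ j) + cnj (t *\<^sub>R A' $ k $ i) * A 0 $ k $ j)) (at 0)"
      by (intro has_derivative_sum has_derivative_mult has_derivative_cnj A_der)
    then show ?thesis
      by (simp add: h_def h'_def scaleR_right.sum scaleR_add_right)
  qed
  have det_h: "det (h t) = cnj (det (A t)) * det (A t)" for t
  proof -
    have "h t = transpose (\<chi> i j. cnj (A t $ i $ j)) ** A t"
      by (simp add: h_def matrix_matrix_mult_def transpose_def vec_eq_iff)
    then show ?thesis by (simp add: det_mul det_cnj)
  qed
  have "((\<lambda>t. det (A t)) has_derivative (\<lambda>t. t *\<^sub>R d')) (at 0)"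
  proof (rule has_derivative_eq_rhs[OF has_derivative_det[where A' = "\<lambda>t. t *\<^sub>R A'"]])
    show "((\<lambda>t. A t $ i $ j) has_derivative (\<lambda>t. (t *\<^sub>R A') $ i $ j)) (at 0)" for i j
      using A_der by simp
    have "column a (t *\<^sub>R A') = complex_of_real t *s column a A'" for a t
      by (simp add: column_def vec_eq_iff) (simp add: scaleR_conv_of_real)
    then show "(\<lambda>t. \<Sum>a\<in>UNIV. det (replace_column (A 0) a (column a (t *\<^sub>R A')))) = (\<lambda>t. t *\<^sub>R d')"
      by (simp add: det_replace_column_scale d' sum_distrib_left scaleR_conv_of_real fun_eq_iff)
  qed
  then have "((\<lambda>t. det (h t)) has_derivative (\<lambda>t. cnj ?d * (t *\<^sub>R d') + cnj (t *\<^sub>R d') * ?d)) (at 0)"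
    unfolding det_h by (intro has_derivative_mult has_derivative_cnj)
  moreover have "((\<lambda>t. det (h t)) has_derivative (\<lambda>t. ?\<delta> (t *\<^sub>R h'))) (at 0)"
    by (rule has_derivative_det) (rule h_der)
  ultimately have "(\<lambda>t. ?\<delta> (t *\<^sub>R h')) = (\<lambda>t. cnj ?d * (t *\<^sub>R d') + cnj (t *\<^sub>R d') * ?d)"
    by (rule has_derivative_unique[rotated])
  from fun_cong[OF this, of 1] have "?\<delta> h' = cnj ?d * d' + cnj d' * ?d"
    by simp
  also have "\<dots> = of_real (2 * Re (cnj ?d * d'))"
    unfolding complex_eq_iff by simp
  finally have \<delta>h: "?\<delta> h' = of_real (2 * Re (cnj ?d * d'))" .
  have h'_herm: "h' $ j $ i = cnj (h' $ i $ j)" for i j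
    by (simp add: h'_def mult.commute add.commute)
  have "?\<delta> K = 0"
  proof (rule det_derivative_antisymmetric_eq_0)
    show "transpose (h 0) = h 0"
      unfolding h0[symmetric] by (simp add: transpose_def vec_eq_iff g_def inner_commute)
    have "K $ j $ i = (- K) $ i $ j" for i j
      using h'_herm[of j i] by (simp add: K_def)
    then show "transpose K = - K" by (rule transpose_eqI)
  qed
  moreover have "?\<delta> h' = ?\<delta> R + \<i> * ?\<delta> K"
  proof -
    have "column a h' = column a R + \<i> *s column a K" for a
      by (simp add: column_def vec_eq_iff R_def K_def complex_eq_iff)
    then show ?thesis
      by (simp add: det_replace_column_add det_replace_column_scale sum.distrib sum_distrib_left)
  qed
  ultimately have \<delta>R: "?\<delta> R = of_real (2 * Re (cnj ?d * d'))" using \<delta>h by simp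
  have "((\<lambda>t. det (?G t)) has_derivative (\<lambda>t. \<Sum>a\<in>UNIV. det (replace_column (?G 0) a (column a (t *\<^sub>R R))))) (at 0)"
  proof (rule has_derivative_det)
    show "((\<lambda>t. ?G t $ i $ j) has_derivative (\<lambda>t. (t *\<^sub>R R) $ i $ j)) (at 0)" for i j
    proof -
      have "((\<lambda>t. complex_of_real (Re (h t $ i $ j))) has_derivative (\<lambda>t. complex_of_real (Re ((t *\<^sub>R h') $ i $ j)))) (at 0)"
        by (intro has_derivative_of_real has_derivative_Re h_der)
      then show ?thesis by (simp add: g_h R_def scaleR_conv_of_real[where 'a = complex])
    qed
  qed
  moreover have "column a (t *\<^sub>R R) = complex_of_real t *s column a R" for a t
    by (simp add: column_def vec_eq_iff) (simp add: scaleR_conv_of_real)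
  ultimately have "((\<lambda>t. complex_of_real (det (g t))) has_derivative (\<lambda>t. of_real t * ?\<delta> R)) (at 0)"
    by (simp add: h0 det_replace_column_scale sum_distrib_left det_of_real)
  then have "((\<lambda>t. Re (complex_of_real (det (g t)))) has_derivative (\<lambda>t. Re (of_real t * ?\<delta> R))) (at 0)"
    by (rule has_derivative_Re)
  then have det_g: "((\<lambda>t. det (g t)) has_real_derivative 2 * Re (cnj ?d * d')) (at 0)"
    unfolding \<delta>R has_field_derivative_def Re_complex_of_real
    by (rule has_derivative_eq_rhs) (simp add: fun_eq_iff)
  have "complex_of_real (det (g 0)) = det (h 0)"
    unfolding h0[symmetric] by (rule det_of_real[symmetric])
  also have "\<dots> = of_real ((cmod ?d)\<^sup>2)"
    unfolding det_h complex_norm_square by (rule mult.commute)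
  finally have g0: "det (g 0) = (cmod ?d)\<^sup>2" by (simp only: of_real_eq_iff)
  have "((\<lambda>t. sqrt (det (g t))) has_real_derivative inverse (sqrt (det (g 0))) / 2 * (2 * Re (cnj ?d * d'))) (at 0)"
  proof (rule DERIV_chain2[OF DERIV_real_sqrt det_g])
    show "0 < det (g 0)" unfolding g0 using nz by simp
  qed
  moreover have "inverse (sqrt (det (g 0))) / 2 * (2 * x) = x / cmod ?d" for x
    unfolding g0 by (simp add: inverse_eq_divide)
  ultimately show ?thesis unfolding g_def by (simp only:)
qed

subsection \<open>The Jacobian matrix of a map into complex Euclidean space\<close>

definition jacobian_matrix :: "(real^'N::finite \<Rightarrow> complex^'N) \<Rightarrow> real^'N \<Rightarrow> complex^'N^'N" where
  "jacobian_matrix F u = (\<chi> i j. partial j F u $ i)"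

lemma column_jacobian_matrix [simp]: "column j (jacobian_matrix F u) = partial j F u"
  by (simp add: column_def jacobian_matrix_def vec_eq_iff)

lemma smooth_on_open_partial[smooth_intros]:
  "smooth_on_open F U \<Longrightarrow> smooth_on_open (partial a F) U"
  unfolding partial_def by (rule smooth_on_open_derivative)

lemma smooth_on_open_jacobian_matrix[smooth_intros]:
  "smooth_on_open F U \<Longrightarrow> smooth_on_open (jacobian_matrix F) U"
  unfolding jacobian_matrix_def
  by (intro smooth_intros) (auto dest: smooth_on_open_openD)

lemma smooth_on_open_replace_column[smooth_intros]:
  fixes A :: "real^'N::finite \<Rightarrow> complex^'N^'N"
  assumes "smooth_on_open A U" "smooth_on_open V U"
  shows "smooth_on_open (\<lambda>u. replace_column (A u) a (V u)) U"
  unfolding replace_column_def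
proof (intro smooth_on_open_vec_lambda smooth_on_open_openD[OF assms(1)])
  show "smooth_on_open (\<lambda>u. if j = a then V u $ i else A u $ i $ j) U" for i j
    by (cases "j = a") (simp_all add: smooth_intros assms)
qed

lemma partial_symmetric:
  fixes F :: "real^'N::finite \<Rightarrow> 'b::euclidean_space"
  assumes "smooth_on_open F U" "u \<in> U"
  shows "partial a (partial b F) u = partial b (partial a F) u"
  unfolding partial_def[abs_def] by (rule symmetric_second_derivative[OF assms])

lemma has_derivative_jacobian_entry:
  assumes "smooth_on_open F U" "u \<in> U"
  shows "((\<lambda>u. jacobian_matrix F u $ i $ j) has_derivative
     (\<lambda>v. frechet_derivative (partial j F) (at u) v $ i)) (at u)"
  unfolding jacobian_matrix_def
  using bounded_linear.has_derivative[OF bounded_linear_vec_nth smooth_on_open_has_derivative[OF smooth_on_open_partial[OF assms(1)] assms(2)]]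
  by simp

text \<open>The terms with second derivatives of \<open>F\<close> cancel in pairs: the columns \<open>a\<close> and \<open>b\<close> hold
  \<open>V\<close> and \<open>\<partial>\<^sub>a\<partial>\<^sub>bF\<close>, once in either order.\<close>

lemma divergence_det_replace_column:
  fixes F V :: "real^'N::finite \<Rightarrow> complex^'N"
  assumes F: "smooth_on_open F U" and V: "smooth_on_open V U" and u: "u \<in> U"
  shows "(\<Sum>a\<in>UNIV. partial a (\<lambda>u. det (replace_column (jacobian_matrix F u) a (V u))) u) =
         (\<Sum>a\<in>UNIV. det (replace_column (jacobian_matrix F u) a (partial a V u)))"
proof -
  let ?A = "jacobian_matrix F u"
  define T where "T a b = det (replace_column (replace_column ?A a (V u)) b (partial a (partial b F) u))" for a b
  have pa: "partial a (\<lambda>u. det (replace_column (jacobian_matrix F u) a (V u))) u =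
      det (replace_column ?A a (partial a V u)) + (\<Sum>b\<in>UNIV - {a}. T a b)" for a
  proof -
    let ?B' = "\<lambda>v. \<chi> i j. if j = a then frechet_derivative V (at u) v $ i else frechet_derivative (partial j F) (at u) v $ i"
    have "((\<lambda>u. det (replace_column (jacobian_matrix F u) a (V u))) has_derivative
        (\<lambda>v. \<Sum>b\<in>UNIV. det (replace_column (replace_column ?A a (V u)) b (column b (?B' v))))) (at u)"
    proof (rule has_derivative_det)
      show "((\<lambda>u. replace_column (jacobian_matrix F u) a (V u) $ i $ j) has_derivative (\<lambda>v. ?B' v $ i $ j)) (at u)" for i j
        using has_derivative_jacobian_entry[OF F u, of i j]
          bounded_linear.has_derivative[OF bounded_linear_vec_nth smooth_on_open_has_derivative[OF V u], of i]
        by (cases "j = a") (simp_all add: replace_column_def)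
    qed
    then have "partial a (\<lambda>u. det (replace_column (jacobian_matrix F u) a (V u))) u =
        (\<Sum>b\<in>UNIV. det (replace_column (replace_column ?A a (V u)) b (column b (?B' (axis a 1)))))"
      unfolding partial_def by (simp add: frechet_derivative_eqI)
    also have "\<dots> = det (replace_column (replace_column ?A a (V u)) a (column a (?B' (axis a 1)))) +
        (\<Sum>b\<in>UNIV - {a}. det (replace_column (replace_column ?A a (V u)) b (column b (?B' (axis a 1)))))"
      by (rule sum.remove) auto
    also have "replace_column (replace_column ?A a (V u)) a (column a (?B' (axis a 1))) = replace_column ?A a (partial a V u)"
      by (simp add: replace_column_def column_def vec_eq_iff partial_def)
    also have "(\<Sum>b\<in>UNIV - {a}. det (replace_column (replace_column ?A a (V u)) b (column b (?B' (axis a 1))))) =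
        (\<Sum>b\<in>UNIV - {a}. T a b)"
      by (intro sum.cong refl) (simp add: T_def column_def partial_def)
    finally show ?thesis .
  qed
  have anti: "T b a = - T a b" if "a \<noteq> b" for a b
  proof -
    let ?X = "replace_column (replace_column ?A a (V u)) b (partial a (partial b F) u)"
    have "replace_column (replace_column ?A b (V u)) a (partial b (partial a F) u) = (\<chi> i j. ?X $ i $ Transposition.transpose a b j)"
      using that partial_symmetric[OF F u, of a b]
      by (auto simp: replace_column_def vec_eq_iff Transposition.transpose_def)
    moreover have "Transposition.transpose a b permutes (UNIV :: 'N set)" by (rule permutes_swap_id) auto
    ultimately have "T b a = of_int (sign (Transposition.transpose a b)) * det ?X"
      unfolding T_def using det_permute_columns by metis
    then show ?thesis using that by (simp add: T_def sign_swap_id)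
  qed
  define S where "S a b = (if a = b then 0 else T a b)" for a b
  have S_anti: "S b a = - S a b" for a b
    by (cases "a = b") (simp_all add: S_def anti[of a b])
  have "(\<Sum>a\<in>UNIV. \<Sum>b\<in>UNIV. S a b) = (\<Sum>a\<in>UNIV. \<Sum>b\<in>UNIV. S b a)"
    by (rule sum.swap)
  also have "\<dots> = (\<Sum>a\<in>UNIV. \<Sum>b\<in>UNIV. - S a b)"
    by (intro sum.cong refl S_anti)
  also have "\<dots> = - (\<Sum>a\<in>UNIV. \<Sum>b\<in>UNIV. S a b)"
    by (simp only: sum_negf)
  finally have S0: "(\<Sum>a\<in>UNIV. \<Sum>b\<in>UNIV. S a b) = 0" by simp
  have "(\<Sum>b\<in>UNIV - {a}. T a b) = (\<Sum>b\<in>UNIV. S a b)" for a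
  proof -
    have "(\<Sum>b\<in>UNIV. S a b) = S a a + (\<Sum>b\<in>UNIV - {a}. S a b)"
      by (rule sum.remove) auto
    also have "(\<Sum>b\<in>UNIV - {a}. S a b) = (\<Sum>b\<in>UNIV - {a}. T a b)"
      by (intro sum.cong refl) (auto simp: S_def)
    finally show ?thesis by (simp add: S_def)
  qed
  with S0 have "(\<Sum>a\<in>UNIV. \<Sum>b\<in>UNIV - {a}. T a b) = 0" by simp
  then show ?thesis by (simp add: pa sum.distrib)
qed

section \<open>Lagrangian frames\<close>

definition complex_vec :: "real^'n \<Rightarrow> complex^'n" where
  "complex_vec x = (\<chi> i. complex_of_real (x $ i))"

lemma complex_vec_component [simp]: "complex_vec x $ i = complex_of_real (x $ i)"
  by (simp add: complex_vec_def)

lemma frechet_derivative_eq_jacobian_matrix: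
  fixes F :: "real^'N::finite \<Rightarrow> complex^'N"
  assumes "F differentiable (at u)"
  shows "frechet_derivative F (at u) v = jacobian_matrix F u *v complex_vec v"
  using linear_eq_sum_axis[OF linear_frechet_derivative[OF assms], of v]
  by (simp add: vec_eq_iff jacobian_matrix_def matrix_vector_mult_def sum_component partial_def
      scaleR_conv_of_real[where 'a = complex] mult.commute)

lemma symplectic_form_eq_Im: "symplectic_form v w = Im (\<Sum>k\<in>UNIV. cnj (v $ k) * w $ k)"
  by (simp add: symplectic_form_def J_def inner_vec_def inner_complex_def)

lemma inner_eq_Re: "v \<bullet> w = Re (\<Sum>k\<in>UNIV. cnj (v $ k) * w $ k)" for v w :: "complex^'n::finite"
  by (simp add: inner_vec_def inner_complex_def)

lemma J_J: "J (J v) = - v"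
  by (simp add: J_def vec_eq_iff)

lemma J_add: "J (v + w) = J v + J w"
  by (simp add: J_def vec_eq_iff distrib_left)

lemma J_inner_J: "J v \<bullet> J w = v \<bullet> w"
  by (simp add: J_def inner_vec_def inner_complex_def algebra_simps)

lemma symplectic_form_J: "symplectic_form (J v) w = - (v \<bullet> w)"
  by (simp add: symplectic_form_def J_J)

lemma symplectic_form_add: "symplectic_form (v + v') w = symplectic_form v w + symplectic_form v' w"
  by (simp add: symplectic_form_def J_add inner_add_left)

definition lagrangian_at :: "(real^'N::finite \<Rightarrow> complex^'N) \<Rightarrow> real^'N \<Rightarrow> bool" where
  "lagrangian_at F u \<longleftrightarrow> F differentiable (at u) \<and> inj (frechet_derivative F (at u)) \<and>
     (\<forall>v w. symplectic_form (frechet_derivative F (at u) v) (frechet_derivative F (at u) w) = 0)"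

lemma lagrangian_at_gram:
  fixes F :: "real^'N::finite \<Rightarrow> complex^'N"
  assumes "lagrangian_at F u"
  shows "Im (\<Sum>k\<in>UNIV. cnj (jacobian_matrix F u $ k $ i) * jacobian_matrix F u $ k $ j) = 0"
  using assms unfolding lagrangian_at_def symplectic_form_eq_Im
  by (simp add: jacobian_matrix_def partial_def)

lemma induced_metric_eq_gram:
  fixes F :: "real^'N::finite \<Rightarrow> complex^'N"
  shows "induced_metric F u = (\<chi> i j. \<Sum>k\<in>UNIV. jacobian_matrix F u $ k $ i \<bullet> jacobian_matrix F u $ k $ j)"
  by (simp add: induced_metric_def jacobian_matrix_def inner_vec_def)

lemma inner_induced_metric:
  fixes F :: "real^'N::finite \<Rightarrow> 'v::real_inner"
  assumes "F differentiable (at u)"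
  shows "frechet_derivative F (at u) v \<bullet> frechet_derivative F (at u) w = v \<bullet> (induced_metric F u *v w)"
proof -
  have "frechet_derivative F (at u) v = (\<Sum>i\<in>UNIV. v $ i *\<^sub>R partial i F u)" for v
    unfolding partial_def by (rule linear_eq_sum_axis[OF linear_frechet_derivative[OF assms]])
  then show ?thesis
    by (simp add: induced_metric_def inner_vec_def matrix_vector_mult_def inner_sum_left inner_sum_right
        sum_distrib_left mult_ac) (rule sum.swap)
qed

lemma det_induced_metric_nonzero:
  fixes F :: "real^'N::finite \<Rightarrow> 'v::real_inner"
  assumes "F differentiable (at u)" "inj (frechet_derivative F (at u))"
  shows "det (induced_metric F u) \<noteq> 0"
proof -
  have "v = 0" if "induced_metric F u *v v = 0" for v
  proof -
    have "frechet_derivative F (at u) v \<bullet> frechet_derivative F (at u) v = 0"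
      unfolding inner_induced_metric[OF assms(1)] that by simp
    then have "frechet_derivative F (at u) v = frechet_derivative F (at u) 0"
      using linear_0[OF linear_frechet_derivative[OF assms(1)]] by simp
    then show ?thesis using assms(2) by (simp add: inj_def)
  qed
  then show ?thesis
    using matrix_left_invertible_ker[of "induced_metric F u"] invertible_det_nz[of "induced_metric F u"] invertible_left_inverse
    by blast
qed

text \<open>Isotropy makes the Gram matrix \<open>A\<^sup>* A\<close> of the columns real, so that it is the induced metric.\<close>

lemma det_induced_metric_lagrangian:
  fixes F :: "real^'N::finite \<Rightarrow> complex^'N"
  assumes "lagrangian_at F u"
  shows "det (induced_metric F u) = (cmod (det (jacobian_matrix F u)))\<^sup>2"
proof -
  let ?A = "jacobian_matrix F u"
  have "(\<chi> i j. complex_of_real (induced_metric F u $ i $ j)) = transpose (\<chi> i j. cnj (?A $ i $ j)) ** ?A"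
    unfolding induced_metric_eq_gram
    using lagrangian_at_gram[OF assms]
    by (simp add: vec_eq_iff matrix_matrix_mult_def transpose_def complex_eq_iff inner_complex_def)
  then have "complex_of_real (det (induced_metric F u)) = cnj (det ?A) * det ?A"
    unfolding det_of_real[symmetric] by (simp add: det_mul det_cnj)
  also have "\<dots> = of_real ((cmod (det ?A))\<^sup>2)"
    unfolding complex_norm_square by (rule mult.commute)
  finally show ?thesis by (simp only: of_real_eq_iff)
qed

lemma det_jacobian_matrix_nonzero:
  assumes "lagrangian_at F u"
  shows "det (jacobian_matrix F u) \<noteq> 0"
  using det_induced_metric_lagrangian[OF assms] det_induced_metric_nonzero[of F u] assms
  by (auto simp: lagrangian_at_def)

lemma volume_density_lagrangian:
  assumes "lagrangian_at F u"
  shows "volume_density F u = cmod (det (jacobian_matrix F u))"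
  by (simp add: volume_density_def det_induced_metric_lagrangian[OF assms])

text \<open>The coordinates of a vector with respect to the complex basis \<open>\<partial>\<^sub>aF\<close>, by the rule of Cramer.  Their
  real parts describe the tangential part of the vector and their imaginary parts the normal part.\<close>

definition frame_coordinates :: "(real^'N::finite \<Rightarrow> complex^'N) \<Rightarrow> real^'N \<Rightarrow> complex^'N \<Rightarrow> complex^'N" where
  "frame_coordinates F u V = (\<chi> a. det (replace_column (jacobian_matrix F u) a V) / det (jacobian_matrix F u))"

lemma jacobian_matrix_frame_coordinates:
  assumes "lagrangian_at F u"
  shows "jacobian_matrix F u *v frame_coordinates F u V = V"
  using cramer[OF det_jacobian_matrix_nonzero[OF assms], of "frame_coordinates F u V" V]
  by (simp add: frame_coordinates_def replace_column_def)

lemma frame_coordinates_unique: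
  assumes "lagrangian_at F u" "jacobian_matrix F u *v c = V"
  shows "frame_coordinates F u V = c"
  using det_jacobian_matrix_nonzero[OF assms(1)]
  by (simp add: frame_coordinates_def vec_eq_iff assms(2)[symmetric] det_replace_column_cramer)

definition tangent_coordinates :: "(real^'N::finite \<Rightarrow> complex^'N) \<Rightarrow> real^'N \<Rightarrow> complex^'N \<Rightarrow> real^'N" where
  "tangent_coordinates F u V = (\<chi> a. Re (frame_coordinates F u V $ a))"

definition normal_coordinates :: "(real^'N::finite \<Rightarrow> complex^'N) \<Rightarrow> real^'N \<Rightarrow> complex^'N \<Rightarrow> real^'N" where
  "normal_coordinates F u V = (\<chi> a. Im (frame_coordinates F u V $ a))"

lemma matrix_vector_mult_complex_vec:
  "A *v (complex_vec x + \<i> *s complex_vec y) = A *v complex_vec x + J (A *v complex_vec y)"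
  by (simp add: matrix_vector_mult_def J_def vec_eq_iff sum_distrib_left sum.distrib[symmetric] algebra_simps)

lemma lagrangian_decomposition:
  fixes F :: "real^'N::finite \<Rightarrow> complex^'N"
  assumes "lagrangian_at F u"
  shows "V = frechet_derivative F (at u) (tangent_coordinates F u V) +
    J (frechet_derivative F (at u) (normal_coordinates F u V))"
proof -
  have "frame_coordinates F u V = complex_vec (tangent_coordinates F u V) + \<i> *s complex_vec (normal_coordinates F u V)"
    by (simp add: vec_eq_iff tangent_coordinates_def normal_coordinates_def complex_eq_iff)
  then show ?thesis
    using jacobian_matrix_frame_coordinates[OF assms, of V] assms
    by (simp add: frechet_derivative_eq_jacobian_matrix lagrangian_at_def matrix_vector_mult_complex_vec)
qed

lemma frame_coordinates_decomposition:
  fixes F :: "real^'N::finite \<Rightarrow> complex^'N"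
  assumes "lagrangian_at F u"
    and "V = frechet_derivative F (at u) x + J (frechet_derivative F (at u) y)"
  shows "frame_coordinates F u V = complex_vec x + \<i> *s complex_vec y"
proof (rule frame_coordinates_unique[OF assms(1)])
  have "F differentiable (at u)" using assms(1) by (simp add: lagrangian_at_def)
  then show "jacobian_matrix F u *v (complex_vec x + \<i> *s complex_vec y) = V"
    by (simp add: assms(2) frechet_derivative_eq_jacobian_matrix matrix_vector_mult_complex_vec)
qed

lemma coordinates_decomposition:
  fixes F :: "real^'N::finite \<Rightarrow> complex^'N"
  assumes "lagrangian_at F u"
    and "V = frechet_derivative F (at u) x + J (frechet_derivative F (at u) y)"
  shows "tangent_coordinates F u V = x" "normal_coordinates F u V = y"
  unfolding tangent_coordinates_def normal_coordinates_def frame_coordinates_decomposition[OF assms]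
  by (simp_all add: vec_eq_iff)

text \<open>Against tangent vectors, \<open>\<omega>(V, _)\<close> sees the normal part of \<open>V\<close> only.\<close>

lemma symplectic_form_normal_coordinates:
  fixes F :: "real^'N::finite \<Rightarrow> complex^'N"
  assumes "lagrangian_at F u"
  shows "symplectic_form V (frechet_derivative F (at u) w) =
    - (frechet_derivative F (at u) (normal_coordinates F u V) \<bullet> frechet_derivative F (at u) w)"
  using assms
  by (subst lagrangian_decomposition[OF assms, of V])
     (simp add: symplectic_form_add symplectic_form_J lagrangian_at_def)


section \<open>The gradient of the Lagrangian angle\<close>

text \<open>The columns of the Jacobian matrix of a Lagrangian map span a Lagrangian subspace, whose
  angle \<open>\<beta>\<close> is defined by \<open>det = e\<^sup>i\<^sup>\<beta> \<bar>det\<bar>\<close>, up to the sign which depends on the orientation of the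
  chart.  Here \<open>E\<close> represents \<open>e\<^sup>i\<^sup>\<beta>\<close> up to a fourth root of unity, which does not change
  \<open>d\<beta>\<close>, and \<open>W\<close> is the image of the gradient of \<open>\<beta>\<close> under the differential of the immersion.\<close>

definition angle_gradient ::
  "'e::euclidean_space set \<Rightarrow> ('e \<Rightarrow> complex^'N::finite) \<Rightarrow> ('e \<Rightarrow> complex) \<Rightarrow> ('e \<Rightarrow> complex^'N) \<Rightarrow> bool" where
  "angle_gradient M \<Phi> E W \<longleftrightarrow> smooth_map E M \<and> smooth_map W M \<and>
     (\<forall>(U :: (real^'N) set) \<phi>. local_param M U \<phi> \<longrightarrow> (\<forall>u\<in>U.
        det (jacobian_matrix (\<Phi> \<circ> \<phi>) u) ^ 4 = of_real (cmod (det (jacobian_matrix (\<Phi> \<circ> \<phi>) u)) ^ 4) * E (\<phi> u) ^ 4 \<and>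
        (\<forall>v. frechet_derivative (E \<circ> \<phi>) (at u) v =
             \<i> * E (\<phi> u) * of_real (W (\<phi> u) \<bullet> frechet_derivative (\<Phi> \<circ> \<phi>) (at u) v)) \<and>
        W (\<phi> u) \<in> range (frechet_derivative (\<Phi> \<circ> \<phi>) (at u))))"

lemma angle_gradientD:
  fixes \<Phi> :: "'e::euclidean_space \<Rightarrow> complex^'N::finite" and \<phi> :: "real^'N \<Rightarrow> 'e"
  assumes "angle_gradient M \<Phi> E W"
  shows "smooth_map E M" "smooth_map W M"
    and "\<And>u. local_param M U \<phi> \<Longrightarrow> u \<in> U \<Longrightarrow> det (jacobian_matrix (\<Phi> \<circ> \<phi>) u) ^ 4 =
      of_real (cmod (det (jacobian_matrix (\<Phi> \<circ> \<phi>) u)) ^ 4) * E (\<phi> u) ^ 4"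
    and "\<And>u v. local_param M U \<phi> \<Longrightarrow> u \<in> U \<Longrightarrow> frechet_derivative (E \<circ> \<phi>) (at u) v =
             \<i> * E (\<phi> u) * of_real (W (\<phi> u) \<bullet> frechet_derivative (\<Phi> \<circ> \<phi>) (at u) v)"
    and "\<And>u. local_param M U \<phi> \<Longrightarrow> u \<in> U \<Longrightarrow> W (\<phi> u) \<in> range (frechet_derivative (\<Phi> \<circ> \<phi>) (at u))"
  using assms unfolding angle_gradient_def by simp_all

lemma lagrangian_immersionD:
  fixes \<Phi> :: "'e::euclidean_space \<Rightarrow> complex^'N::finite" and \<phi> :: "real^'N \<Rightarrow> 'e"
  assumes "lagrangian_immersion M \<Phi>"
  shows "smooth_map \<Phi> M"
    and "local_param M U \<phi> \<Longrightarrow> smooth_on_open (\<Phi> \<circ> \<phi>) U"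
    and "\<And>u. local_param M U \<phi> \<Longrightarrow> u \<in> U \<Longrightarrow> lagrangian_at (\<Phi> \<circ> \<phi>) u"
proof -
  show s: "smooth_map \<Phi> M"
    using assms by (simp add: lagrangian_immersion_def immersion_def)
  show *: "smooth_on_open (\<Phi> \<circ> \<phi>) U" if "local_param M U \<phi>"
    unfolding o_def by (rule smooth_map_chart[OF s that])
  show "lagrangian_at (\<Phi> \<circ> \<phi>) u" if "local_param M U \<phi>" "u \<in> U" for u
    using assms that smooth_on_open_differentiable[OF *[OF that(1)] that(2)]
    unfolding lagrangian_at_def lagrangian_immersion_def immersion_def by blast
qed

definition inverse_phase :: "(real^'N::finite \<Rightarrow> complex^'N) \<Rightarrow> real^'N \<Rightarrow> complex" where
  "inverse_phase F u = of_real (cmod (det (jacobian_matrix F u))) / det (jacobian_matrix F u)"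

lemma cmod_eq_sqrt_inner: "cmod z = sqrt (z \<bullet> z)"
  by (simp add: norm_eq_sqrt_inner)

lemma smooth_on_open_norm_nonzero:
  fixes f :: "'a::euclidean_space \<Rightarrow> complex"
  assumes "smooth_on_open f U" "\<And>u. u \<in> U \<Longrightarrow> f u \<noteq> 0"
  shows "smooth_on_open (\<lambda>u. cmod (f u)) U"
  unfolding cmod_eq_sqrt_inner using assms by (intro smooth_intros) auto

locale lagrangian_chart =
  fixes M :: "'e::euclidean_space set" and \<Phi> :: "'e \<Rightarrow> complex^'N::finite" and E W
    and U :: "(real^'N) set" and \<phi> :: "real^'N \<Rightarrow> 'e"
  assumes L: "lagrangian_immersion M \<Phi>" and G: "angle_gradient M \<Phi> E W" and c: "local_param M U \<phi>"
begin

abbreviation "F \<equiv> \<Phi> \<circ> \<phi>"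

lemmas smooth_F = lagrangian_immersionD(2)[OF L c]
lemmas lagrangian_F = lagrangian_immersionD(3)[OF L c]

lemma smooth_det_F: "smooth_on_open (\<lambda>u. det (jacobian_matrix F u)) U"
  using smooth_F by (intro smooth_intros smooth_on_open_openD)

lemma det_F_nonzero: "u \<in> U \<Longrightarrow> det (jacobian_matrix F u) \<noteq> 0"
  by (rule det_jacobian_matrix_nonzero[OF lagrangian_F])

lemma smooth_cmod_det_F: "smooth_on_open (\<lambda>u. cmod (det (jacobian_matrix F u))) U"
  by (rule smooth_on_open_norm_nonzero[OF smooth_det_F det_F_nonzero])

lemma smooth_inverse_phase: "smooth_on_open (inverse_phase F) U"
  unfolding inverse_phase_def[abs_def]
  by (intro smooth_on_open_divide smooth_on_open_of_real smooth_cmod_det_F smooth_det_F det_F_nonzero)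

text \<open>The fourth power of \<open>inverse_phase F * E\<close> is constant, so the logarithmic derivatives of the two
  factors add up to zero.\<close>

lemma derivative_inverse_phase:
  assumes u: "u \<in> U"
  shows "frechet_derivative (inverse_phase F) (at u) v =
    - \<i> * inverse_phase F u * of_real (W (\<phi> u) \<bullet> frechet_derivative F (at u) v)"
proof -
  let ?q = "inverse_phase F" and ?e = "\<lambda>u. E (\<phi> u)"
  have qe: "(?q w * ?e w) ^ 4 = 1" if "w \<in> U" for w
  proof -
    have "(?q w * ?e w) ^ 4 = of_real (cmod (det (jacobian_matrix F w)) ^ 4) * ?e w ^ 4 / det (jacobian_matrix F w) ^ 4"
      by (simp add: inverse_phase_def power_mult_distrib power_divide)
    also have "\<dots> = 1"
      unfolding angle_gradientD(3)[OF G c that, symmetric] using det_F_nonzero[OF that] by simp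
    finally show ?thesis .
  qed
  have q: "(?q has_derivative frechet_derivative ?q (at u)) (at u)"
    by (rule smooth_on_open_has_derivative[OF smooth_inverse_phase u])
  have e: "(?e has_derivative frechet_derivative (E \<circ> \<phi>) (at u)) (at u)"
    using smooth_on_open_has_derivative[OF smooth_map_chart[OF angle_gradientD(1)[OF G] c] u] by (simp add: o_def)
  let ?p = "?q u * ?e u"
  have p: "((\<lambda>w. ?q w * ?e w) has_derivative (\<lambda>v. ?q u * frechet_derivative (E \<circ> \<phi>) (at u) v +
      frechet_derivative ?q (at u) v * ?e u)) (at u)" (is "(_ has_derivative ?D) _")
    by (rule has_derivative_mult[OF q e])
  from has_derivative_power[OF p, of 4]
  have "((\<lambda>w. (?q w * ?e w) ^ 4) has_derivative (\<lambda>v. of_nat 4 * ?D v * ?p ^ 3)) (at u)" by simp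
  then have "((\<lambda>w. 1) has_derivative (\<lambda>v. of_nat 4 * ?D v * ?p ^ 3)) (at u)"
    by (rule has_derivative_transform_within_open[OF _ local_paramD(2)[OF c] u]) (rule qe)
  then have "(\<lambda>v. of_nat 4 * ?D v * ?p ^ 3) = (\<lambda>v. 0)"
    using has_derivative_unique has_derivative_const by blast
  from fun_cong[OF this, of v] have "of_nat 4 * ?D v * ?p ^ 3 = 0" .
  moreover have "?p \<noteq> 0" using qe[OF u] by auto
  moreover have "x = 0" if "of_nat 4 * x * y ^ 3 = 0" "y \<noteq> 0" for x y :: complex
    using that by simp
  ultimately have "?D v = 0" by blast
  then have "(frechet_derivative ?q (at u) v + \<i> * ?q u * of_real (W (\<phi> u) \<bullet> frechet_derivative F (at u) v)) * ?e u = 0"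
    unfolding angle_gradientD(4)[OF G c u] by (simp add: algebra_simps)
  then show ?thesis
    using \<open>?p \<noteq> 0\<close> by (simp add: add_eq_0_iff)
qed

text \<open>The product rule for the inverse phase and the determinants, with the derivatives from
  \<open>derivative_inverse_phase\<close> and \<open>divergence_det_replace_column\<close>.  The real part of the left side is the
  rate of change of the volume density under a variation with velocity \<open>V\<close>.\<close>

lemma divergence_identity:
  assumes V: "smooth_on_open V U" and u: "u \<in> U"
  shows "inverse_phase F u * (\<Sum>a\<in>UNIV. det (replace_column (jacobian_matrix F u) a (partial a V u))) =
    (\<Sum>a\<in>UNIV. partial a (\<lambda>u. inverse_phase F u * det (replace_column (jacobian_matrix F u) a (V u))) u) +
    \<i> * (\<Sum>a\<in>UNIV. of_real (W (\<phi> u) \<bullet> partial a F u) * (inverse_phase F u * det (replace_column (jacobian_matrix F u) a (V u))))"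
proof -
  let ?D = "\<lambda>a u. det (replace_column (jacobian_matrix F u) a (V u))"
  have D: "smooth_on_open (?D a) U" for a
    using smooth_F V by (intro smooth_intros smooth_on_open_openD)
  have "partial a (\<lambda>u. inverse_phase F u * ?D a u) u =
      inverse_phase F u * partial a (?D a) u - \<i> * (of_real (W (\<phi> u) \<bullet> partial a F u) * (inverse_phase F u * ?D a u))" for a
    using partial_mult[OF smooth_on_open_differentiable[OF smooth_inverse_phase u] smooth_on_open_differentiable[OF D u], of a a]
      derivative_inverse_phase[OF u, of "axis a 1"]
    by (simp add: partial_def[of a "inverse_phase F"] partial_def[of a F] mult_ac)
  then show ?thesis
    unfolding divergence_det_replace_column[OF smooth_F V u, symmetric]
    by (simp add: sum_subtractf sum_distrib_left)
qed

end

section \<open>The first variation of the volume\<close>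

text \<open>For a tangential \<open>W\<close>, the sum on the left, divided by the determinant, has the divergence of \<open>W\<close> as
  its real part and \<open>d\<beta>(W)\<close> as its imaginary part.  As \<open>W\<close> is the gradient of \<open>\<beta>\<close>, the equation says
  that the divergence is zero.\<close>

definition divergence_free ::
  "'e::euclidean_space set \<Rightarrow> ('e \<Rightarrow> complex^'N::finite) \<Rightarrow> ('e \<Rightarrow> complex^'N) \<Rightarrow> bool" where
  "divergence_free M \<Phi> W \<longleftrightarrow>
     (\<forall>(U :: (real^'N) set) \<phi>. local_param M U \<phi> \<longrightarrow> (\<forall>u\<in>U.
        (\<Sum>a\<in>UNIV. det (replace_column (jacobian_matrix (\<Phi> \<circ> \<phi>) u) a (partial a (W \<circ> \<phi>) u))) =
        \<i> * of_real (W (\<phi> u) \<bullet> W (\<phi> u)) * det (jacobian_matrix (\<Phi> \<circ> \<phi>) u)))"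

lemma partial_Re:
  assumes "f differentiable (at u)"
  shows "partial a (\<lambda>u. Re (f u)) u = Re (partial a f u)"
  unfolding partial_def by (rule frechet_derivative_linear_compose[OF bounded_linear_Re assms])

lemma partial_cong_open:
  assumes "open S" "u \<in> S" "f differentiable (at u)" "\<And>y. y \<in> S \<Longrightarrow> f y = g y"
  shows "partial a f u = partial a g u"
  unfolding partial_def using frechet_derivative_transform_within_open[OF assms(3,1,2,4)] by simp

context lagrangian_chart
begin

lemma differentiable_F: "u \<in> U \<Longrightarrow> F differentiable (at u)"
  by (rule smooth_on_open_differentiable[OF smooth_F])

lemma smooth_volume_density: "smooth_on_open (volume_density F) U"
  by (rule smooth_on_open_cong[OF smooth_cmod_det_F])
     (simp add: volume_density_lagrangian[OF lagrangian_F])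

lemma smooth_tangent_coordinates:
  assumes V: "smooth_on_open V U"
  shows "smooth_on_open (\<lambda>u. tangent_coordinates F u (V u)) U"
  unfolding tangent_coordinates_def frame_coordinates_def
  using smooth_F V smooth_on_open_openD[OF V] det_F_nonzero
  by (intro smooth_on_open_vec_lambda) (auto intro!: smooth_intros)

lemma inverse_phase_frame_coordinates:
  assumes "u \<in> U"
  shows "inverse_phase F u * det (replace_column (jacobian_matrix F u) a V) =
    of_real (volume_density F u) * frame_coordinates F u V $ a"
  by (simp add: inverse_phase_def frame_coordinates_def volume_density_lagrangian[OF lagrangian_F[OF assms]])

lemma angle_gradient_coordinates:
  assumes "u \<in> U"
  shows "frechet_derivative F (at u) (tangent_coordinates F u (W (\<phi> u))) = W (\<phi> u)"
    and "normal_coordinates F u (W (\<phi> u)) = 0"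
proof -
  obtain w where w: "W (\<phi> u) = frechet_derivative F (at u) w"
    using angle_gradientD(5)[OF G c assms] by blast
  have "W (\<phi> u) = frechet_derivative F (at u) w + J (frechet_derivative F (at u) 0)"
    using w linear_0[OF linear_frechet_derivative[OF differentiable_F[OF assms]]] by (simp add: J_def zero_vec_def)
  from coordinates_decomposition[OF lagrangian_F[OF assms] this]
  show "frechet_derivative F (at u) (tangent_coordinates F u (W (\<phi> u))) = W (\<phi> u)"
    "normal_coordinates F u (W (\<phi> u)) = 0"
    using w by simp_all
qed

text \<open>The real part of \<open>divergence_identity\<close>: with \<open>V = dF(x) + J dF(y)\<close>, the coordinates \<open>x\<close> give the
  divergence and \<open>y\<close> gives the product with \<open>W\<close>.\<close>

lemma first_variation_tangent_part:
  assumes V: "smooth_on_open V U" and u: "u \<in> U"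
  shows "Re (inverse_phase F u * (\<Sum>a\<in>UNIV. det (replace_column (jacobian_matrix F u) a (partial a V u)))) =
    (\<Sum>a\<in>UNIV. partial a (\<lambda>u. volume_density F u * tangent_coordinates F u (V u) $ a) u) -
    volume_density F u * (W (\<phi> u) \<bullet> frechet_derivative F (at u) (normal_coordinates F u (V u)))"
proof -
  let ?q = "\<lambda>a u. inverse_phase F u * det (replace_column (jacobian_matrix F u) a (V u))"
  have q: "smooth_on_open (?q a) U" for a
    using smooth_F V smooth_inverse_phase by (intro smooth_intros smooth_on_open_openD)
  have Re: "Re (partial a (?q a) u) = partial a (\<lambda>u. volume_density F u * tangent_coordinates F u (V u) $ a) u" for a
  proof -
    have "Re (partial a (?q a) u) = partial a (\<lambda>u. Re (?q a u)) u"
      by (rule partial_Re[symmetric]) (rule smooth_on_open_differentiable[OF q u])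
    also have "\<dots> = partial a (\<lambda>u. volume_density F u * tangent_coordinates F u (V u) $ a) u"
      by (rule partial_cong_open[OF local_paramD(2)[OF c] u smooth_on_open_differentiable[OF smooth_on_open_Re[OF q] u]])
         (simp add: inverse_phase_frame_coordinates tangent_coordinates_def)
    finally show ?thesis .
  qed
  have Im: "Re (\<i> * (\<Sum>a\<in>UNIV. of_real (W (\<phi> u) \<bullet> partial a F u) * ?q a u)) =
      - (volume_density F u * (W (\<phi> u) \<bullet> frechet_derivative F (at u) (normal_coordinates F u (V u))))"
  proof -
    have "frechet_derivative F (at u) (normal_coordinates F u (V u)) =
        (\<Sum>a\<in>UNIV. normal_coordinates F u (V u) $ a *\<^sub>R partial a F u)"
      unfolding partial_def by (rule linear_eq_sum_axis[OF linear_frechet_derivative[OF differentiable_F[OF u]]])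
    then show ?thesis
      by (simp add: inverse_phase_frame_coordinates[OF u] inner_sum_right sum_distrib_left sum_negf normal_coordinates_def mult_ac)
  qed
  show ?thesis
    unfolding divergence_identity[OF V u] plus_complex.sel Im by (simp add: Re)
qed

lemma divergence_angle_gradient:
  assumes D: "divergence_free M \<Phi> W" and u: "u \<in> U"
  shows "(\<Sum>a\<in>UNIV. partial a (\<lambda>u. volume_density F u * tangent_coordinates F u (W (\<phi> u)) $ a) u) = 0"
proof -
  have W: "smooth_on_open (W \<circ> \<phi>) U"
    unfolding o_def by (rule smooth_map_chart[OF angle_gradientD(2)[OF G] c])
  have "inverse_phase F u * (\<Sum>a\<in>UNIV. det (replace_column (jacobian_matrix F u) a (partial a (W \<circ> \<phi>) u))) =
      \<i> * of_real ((W (\<phi> u) \<bullet> W (\<phi> u)) * cmod (det (jacobian_matrix F u)))"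
    using D c u det_F_nonzero[OF u] unfolding divergence_free_def inverse_phase_def by simp
  then show ?thesis
    using first_variation_tangent_part[OF W u] angle_gradient_coordinates(2)[OF u]
      linear_0[OF linear_frechet_derivative[OF differentiable_F[OF u]]] by simp
qed

text \<open>For a Hamiltonian field the normal part contributes \<open>W f\<close>, which is a divergence because
  \<open>W\<close> is divergence free.\<close>

lemma hamiltonian_first_variation_is_divergence:
  assumes D: "divergence_free M \<Phi> W" and V: "smooth_on_open V U" and f: "smooth_map f M"
    and ham: "\<And>u w. u \<in> U \<Longrightarrow> symplectic_form (V u) (frechet_derivative F (at u) w) = frechet_derivative (f \<circ> \<phi>) (at u) w"
    and u: "u \<in> U"
  shows "Re (inverse_phase F u * (\<Sum>a\<in>UNIV. det (replace_column (jacobian_matrix F u) a (partial a V u)))) =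
    (\<Sum>a\<in>UNIV. partial a (\<lambda>u. volume_density F u *
      (tangent_coordinates F u (V u) + f (\<phi> u) *\<^sub>R tangent_coordinates F u (W (\<phi> u))) $ a) u)"
proof -
  let ?n = "volume_density F" and ?x = "\<lambda>u. tangent_coordinates F u (V u)"
    and ?w = "\<lambda>u. tangent_coordinates F u (W (\<phi> u))" and ?f = "\<lambda>u. f (\<phi> u)"
  have sf: "smooth_on_open ?f U" by (rule smooth_map_chart[OF f c])
  have sw: "smooth_on_open ?w U"
    by (rule smooth_tangent_coordinates[OF smooth_map_chart[OF angle_gradientD(2)[OF G] c]])
  have nx: "smooth_on_open (\<lambda>u. ?n u * ?x u $ a) U" and nw: "smooth_on_open (\<lambda>u. ?n u * ?w u $ a) U" for a
    by (intro smooth_intros smooth_volume_density smooth_tangent_coordinates V sw)+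
  have "W (\<phi> u) \<bullet> frechet_derivative F (at u) (normal_coordinates F u (V u)) =
      - symplectic_form (V u) (frechet_derivative F (at u) (?w u))"
    using symplectic_form_normal_coordinates[OF lagrangian_F[OF u], of "V u" "?w u"]
    unfolding angle_gradient_coordinates(1)[OF u] by (simp add: inner_commute)
  also have "\<dots> = - (\<Sum>a\<in>UNIV. ?w u $ a * partial a ?f u)"
    unfolding ham[OF u] partial_def comp_def[of f \<phi>]
    using linear_eq_sum_axis[OF linear_frechet_derivative[OF smooth_on_open_differentiable[OF sf u]], of "?w u"] by simp
  finally have 1: "?n u * (W (\<phi> u) \<bullet> frechet_derivative F (at u) (normal_coordinates F u (V u))) =
      - (\<Sum>a\<in>UNIV. partial a ?f u * (?n u * ?w u $ a))"
    by (simp add: sum_distrib_left mult_ac)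
  have 2: "partial a (\<lambda>u. ?n u * (?x u + ?f u *\<^sub>R ?w u) $ a) u =
      partial a (\<lambda>u. ?n u * ?x u $ a) u + (?f u * partial a (\<lambda>u. ?n u * ?w u $ a) u + partial a ?f u * (?n u * ?w u $ a))" for a
  proof -
    have "((\<lambda>u. ?n u * ?x u $ a + ?f u * (?n u * ?w u $ a)) has_derivative
        (\<lambda>v. frechet_derivative (\<lambda>u. ?n u * ?x u $ a) (at u) v + frechet_derivative (\<lambda>u. ?f u * (?n u * ?w u $ a)) (at u) v)) (at u)"
      by (intro has_derivative_add smooth_on_open_has_derivative[OF nx u]
          smooth_on_open_has_derivative[OF smooth_on_open_mult[OF sf nw] u])
    then have "partial a (\<lambda>u. ?n u * ?x u $ a + ?f u * (?n u * ?w u $ a)) u =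
        partial a (\<lambda>u. ?n u * ?x u $ a) u + partial a (\<lambda>u. ?f u * (?n u * ?w u $ a)) u"
      by (simp add: partial_def frechet_derivative_eqI)
    also have "partial a (\<lambda>u. ?f u * (?n u * ?w u $ a)) u =
        ?f u * partial a (\<lambda>u. ?n u * ?w u $ a) u + partial a ?f u * (?n u * ?w u $ a)"
      by (rule partial_mult[OF smooth_on_open_differentiable[OF sf u] smooth_on_open_differentiable[OF nw u]])
    finally have *: "partial a (\<lambda>u. ?n u * ?x u $ a + ?f u * (?n u * ?w u $ a)) u =
        partial a (\<lambda>u. ?n u * ?x u $ a) u + (?f u * partial a (\<lambda>u. ?n u * ?w u $ a) u + partial a ?f u * (?n u * ?w u $ a))" .
    have "?n u * (?x u + ?f u *\<^sub>R ?w u) $ a = ?n u * ?x u $ a + ?f u * (?n u * ?w u $ a)" for u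
      unfolding vector_add_component vector_scaleR_component real_scaleR_def by algebra
    with * show ?thesis by (simp only:)
  qed
  show ?thesis
    unfolding first_variation_tangent_part[OF V u] 1 2
    using divergence_angle_gradient[OF D u]
    by (simp add: sum.distrib sum_distrib_left[symmetric])
qed

end

subsection \<open>Smooth variations in a chart\<close>

lemma smooth_variation_chart:
  fixes \<Gamma> :: "real \<Rightarrow> 'e::euclidean_space \<Rightarrow> 'b::real_normed_vector" and \<phi> :: "real^'N::finite \<Rightarrow> 'e"
  assumes \<Gamma>: "smooth_map (\<lambda>(t, x). \<Gamma> t x) (I \<times> M)" and "open I" and c: "local_param M U \<phi>"
  shows "smooth_on_open (\<lambda>(t, u). \<Gamma> t (\<phi> u)) (I \<times> U)"
proof (rule smooth_on_open_local)
  let ?\<phi> = "\<lambda>z :: real \<times> (real^'N). (fst z, \<phi> (snd z))"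
  show op: "open (I \<times> U)" using \<open>open I\<close> local_paramD(2)[OF c] by (rule open_Times)
  have "smooth_on_open (\<lambda>z. \<phi> (snd z)) (I \<times> U)"
    by (rule smooth_on_open_compose[OF local_paramD(1)[OF c] smooth_on_open_snd[OF smooth_on_open_ident[OF op]]]) auto
  then have \<phi>: "smooth_on_open ?\<phi> (I \<times> U)"
    by (intro smooth_on_open_Pair smooth_on_open_fst smooth_on_open_ident op)
  fix z assume z: "z \<in> I \<times> U"
  then have "?\<phi> z \<in> I \<times> M" using local_paramD(5)[OF c] by auto
  then obtain V g where V: "?\<phi> z \<in> V" "smooth_on_open g V" "\<And>y. y \<in> V \<inter> I \<times> M \<Longrightarrow> g y = (\<lambda>(t, x). \<Gamma> t x) y"
    using \<Gamma> unfolding smooth_map_def by metis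
  have op': "open (I \<times> U \<inter> ?\<phi> -` V)"
    by (rule continuous_open_preimage[OF smooth_on_open_continuous_on[OF \<phi>] op smooth_on_open_openD[OF V(2)]])
  have "smooth_on_open (\<lambda>z. g (?\<phi> z)) (I \<times> U \<inter> ?\<phi> -` V)"
    by (rule smooth_on_open_compose[OF V(2) smooth_on_open_subset[OF \<phi> Int_lower1 op']]) auto
  then have "smooth_on_open (\<lambda>(t, u). \<Gamma> t (\<phi> u)) (I \<times> U \<inter> ?\<phi> -` V)"
  proof (rule smooth_on_open_cong)
    fix y assume y: "y \<in> I \<times> U \<inter> ?\<phi> -` V"
    then have "?\<phi> y \<in> V \<inter> I \<times> M" using local_paramD(5)[OF c] by auto
    from V(3)[OF this] show "g (?\<phi> y) = (\<lambda>(t, u). \<Gamma> t (\<phi> u)) y" by (simp add: split_beta)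
  qed
  moreover have "z \<in> I \<times> U \<inter> ?\<phi> -` V" using z V(1) by simp
  ultimately show "\<exists>T. z \<in> T \<and> smooth_on_open (\<lambda>(t, u). \<Gamma> t (\<phi> u)) T"
    by (intro exI[of _ "I \<times> U \<inter> ?\<phi> -` V"] conjI)
qed

text \<open>With both partial derivatives expressed by the total derivative, \<open>symmetric_second_derivative\<close> applies
  to mixed derivatives in space and time.\<close>

lemma frechet_derivative_slices:
  fixes g :: "real \<times> 'a::euclidean_space \<Rightarrow> 'b::real_normed_vector"
  assumes "smooth_on_open g S" "(t, u) \<in> S"
  shows "((\<lambda>u. g (t, u)) has_derivative (\<lambda>v. frechet_derivative g (at (t, u)) (0, v))) (at u)"
    and "((\<lambda>t. g (t, u)) has_vector_derivative frechet_derivative g (at (t, u)) (1, 0)) (at t)"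
proof -
  note g = smooth_on_open_has_derivative[OF assms]
  have 1: "((\<lambda>u. (t, u)) has_derivative (\<lambda>v. (0, v))) (at u)"
    by (auto intro!: derivative_eq_intros)
  show "((\<lambda>u. g (t, u)) has_derivative (\<lambda>v. frechet_derivative g (at (t, u)) (0, v))) (at u)"
    by (rule has_derivative_compose[OF 1 g])
  have 2: "((\<lambda>t. (t, u)) has_derivative (\<lambda>h. (h, 0))) (at t)"
    by (auto intro!: derivative_eq_intros)
  have lin: "linear (frechet_derivative g (at (t, u)))"
    by (rule linear_frechet_derivative[OF smooth_on_open_differentiable[OF assms]])
  have 3: "frechet_derivative g (at (t, u)) (h, 0) = h *\<^sub>R frechet_derivative g (at (t, u)) (1, 0)" for h
    using linear_scale[OF lin, of h "(1, 0)"] by simp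
  show "((\<lambda>t. g (t, u)) has_vector_derivative frechet_derivative g (at (t, u)) (1, 0)) (at t)"
    unfolding has_vector_derivative_def
    by (rule has_derivative_eq_rhs[OF has_derivative_compose[OF 2 g]]) (rule ext, rule 3)
qed

text \<open>The volume density is smooth only where the metric is positive definite.  This set is open and
  contains \<open>{0} \<times> U\<close>, so \<open>leibniz_rule_compact_support\<close> applies, and \<open>has_derivative_sqrt_det_gram\<close> gives
  the derivative of the integrand.\<close>

lemma has_derivative_volume_in_chart:
  fixes \<Gamma> :: "real \<Rightarrow> 'e::euclidean_space \<Rightarrow> complex^'N::finite" and U :: "(real^'N) set"
  assumes L: "lagrangian_immersion M \<Phi>" and c: "local_param M U \<phi>" and "\<epsilon> > 0"
    and \<Gamma>: "smooth_map (\<lambda>(t, x). \<Gamma> t x) ({-\<epsilon><..<\<epsilon>} \<times> M)" "\<And>x. x \<in> M \<Longrightarrow> \<Gamma> 0 x = \<Phi> x"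
    and \<rho>: "smooth_map \<rho> M" and C: "compact C" "C \<subseteq> \<phi> ` U" "\<And>x. x \<in> M - C \<Longrightarrow> \<rho> x = 0"
  defines "V \<equiv> \<lambda>u. vector_derivative (\<lambda>t. \<Gamma> t (\<phi> u)) (at 0)"
  shows "smooth_on_open V U"
    and "((\<lambda>t. integral U (\<lambda>u. \<rho> (\<phi> u) * volume_density (\<Gamma> t \<circ> \<phi>) u)) has_real_derivative
      integral U (\<lambda>u. \<rho> (\<phi> u) * Re (inverse_phase (\<Phi> \<circ> \<phi>) u *
        (\<Sum>a\<in>UNIV. det (replace_column (jacobian_matrix (\<Phi> \<circ> \<phi>) u) a (partial a V u)))))) (at 0)"
proof -
  define I where "I = {-\<epsilon><..<\<epsilon>}"
  have I: "open I" "0 \<in> I" using \<open>\<epsilon> > 0\<close> by (auto simp: I_def)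
  define g where "g = (\<lambda>(t, u). \<Gamma> t (\<phi> u))"
  have g: "smooth_on_open g (I \<times> U)"
    unfolding g_def by (rule smooth_variation_chart[OF \<Gamma>(1)[folded I_def] I(1) c])
  define g\<^sub>t where "g\<^sub>t z = frechet_derivative g (at z) (1, 0)" for z
  define g\<^sub>u where "g\<^sub>u j z = frechet_derivative g (at z) (0, axis j 1)" for j z
  have gt: "smooth_on_open g\<^sub>t (I \<times> U)" and gu: "smooth_on_open (g\<^sub>u j) (I \<times> U)" for j
    unfolding g\<^sub>t_def g\<^sub>u_def by (rule smooth_on_open_derivative[OF g])+
  have opU: "open U" by (rule local_paramD(2)[OF c])
  have F0: "\<Gamma> 0 (\<phi> u) = (\<Phi> \<circ> \<phi>) u" if "u \<in> U" for u
    using \<Gamma>(2) local_paramD(5)[OF c] that by auto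
  have V: "V u = g\<^sub>t (0, u)" if "u \<in> U" for u
    using frechet_derivative_slices(2)[OF g, of 0 u] that I(2)
    unfolding V_def g\<^sub>t_def by (intro vector_derivative_at) (simp add: g_def)
  have "smooth_on_open (\<lambda>u. (0 :: real, u)) U"
    by (intro smooth_on_open_Pair smooth_on_open_const smooth_on_open_ident opU)
  then have "smooth_on_open (\<lambda>u. g\<^sub>t (0, u)) U"
    by (rule smooth_on_open_compose[OF gt]) (use I in auto)
  then show V_smooth: "smooth_on_open V U"
    by (rule smooth_on_open_cong) (simp add: V)
  have partial_g: "partial j (\<Gamma> t \<circ> \<phi>) u = g\<^sub>u j (t, u)" if "t \<in> I" "u \<in> U" for j t u
  proof -
    have "((\<Gamma> t \<circ> \<phi>) has_derivative (\<lambda>v. frechet_derivative g (at (t, u)) (0, v))) (at u)"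
      using frechet_derivative_slices(1)[OF g, of t u] that by (simp add: g_def o_def)
    then show ?thesis by (simp add: partial_def g\<^sub>u_def frechet_derivative_eqI)
  qed
  have jac0: "g\<^sub>u j (0, u) $ i = jacobian_matrix (\<Phi> \<circ> \<phi>) u $ i $ j" if "u \<in> U" for i j u
  proof -
    have "((\<lambda>u. \<Gamma> 0 (\<phi> u)) has_derivative (\<lambda>v. frechet_derivative g (at (0, u)) (0, v))) (at u)"
      using frechet_derivative_slices(1)[OF g, of 0 u] that I(2) by (simp add: g_def)
    then have "((\<Phi> \<circ> \<phi>) has_derivative (\<lambda>v. frechet_derivative g (at (0, u)) (0, v))) (at u)"
      by (rule has_derivative_transform_within_open[OF _ opU that]) (rule F0)
    then show ?thesis by (simp add: jacobian_matrix_def partial_def g\<^sub>u_def frechet_derivative_eqI)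
  qed
  define D where "D z = det (\<chi> i j. \<Sum>k\<in>UNIV. g\<^sub>u i z $ k \<bullet> g\<^sub>u j z $ k)" for z
  have D: "smooth_on_open D (I \<times> U)"
    unfolding D_def using gu smooth_on_open_openD[OF g] by (intro smooth_intros) auto
  have dens: "volume_density (\<Gamma> t \<circ> \<phi>) u = sqrt (D (t, u))" if "t \<in> I" "u \<in> U" for t u
    using that by (simp add: volume_density_def D_def induced_metric_def partial_g inner_vec_def)
  have D0: "D (0, u) = (cmod (det (jacobian_matrix (\<Phi> \<circ> \<phi>) u)))\<^sup>2" if "u \<in> U" for u
    unfolding det_induced_metric_lagrangian[OF lagrangian_immersionD(3)[OF L c that], symmetric]
    by (simp add: D_def induced_metric_eq_gram jac0[OF that])
  define S where "S = (I \<times> U) \<inter> D -` {0<..}"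
  have S: "open S" "S \<subseteq> I \<times> U"
    unfolding S_def
    by (rule continuous_open_preimage[OF smooth_on_open_continuous_on[OF D] smooth_on_open_openD[OF D] open_greaterThan]) auto
  have S0: "(0, u) \<in> S" if "u \<in> U" for u
    using that I(2) det_jacobian_matrix_nonzero[OF lagrangian_immersionD(3)[OF L c that]]
    by (simp add: S_def D0)
  define r where "r u = \<rho> (\<phi> u)" for u
  have r: "smooth_on_open r U" unfolding r_def by (rule smooth_map_chart[OF \<rho> c])
  define q where "q t u = r u * volume_density (\<Gamma> t \<circ> \<phi>) u" for t u
  have q: "smooth_on_open (\<lambda>(t, u). q t u) S"
  proof (rule smooth_on_open_cong)
    have "smooth_on_open (\<lambda>z. r (snd z)) (I \<times> U)"
      by (rule smooth_on_open_compose[OF r smooth_on_open_snd[OF smooth_on_open_ident[OF smooth_on_open_openD[OF D]]]]) auto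
    then show "smooth_on_open (\<lambda>z. r (snd z) * sqrt (D z)) S"
      using S smooth_on_open_subset[OF _ S(2,1)] D
      by (intro smooth_on_open_mult smooth_on_open_sqrt) (auto simp: S_def)
    show "r (snd z) * sqrt (D z) = (\<lambda>(t, u). q t u) z" if "z \<in> S" for z
      using that S(2) dens by (auto simp: q_def)
  qed
  obtain Z where Z: "compact Z" "Z \<subseteq> U" "\<And>u. u \<in> U - Z \<Longrightarrow> \<phi> u \<in> M - C"
    using chart_compact_support[OF c C(1,2)] by metis
  have r0: "r u = 0" if "u \<in> U - Z" for u
    unfolding r_def using C(3) Z(3)[OF that] .
  let ?d = "\<lambda>u. Re (inverse_phase (\<Phi> \<circ> \<phi>) u *
        (\<Sum>a\<in>UNIV. det (replace_column (jacobian_matrix (\<Phi> \<circ> \<phi>) u) a (partial a V u))))"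
  have der: "(if u \<in> Z then frechet_derivative (\<lambda>(t, u). q t u) (at (0, u)) (1, 0) else 0) = \<rho> (\<phi> u) * ?d u"
    if u: "u \<in> U" for u
  proof (cases "u \<in> Z")
    case False
    then show ?thesis using r0[of u] u by (simp add: r_def)
  next
    case True
    define A where "A t = (\<chi> i j. g\<^sub>u j (t, u) $ i)" for t
    define A' where "A' = (\<chi> i j. partial j V u $ i)"
    have A0: "A 0 = jacobian_matrix (\<Phi> \<circ> \<phi>) u"
      by (simp add: A_def vec_eq_iff jac0[OF u])
    have u0: "(0, u) \<in> I \<times> U" using u I by simp
    have pV: "partial j V u = frechet_derivative (g\<^sub>u j) (at (0, u)) (1, 0)" for j
    proof -
      have "((\<lambda>u. g\<^sub>t (0, u)) has_derivative (\<lambda>v. frechet_derivative g\<^sub>t (at (0, u)) (0, v))) (at u)"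
        by (rule frechet_derivative_slices(1)[OF gt u0])
      then have "(V has_derivative (\<lambda>v. frechet_derivative g\<^sub>t (at (0, u)) (0, v))) (at u)"
        by (rule has_derivative_transform_within_open[OF _ opU u]) (simp add: V)
      then have "partial j V u = frechet_derivative g\<^sub>t (at (0, u)) (0, axis j 1)"
        by (simp add: partial_def frechet_derivative_eqI)
      also have "\<dots> = frechet_derivative (g\<^sub>u j) (at (0, u)) (1, 0)"
        unfolding g\<^sub>t_def g\<^sub>u_def by (rule symmetric_second_derivative[OF g u0])
      finally show ?thesis .
    qed
    have gram: "((\<lambda>t. sqrt (det (\<chi> i j. \<Sum>k\<in>UNIV. A t $ k $ i \<bullet> A t $ k $ j))) has_real_derivative
      Re (cnj (det (A 0)) * (\<Sum>a\<in>UNIV. det (replace_column (A 0) a (column a A')))) / cmod (det (A 0))) (at 0)"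
    proof (rule has_derivative_sqrt_det_gram[OF _ _ _ refl])
      show "((\<lambda>t. A t $ i $ j) has_vector_derivative A' $ i $ j) (at 0)" for i j
        using bounded_linear.has_vector_derivative[OF bounded_linear_vec_nth frechet_derivative_slices(2)[OF gu u0]]
        by (simp add: A_def A'_def pV)
      show "Im (\<Sum>k\<in>UNIV. cnj (A 0 $ k $ i) * A 0 $ k $ j) = 0" for i j
        unfolding A0 by (rule lagrangian_at_gram[OF lagrangian_immersionD(3)[OF L c u]])
      show "det (A 0) \<noteq> 0"
        unfolding A0 by (rule det_jacobian_matrix_nonzero[OF lagrangian_immersionD(3)[OF L c u]])
    qed
    have col: "column a A' = partial a V u" for a
      by (simp add: A'_def column_def vec_eq_iff)
    have phase: "Re (cnj (det (A 0)) * z) / cmod (det (A 0)) = Re (inverse_phase (\<Phi> \<circ> \<phi>) u * z)" for z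
    proof -
      let ?e = "det (jacobian_matrix (\<Phi> \<circ> \<phi>) u)"
      have "?e \<noteq> 0" by (rule det_jacobian_matrix_nonzero[OF lagrangian_immersionD(3)[OF L c u]])
      then have "inverse_phase (\<Phi> \<circ> \<phi>) u = cnj ?e / of_real (cmod ?e)"
        by (simp add: inverse_phase_def frac_eq_eq power2_eq_square[symmetric]) (simp only: of_real_power[symmetric] complex_norm_square mult.commute[of "cnj _"])
      then show ?thesis unfolding A0 by simp
    qed
    have "A t $ k $ i = g\<^sub>u i (t, u) $ k" for t k i by (simp add: A_def)
    with gram[unfolded col phase, unfolded A0]
    have "((\<lambda>t. sqrt (D (t, u))) has_real_derivative ?d u) (at 0)"
      by (simp only: D_def)
    then have 1: "((\<lambda>t. r u * sqrt (D (t, u))) has_real_derivative r u * ?d u) (at 0)"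
      by (rule DERIV_cmult)
    have 2: "((\<lambda>t. q t u) has_real_derivative r u * ?d u) (at 0)"
      by (rule has_field_derivative_transform_within_open[OF 1 I]) (simp add: q_def dens u)
    have "((\<lambda>t. q t u) has_real_derivative frechet_derivative (\<lambda>(t, u). q t u) (at (0, u)) (1, 0)) (at 0)"
      using frechet_derivative_slices(2)[OF q S0[OF u]] by (simp add: has_real_derivative_iff_has_vector_derivative)
    from DERIV_unique[OF this 2] show ?thesis using True by (simp add: r_def)
  qed
  have "((\<lambda>t. integral U (q t)) has_real_derivative
      integral U (\<lambda>u. if u \<in> Z then frechet_derivative (\<lambda>(t, u). q t u) (at (0, u)) (1, 0) else 0)) (at 0)"
    using Z S0 r0 by (intro leibniz_rule_compact_support[OF q opU]) (auto simp: q_def)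
  moreover have "integral U (\<lambda>u. if u \<in> Z then frechet_derivative (\<lambda>(t, u). q t u) (at (0, u)) (1, 0) else 0) =
      integral U (\<lambda>u. \<rho> (\<phi> u) * ?d u)"
    by (rule integral_cong) (rule der)
  ultimately show "((\<lambda>t. integral U (\<lambda>u. \<rho> (\<phi> u) * volume_density (\<Gamma> t \<circ> \<phi>) u)) has_real_derivative
      integral U (\<lambda>u. \<rho> (\<phi> u) * ?d u)) (at 0)"
    by (simp add: q_def[abs_def] r_def)
qed


section \<open>A criterion for Hamiltonian minimality\<close>

text \<open>In every chart the integrand of the first variation is the divergence of the same vector field on
  \<open>M\<close>, namely the tangential part of the variation field plus \<open>f W\<close>.\<close>

theorem H_minimal_if_angle_gradient_divergence_free:
  fixes M :: "'e::euclidean_space set" and \<Phi> :: "'e \<Rightarrow> complex^'N::finite"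
  assumes L: "lagrangian_immersion M \<Phi>" and G: "angle_gradient M \<Phi> E W" and D: "divergence_free M \<Phi> W"
  shows "H_minimal M \<Phi>"
  unfolding H_minimal_def
proof (intro conjI L allI impI)
  fix \<epsilon> \<Gamma> K and U :: "nat \<Rightarrow> (real^'N) set" and \<phi> \<rho>
  assume \<Gamma>: "hamiltonian_variation M \<Phi> \<epsilon> \<Gamma>" and P: "partition_of_unity M K U \<phi> \<rho>"
  note chart = partition_of_unityD(1)[OF P]
  have \<Gamma>': "\<epsilon> > 0" "smooth_map (\<lambda>(t, x). \<Gamma> t x) ({-\<epsilon><..<\<epsilon>} \<times> M)" "\<And>x. x \<in> M \<Longrightarrow> \<Gamma> 0 x = \<Phi> x"
    using \<Gamma> unfolding hamiltonian_variation_def by blast+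
  define v where "v x = vector_derivative (\<lambda>t. \<Gamma> t x) (at 0)" for x
  have "\<exists>f :: 'e \<Rightarrow> real. smooth_map f M \<and> (\<forall>(U :: (real^'N) set) \<phi>. local_param M U \<phi> \<longrightarrow> (\<forall>u\<in>U. \<forall>w.
      symplectic_form (v (\<phi> u)) (frechet_derivative (\<Phi> \<circ> \<phi>) (at u) w) = frechet_derivative (f \<circ> \<phi>) (at u) w))"
    using \<Gamma> unfolding hamiltonian_variation_def v_def by blast
  then obtain f :: "'e \<Rightarrow> real" where f: "smooth_map f M" "\<forall>(U :: (real^'N) set) \<phi>. local_param M U \<phi> \<longrightarrow> (\<forall>u\<in>U. \<forall>w.
      symplectic_form (v (\<phi> u)) (frechet_derivative (\<Phi> \<circ> \<phi>) (at u) w) = frechet_derivative (f \<circ> \<phi>) (at u) w)"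
    by blast
  define n where "n i = volume_density (\<Phi> \<circ> \<phi> i)" for i
  define Y where "Y i u = tangent_coordinates (\<Phi> \<circ> \<phi> i) u (v (\<phi> i u)) +
      f (\<phi> i u) *\<^sub>R tangent_coordinates (\<Phi> \<circ> \<phi> i) u (W (\<phi> i u))" for i u
  let ?d = "\<lambda>i u. \<Sum>a\<in>UNIV. partial a (\<lambda>u. n i u * Y i u $ a) u"
  have LC: "lagrangian_chart M \<Phi> E W (U i) (\<phi> i)" if "i < K" for i
    by (rule lagrangian_chart.intro[OF L G chart[OF that]])
  have var: "((\<lambda>t. integral (U i) (\<lambda>u. \<rho> i (\<phi> i u) * volume_density (\<Gamma> t \<circ> \<phi> i) u)) has_real_derivative
      integral (U i) (\<lambda>u. \<rho> i (\<phi> i u) * ?d i u)) (at 0)"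
    and V: "smooth_on_open (\<lambda>u. v (\<phi> i u)) (U i)" if i: "i < K" for i
  proof -
    interpret lagrangian_chart M \<Phi> E W "U i" "\<phi> i" by (rule LC[OF i])
    obtain C where CC: "compact C \<and> C \<subseteq> \<phi> i ` U i \<and> (\<forall>x\<in>M - C. \<rho> i x = 0)"
      using partition_of_unityD(4)[OF P i] by (elim exE)
    then have C: "compact C" "C \<subseteq> \<phi> i ` U i" "\<And>x. x \<in> M - C \<Longrightarrow> \<rho> i x = 0"
      by simp_all
    note hv = has_derivative_volume_in_chart[OF L chart[OF i] \<Gamma>' partition_of_unityD(2)[OF P i] C, folded v_def]
    show V: "smooth_on_open (\<lambda>u. v (\<phi> i u)) (U i)" by (rule hv(1))
    have "integral (U i) (\<lambda>u. \<rho> i (\<phi> i u) * Re (inverse_phase (\<Phi> \<circ> \<phi> i) u *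
        (\<Sum>a\<in>UNIV. det (replace_column (jacobian_matrix (\<Phi> \<circ> \<phi> i) u) a (partial a (\<lambda>u. v (\<phi> i u)) u))))) =
        integral (U i) (\<lambda>u. \<rho> i (\<phi> i u) * ?d i u)"
    proof (rule integral_cong)
      fix u assume "u \<in> U i"
      have "Re (inverse_phase (\<Phi> \<circ> \<phi> i) u *
        (\<Sum>a\<in>UNIV. det (replace_column (jacobian_matrix (\<Phi> \<circ> \<phi> i) u) a (partial a (\<lambda>u. v (\<phi> i u)) u)))) = ?d i u"
        unfolding n_def Y_def
        using f(2) chart[OF i] by (intro hamiltonian_first_variation_is_divergence[OF D V f(1) _ \<open>u \<in> U i\<close>]) blast
      then show "\<rho> i (\<phi> i u) * Re (inverse_phase (\<Phi> \<circ> \<phi> i) u *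
        (\<Sum>a\<in>UNIV. det (replace_column (jacobian_matrix (\<Phi> \<circ> \<phi> i) u) a (partial a (\<lambda>u. v (\<phi> i u)) u)))) =
        \<rho> i (\<phi> i u) * ?d i u" by simp
    qed
    with hv(2) show "((\<lambda>t. integral (U i) (\<lambda>u. \<rho> i (\<phi> i u) * volume_density (\<Gamma> t \<circ> \<phi> i) u)) has_real_derivative
      integral (U i) (\<lambda>u. \<rho> i (\<phi> i u) * ?d i u)) (at 0)" by simp
  qed
  have "(\<Sum>i<K. integral (U i) (\<lambda>u. \<rho> i (\<phi> i u) * ?d i u)) = 0"
  proof (rule divergence_theorem_partition_of_unity[OF P])
    fix i assume i: "i < K"
    interpret lagrangian_chart M \<Phi> E W "U i" "\<phi> i" by (rule LC[OF i])
    show "smooth_on_open (n i) (U i)" unfolding n_def by (rule smooth_volume_density)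
    show "smooth_on_open (Y i) (U i)"
      unfolding Y_def
      by (intro smooth_on_open_add smooth_on_open_scaleR smooth_tangent_coordinates V[OF i]
          smooth_map_chart[OF f(1) chart[OF i]] smooth_map_chart[OF angle_gradientD(2)[OF G] chart[OF i]])
  next
    fix i j u u' and T :: "real^'N \<Rightarrow> real^'N"
    assume ij: "i < K" "j < K" and u: "u \<in> U i" "u' \<in> U j" "\<phi> i u = \<phi> j u'" and "linear T"
      and T: "\<And>v. frechet_derivative (\<phi> i) (at u) v = frechet_derivative (\<phi> j) (at u') (T v)"
    let ?F = "\<lambda>i. \<Phi> \<circ> \<phi> i"
    have la: "lagrangian_at (?F i) u" "lagrangian_at (?F j) u'"
      using lagrangian_immersionD(3)[OF L] chart ij u by blast+
    have FT: "frechet_derivative (?F i) (at u) v = frechet_derivative (?F j) (at u') (T v)" for v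
      unfolding o_def
      by (rule frechet_derivative_change_of_charts[OF lagrangian_immersionD(1)[OF L] chart[OF ij(1)] chart[OF ij(2)] u T])
    have coord: "tangent_coordinates (?F j) u' X = T (tangent_coordinates (?F i) u X)" for X
    proof (rule coordinates_decomposition(1)[OF la(2)])
      show "X = frechet_derivative (?F j) (at u') (T (tangent_coordinates (?F i) u X)) +
          J (frechet_derivative (?F j) (at u') (T (normal_coordinates (?F i) u X)))"
        using lagrangian_decomposition[OF la(1), of X] unfolding FT .
    qed
    have "jacobian_matrix (?F i) u = jacobian_matrix (?F j) u' ** (\<chi> a b. complex_of_real (matrix T $ a $ b))"
    proof -
      have "frechet_derivative (?F i) (at u) (axis b 1) $ a =
          (\<Sum>c\<in>UNIV. jacobian_matrix (?F j) u' $ a $ c * complex_of_real (T (axis b 1) $ c))" for a b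
        unfolding FT using la(2)
        by (simp add: frechet_derivative_eq_jacobian_matrix lagrangian_at_def matrix_vector_mult_def)
      then show ?thesis
        by (simp add: vec_eq_iff jacobian_matrix_def[of "?F i"] partial_def[of _ "?F i"] matrix_matrix_mult_def matrix_def)
    qed
    then have "n i u = \<bar>det (matrix T)\<bar> * n j u'"
      by (simp add: n_def volume_density_lagrangian[OF la(1)] volume_density_lagrangian[OF la(2)]
          det_mul det_of_real norm_mult)
    moreover have "Y j u' = T (Y i u)"
      unfolding Y_def coord
      by (simp add: linear_add[OF \<open>linear T\<close>] linear_scale[OF \<open>linear T\<close>] u(3))
    ultimately show "n i u = \<bar>det (matrix T)\<bar> * n j u' \<and> Y j u' = T (Y i u)" ..
  qed
  moreover have "((\<lambda>t. \<Sum>i<K. integral (U i) (\<lambda>u. \<rho> i (\<phi> i u) * volume_density (\<Gamma> t \<circ> \<phi> i) u)) has_real_derivative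
      (\<Sum>i<K. integral (U i) (\<lambda>u. \<rho> i (\<phi> i u) * ?d i u))) (at 0)"
    by (rule DERIV_sum) (use var in simp)
  ultimately show "((\<lambda>t. volume K U \<phi> \<rho> (\<Gamma> t)) has_real_derivative 0) (at 0)"
    unfolding volume_def by simp
qed

section \<open>The mean curvature of a Lagrangian immersion\<close>

lemma inverse_metric_mult:
  fixes F :: "real^'N::finite \<Rightarrow> 'v::real_inner"
  assumes "F differentiable (at u)" "inj (frechet_derivative F (at u))"
  shows "inverse_metric F u ** induced_metric F u = mat 1"
  unfolding inverse_metric_def
  using det_induced_metric_nonzero[OF assms]
  unfolding invertible_det_nz[symmetric] invertible_def matrix_inv_def by (rule someI2_ex) simp

lemma sum_inverse_metric:
  fixes F :: "real^'N::finite \<Rightarrow> 'v::real_inner"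
  assumes "F differentiable (at u)" "inj (frechet_derivative F (at u))"
  shows "(\<Sum>j\<in>UNIV. inverse_metric F u $ i $ j * (frechet_derivative F (at u) x \<bullet> partial j F u)) = x $ i"
proof -
  have "frechet_derivative F (at u) x \<bullet> partial j F u = (induced_metric F u *v x) $ j" for j
  proof -
    have "frechet_derivative F (at u) x = (\<Sum>i\<in>UNIV. x $ i *\<^sub>R partial i F u)"
      unfolding partial_def by (rule linear_eq_sum_axis[OF linear_frechet_derivative[OF assms(1)]])
    then show ?thesis
      by (simp add: induced_metric_def matrix_vector_mult_def inner_sum_left inner_sum_right inner_commute[of _ "partial j F u"] mult.commute)
  qed
  then have "(\<Sum>j\<in>UNIV. inverse_metric F u $ i $ j * (frechet_derivative F (at u) x \<bullet> partial j F u)) =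
      (inverse_metric F u *v (induced_metric F u *v x)) $ i"
    by (simp add: matrix_vector_mult_def)
  also have "\<dots> = x $ i"
    by (simp add: matrix_vector_mul_assoc inverse_metric_mult[OF assms])
  finally show ?thesis .
qed

text \<open>The vectors \<open>J dF(y)\<close> are normal by isotropy, and the inverse metric recovers \<open>x\<close> from the products of
  \<open>dF(x)\<close> with the frame.\<close>

lemma normal_part_lagrangian:
  fixes F :: "real^'N::finite \<Rightarrow> complex^'N"
  assumes "lagrangian_at F u"
  shows "normal_part F u V = J (frechet_derivative F (at u) (normal_coordinates F u V))"
proof -
  let ?x = "tangent_coordinates F u V" and ?y = "normal_coordinates F u V" and ?D = "frechet_derivative F (at u)"
  have d: "F differentiable (at u)" "inj ?D" using assms by (simp_all add: lagrangian_at_def)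
  have V: "V = ?D ?x + J (?D ?y)" by (rule lagrangian_decomposition[OF assms])
  have "V \<bullet> partial j F u = ?D ?x \<bullet> partial j F u" for j
  proof -
    have "J (?D ?y) \<bullet> partial j F u = 0"
      using assms unfolding lagrangian_at_def symplectic_form_def partial_def by blast
    then show ?thesis by (subst V) (simp add: inner_add_left)
  qed
  then have "(\<Sum>i\<in>UNIV. \<Sum>j\<in>UNIV. (inverse_metric F u $ i $ j * (V \<bullet> partial j F u)) *\<^sub>R partial i F u) =
      (\<Sum>i\<in>UNIV. ?x $ i *\<^sub>R partial i F u)"
    by (simp add: scaleR_sum_left[symmetric] sum_inverse_metric[OF d])
  also have "\<dots> = ?D ?x"
    unfolding partial_def by (rule linear_eq_sum_axis[OF linear_frechet_derivative[OF d(1)], symmetric])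
  finally have "normal_part F u V = V - ?D ?x" by (simp add: normal_part_def)
  then show ?thesis using V by (metis add_diff_cancel_left')
qed

lemma J_linear: "linear J"
  by (intro linearI) (simp_all add: J_def vec_eq_iff distrib_left)

lemma bounded_linear_J: "bounded_linear J"
  using J_linear linear_conv_bounded_linear by blast

lemma symplectic_form_antisym: "symplectic_form v w = - symplectic_form w v"
  by (simp add: symplectic_form_def J_def inner_vec_def inner_complex_def sum_negf[symmetric] algebra_simps)

lemma bounded_bilinear_symplectic_form: "bounded_bilinear symplectic_form"
  unfolding symplectic_form_def[abs_def]
  by (rule bounded_bilinear.comp1[OF bounded_bilinear_inner bounded_linear_J])

lemma partial_Im:
  assumes "f differentiable (at u)"
  shows "partial a (\<lambda>u. Im (f u)) u = Im (partial a f u)"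
  unfolding partial_def by (rule frechet_derivative_linear_compose[OF bounded_linear_Im assms])

context lagrangian_chart
begin

text \<open>The derivative of \<open>\<omega>(\<partial>\<^sub>bF, \<partial>\<^sub>cF) = 0\<close> in the direction \<open>a\<close>.  Together with the symmetry in \<open>a\<close>
  and \<open>b\<close> it makes \<open>\<omega>(\<partial>\<^sub>a\<partial>\<^sub>bF, \<partial>\<^sub>cF)\<close> totally symmetric.\<close>

lemma cubic_form_symmetric:
  assumes u: "u \<in> U"
  shows "symplectic_form (partial a (partial b F) u) (partial c F u) = symplectic_form (partial a (partial c F) u) (partial b F u)"
proof -
  let ?d = "frechet_derivative"
  have "((\<lambda>u. symplectic_form (partial b F u) (partial c F u)) has_derivative
      (\<lambda>v. symplectic_form (partial b F u) (?d (partial c F) (at u) v) + symplectic_form (?d (partial b F) (at u) v) (partial c F u))) (at u)"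
    by (intro bounded_bilinear.FDERIV[OF bounded_bilinear_symplectic_form]
        smooth_on_open_has_derivative[OF smooth_on_open_partial[OF smooth_F] u])
  moreover have "((\<lambda>u. symplectic_form (partial b F u) (partial c F u)) has_derivative (\<lambda>v. 0)) (at u)"
  proof (rule has_derivative_transform_within_open[OF has_derivative_const local_paramD(2)[OF c] u])
    show "0 = symplectic_form (partial b F u) (partial c F u)" if "u \<in> U" for u
      using lagrangian_F[OF that] by (simp add: lagrangian_at_def partial_def)
  qed
  ultimately have "(\<lambda>v. symplectic_form (partial b F u) (?d (partial c F) (at u) v) + symplectic_form (?d (partial b F) (at u) v) (partial c F u)) = (\<lambda>v. 0)"
    by (rule has_derivative_unique)
  from fun_cong[OF this, of "axis a 1"]
  have "symplectic_form (partial b F u) (partial a (partial c F) u) + symplectic_form (partial a (partial b F) u) (partial c F u) = 0"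
    unfolding partial_def[of a] .
  then show ?thesis
    using symplectic_form_antisym[of "partial b F u" "partial a (partial c F) u"] by linarith
qed

text \<open>The imaginary part of \<open>divergence_identity\<close> for \<open>V = \<partial>\<^sub>kF\<close>.  The divergence on its right side is that of
  \<open>\<partial>\<^sub>k\<close>, a real field, and does not contribute.\<close>

lemma inner_angle_gradient_partial:
  assumes u: "u \<in> U"
  shows "W (\<phi> u) \<bullet> partial k F u = (\<Sum>a\<in>UNIV. normal_coordinates F u (partial a (partial k F) u) $ a)"
proof -
  let ?n = "volume_density F u"
  have V: "smooth_on_open (partial k F) U" by (rule smooth_on_open_partial[OF smooth_F])
  have fc: "frame_coordinates F w (partial k F w) $ a = (if a = k then 1 else 0)" if "w \<in> U" for w a
  proof -
    have "linear (frechet_derivative F (at w))"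
      by (rule linear_frechet_derivative[OF differentiable_F[OF that]])
    then have "partial k F w = frechet_derivative F (at w) (axis k 1) + J (frechet_derivative F (at w) 0)"
      by (simp add: partial_def linear_0 linear_0[OF J_linear])
    from frame_coordinates_decomposition[OF lagrangian_F[OF that] this] show ?thesis
      by (simp add: axis_def)
  qed
  have fc': "inverse_phase F w * det (replace_column (jacobian_matrix F w) a (partial k F w)) =
      of_real (volume_density F w * (if a = k then 1 else 0))" if "w \<in> U" for w a
    using fc[OF that] by (simp add: inverse_phase_frame_coordinates[OF that])
  have "Im (partial a (\<lambda>w. inverse_phase F w * det (replace_column (jacobian_matrix F w) a (partial k F w))) u) = 0" for a
  proof -
    let ?q = "\<lambda>w. inverse_phase F w * det (replace_column (jacobian_matrix F w) a (partial k F w))"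
    have q: "smooth_on_open ?q U"
      using smooth_F V smooth_inverse_phase by (intro smooth_intros smooth_on_open_openD)
    have "Im (partial a ?q u) = partial a (\<lambda>w. Im (?q w)) u"
      by (rule partial_Im[OF smooth_on_open_differentiable[OF q u], symmetric])
    also have "frechet_derivative (\<lambda>w. Im (?q w)) (at u) = (\<lambda>v. 0)"
      by (rule frechet_derivative_zero_on_open[OF local_paramD(2)[OF c] u]) (simp only: fc' Im_complex_of_real)
    then have "partial a (\<lambda>w. Im (?q w)) u = 0" by (simp add: partial_def)
    finally show ?thesis .
  qed
  then have "Im (inverse_phase F u * (\<Sum>a\<in>UNIV. det (replace_column (jacobian_matrix F u) a (partial a (partial k F) u)))) =
      Im (\<i> * (\<Sum>a\<in>UNIV. of_real (W (\<phi> u) \<bullet> partial a F u) * of_real (?n * (if a = k then 1 else 0))))"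
    unfolding divergence_identity[OF V u] fc'[OF u] by simp
  also have "\<dots> = ?n * (W (\<phi> u) \<bullet> partial k F u)"
    by (simp add: if_distrib if_distribR cong: if_cong)
  also have "inverse_phase F u * (\<Sum>a\<in>UNIV. det (replace_column (jacobian_matrix F u) a (partial a (partial k F) u))) =
      of_real ?n * (\<Sum>a\<in>UNIV. frame_coordinates F u (partial a (partial k F) u) $ a)"
    by (simp add: sum_distrib_left inverse_phase_frame_coordinates[OF u])
  finally have eq: "Im (of_real ?n * (\<Sum>a\<in>UNIV. frame_coordinates F u (partial a (partial k F) u) $ a)) =
      ?n * (W (\<phi> u) \<bullet> partial k F u)" .
  have "Im (of_real x * (\<Sum>a\<in>UNIV. z a)) = x * (\<Sum>a\<in>UNIV. Im (z a))" for x and z :: "'N \<Rightarrow> complex"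
    by simp
  with eq have "?n * (\<Sum>a\<in>UNIV. normal_coordinates F u (partial a (partial k F) u) $ a) = ?n * (W (\<phi> u) \<bullet> partial k F u)"
    by (simp only: normal_coordinates_def vec_lambda_beta)
  moreover have "?n \<noteq> 0"
    using det_F_nonzero[OF u] by (simp add: volume_density_lagrangian[OF lagrangian_F[OF u]])
  ultimately show ?thesis by simp
qed

lemma tangent_eqI:
  assumes u: "u \<in> U" and "\<And>a. frechet_derivative F (at u) x \<bullet> partial a F u = frechet_derivative F (at u) y \<bullet> partial a F u"
  shows "frechet_derivative F (at u) x = frechet_derivative F (at u) y"
proof -
  have "x $ i = y $ i" for i
    using sum_inverse_metric[OF differentiable_F[OF u], of i x] sum_inverse_metric[OF differentiable_F[OF u], of i y]
      lagrangian_F[OF u] assms(2) by (simp add: lagrangian_at_def)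
  then have "x = y" by (simp add: vec_eq_iff)
  then show ?thesis by simp
qed

text \<open>In the trace of the second fundamental form, the symmetry of the cubic form moves the
  contraction with the inverse metric to the pair of indices of \<open>inner_angle_gradient_partial\<close>.\<close>

lemma mean_curvature_eq:
  assumes u: "u \<in> U"
  shows "mean_curvature F u = (1 / real CARD('N)) *\<^sub>R J (W (\<phi> u))"
proof -
  let ?g = "inverse_metric F u" and ?D = "frechet_derivative F (at u)"
  let ?S = "\<lambda>a b c. symplectic_form (partial a (partial b F) u) (partial c F u)"
  have d: "F differentiable (at u)" "inj ?D" and la: "lagrangian_at F u"
    using lagrangian_F[OF u] by (simp_all add: lagrangian_at_def)
  have lin: "linear ?D" by (rule linear_frechet_derivative[OF d(1)])
  \<comment> \<open>Up to the factor \<open>1/N\<close>, the mean curvature vector is \<open>J dF(Y)\<close>.\<close>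
  define y where "y a b = normal_coordinates F u (partial a (partial b F) u)" for a b
  define Y where "Y = (\<Sum>a\<in>UNIV. \<Sum>b\<in>UNIV. ?g $ a $ b *\<^sub>R y a b)"
  have Dy: "?D (y a b) \<bullet> partial k F u = - ?S a b k" for a b k
    unfolding y_def partial_def[of k F] symplectic_form_normal_coordinates[OF la] by simp
  have "?D Y \<bullet> partial k F u = W (\<phi> u) \<bullet> partial k F u" for k
  proof -
    have "?D Y \<bullet> partial k F u = (\<Sum>a\<in>UNIV. \<Sum>b\<in>UNIV. ?g $ a $ b * (- ?S a b k))"
      by (simp add: Y_def linear_sum[OF lin] linear_scale[OF lin] inner_sum_left Dy)
    also have "\<dots> = (\<Sum>a\<in>UNIV. \<Sum>b\<in>UNIV. ?g $ a $ b * (?D (y a k) \<bullet> partial b F u))"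
      unfolding Dy by (intro sum.cong refl) (simp add: cubic_form_symmetric[OF u])
    also have "\<dots> = (\<Sum>a\<in>UNIV. y a k $ a)"
      by (intro sum.cong refl) (rule sum_inverse_metric[OF d])
    also have "\<dots> = W (\<phi> u) \<bullet> partial k F u"
      unfolding y_def by (rule inner_angle_gradient_partial[OF u, symmetric])
    finally show ?thesis .
  qed
  then have "?D Y = W (\<phi> u)"
    using tangent_eqI[OF u, of Y "tangent_coordinates F u (W (\<phi> u))"] angle_gradient_coordinates(1)[OF u] by simp
  moreover have "(\<Sum>a\<in>UNIV. \<Sum>b\<in>UNIV. ?g $ a $ b *\<^sub>R second_fundamental_form F u a b) = J (?D Y)"
    by (simp add: second_fundamental_form_def normal_part_lagrangian[OF la] Y_def y_def
        linear_sum[OF lin] linear_scale[OF lin] linear_sum[OF J_linear] linear_scale[OF J_linear])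
  ultimately show ?thesis by (simp add: mean_curvature_def)
qed

text \<open>If \<open>J W\<close> is parallel in the normal bundle, then \<open>J dW\<close> is tangential, so \<open>dW\<close> is normal and orthogonal to
  the tangential vector \<open>W\<close>.\<close>

lemma parallel_imp_inner_derivative_eq_0:
  assumes u: "u \<in> U" and par: "\<And>k. normal_derivative_mean_curvature F u k = 0"
  shows "frechet_derivative (\<lambda>u. W (\<phi> u) \<bullet> W (\<phi> u)) (at u) = (\<lambda>v. 0)"
proof -
  have W: "smooth_on_open (\<lambda>u. W (\<phi> u)) U" by (rule smooth_map_chart[OF angle_gradientD(2)[OF G] c])
  let ?W' = "frechet_derivative (\<lambda>u. W (\<phi> u)) (at u)" and ?D = "frechet_derivative F (at u)"
  let ?c = "1 / real CARD('N)"
  have la: "lagrangian_at F u" by (rule lagrangian_F[OF u])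
  have W': "((\<lambda>u. W (\<phi> u)) has_derivative ?W') (at u)" by (rule smooth_on_open_has_derivative[OF W u])
  have orth: "?W' (axis k 1) \<bullet> W (\<phi> u) = 0" for k
  proof -
    have "((\<lambda>u. ?c *\<^sub>R J (W (\<phi> u))) has_derivative (\<lambda>v. ?c *\<^sub>R J (?W' v))) (at u)"
      by (intro has_derivative_scaleR_right bounded_linear.has_derivative[OF bounded_linear_J W'])
    then have "(mean_curvature F has_derivative (\<lambda>v. ?c *\<^sub>R J (?W' v))) (at u)"
      by (rule has_derivative_transform_within_open[OF _ local_paramD(2)[OF c] u]) (simp add: mean_curvature_eq)
    then have "partial k (mean_curvature F) u = ?c *\<^sub>R J (?W' (axis k 1))"
      by (simp add: partial_def frechet_derivative_eqI)
    then have "normal_part F u (?c *\<^sub>R J (?W' (axis k 1))) = 0"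
      using par[of k] by (simp add: normal_derivative_mean_curvature_def)
    then have "?c *\<^sub>R J (?W' (axis k 1)) = ?D (tangent_coordinates F u (?c *\<^sub>R J (?W' (axis k 1))))"
      using lagrangian_decomposition[OF la, of "?c *\<^sub>R J (?W' (axis k 1))"] normal_part_lagrangian[OF la] by simp
    then obtain x where x: "?c *\<^sub>R J (?W' (axis k 1)) = ?D x" by blast
    obtain w where w: "W (\<phi> u) = ?D w" using angle_gradient_coordinates(1)[OF u] by metis
    have "?c * (?W' (axis k 1) \<bullet> W (\<phi> u)) = (?c *\<^sub>R J (?W' (axis k 1))) \<bullet> J (W (\<phi> u))"
      by (simp add: J_inner_J)
    also have "\<dots> = symplectic_form (?D w) (?D x)"
      unfolding x w symplectic_form_def by (rule inner_commute)
    also have "\<dots> = 0" using la by (simp add: lagrangian_at_def)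
    finally show ?thesis by simp
  qed
  have "?W' v \<bullet> W (\<phi> u) = 0" for v
    using linear_eq_sum_axis[OF has_derivative_linear[OF W'], of v] orth
    by (simp add: inner_sum_left)
  then have "(\<lambda>v. W (\<phi> u) \<bullet> ?W' v + ?W' v \<bullet> W (\<phi> u)) = (\<lambda>v. 0)"
    by (simp add: inner_commute)
  then show ?thesis
    using frechet_derivative_eqI[OF has_derivative_inner[OF W' W']] by simp
qed

end

lemma minimal_imp_parallel_mean_curvature:
  fixes \<Phi> :: "'e::euclidean_space \<Rightarrow> complex^'N::finite"
  assumes "minimal_immersion M \<Phi>"
  shows "parallel_mean_curvature M \<Phi>"
  unfolding parallel_mean_curvature_def
proof (intro conjI allI impI ballI)
  show "immersion M \<Phi>" using assms by (simp add: minimal_immersion_def)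
  fix U :: "(real^'N) set" and \<phi> u k assume c: "local_param M U \<phi>" and u: "u \<in> U"
  have "mean_curvature (\<Phi> \<circ> \<phi>) w = 0" if "w \<in> U" for w
    using assms c that unfolding minimal_immersion_def by blast
  then have "frechet_derivative (mean_curvature (\<Phi> \<circ> \<phi>)) (at u) = (\<lambda>v. 0)"
    by (rule frechet_derivative_zero_on_open[OF local_paramD(2)[OF c] u])
  then show "normal_derivative_mean_curvature (\<Phi> \<circ> \<phi>) u k = 0"
    by (simp add: normal_derivative_mean_curvature_def normal_part_def partial_def)
qed

theorem nontrivial_H_minimal_criterion:
  fixes \<Phi> :: "'e::euclidean_space \<Rightarrow> complex^'N::finite" and U :: "(real^'N) set"
  assumes L: "lagrangian_immersion M \<Phi>" and G: "angle_gradient M \<Phi> E W" and D: "divergence_free M \<Phi> W"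
    and c: "local_param M U \<phi>" and "connected U" and uv: "u \<in> U" "v \<in> U"
    and ne: "W (\<phi> u) \<bullet> W (\<phi> u) \<noteq> W (\<phi> v) \<bullet> W (\<phi> v)"
  shows "nontrivial_H_minimal M \<Phi>"
proof -
  have "\<not> parallel_mean_curvature M \<Phi>"
  proof
    assume par: "parallel_mean_curvature M \<Phi>"
    interpret lagrangian_chart M \<Phi> E W U \<phi> by (rule lagrangian_chart.intro[OF L G c])
    let ?h = "\<lambda>u. W (\<phi> u) \<bullet> W (\<phi> u)"
    have h: "smooth_on_open ?h U"
      by (intro smooth_on_open_inner smooth_map_chart[OF angle_gradientD(2)[OF G] c])
    have "(?h has_derivative (\<lambda>v. 0)) (at w within U)" if "w \<in> U" for w
    proof -
      have "\<And>k. normal_derivative_mean_curvature F w k = 0"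
        using par c that unfolding parallel_mean_curvature_def by blast
      then have "(?h has_derivative (\<lambda>v. 0)) (at w)"
        using smooth_on_open_has_derivative[OF h that] parallel_imp_inner_derivative_eq_0[OF that] by simp
      then show ?thesis by (rule has_derivative_at_withinI)
    qed
    then have "?h constant_on U"
      by (intro has_derivative_zero_connected_constant_on[OF \<open>connected U\<close> local_paramD(2)[OF c] finite.emptyI]) (auto intro: smooth_on_open_continuous_on[OF h])
    then show False using uv ne unfolding constant_on_def by metis
  qed
  then show ?thesis
    unfolding nontrivial_H_minimal_def
    using minimal_imp_parallel_mean_curvature H_minimal_if_angle_gradient_divergence_free[OF L G D] by blast
qed

section \<open>Weighted immersions of a product of a torus and spheres\<close>

text \<open>A vector that is symplectically orthogonal to a Lagrangian subspace belongs to it.  This shows that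
  vectors are tangential without a comparison of dimensions.\<close>

lemma lagrangian_range:
  fixes F :: "real^'N::finite \<Rightarrow> complex^'N"
  assumes la: "lagrangian_at F u" and X: "\<And>v. symplectic_form X (frechet_derivative F (at u) v) = 0"
  shows "X \<in> range (frechet_derivative F (at u))"
proof -
  let ?D = "frechet_derivative F (at u)"
  have "?D (normal_coordinates F u X) \<bullet> ?D (normal_coordinates F u X) = 0"
    using symplectic_form_normal_coordinates[OF la, of X "normal_coordinates F u X"] X by simp
  then have "X = ?D (tangent_coordinates F u X) + J 0"
    using lagrangian_decomposition[OF la, of X] by simp
  also have "J 0 = (0 :: complex^'N)" by (rule linear_0[OF J_linear])
  finally show ?thesis by (metis add.right_neutral rangeI)
qed

text \<open>In every term of the Leibniz formula, the sum over \<open>a\<close> collects each entry \<open>l k\<close> once.\<close>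

lemma sum_det_replace_column_diagonal:
  fixes A :: "'a::comm_ring_1^'n::finite^'n"
  shows "(\<Sum>a\<in>UNIV. det (replace_column A a (\<chi> k. l k * A $ k $ a))) = (\<Sum>k\<in>UNIV. l k) * det A"
proof -
  have "(\<Sum>a\<in>UNIV. det (replace_column A a (\<chi> k. l k * A $ k $ a))) =
      (\<Sum>a\<in>UNIV. \<Sum>p\<in>{p. p permutes UNIV}. l (p a) * (of_int (sign p) * (\<Prod>i\<in>UNIV. A $ p i $ i)))"
    unfolding det_replace_column
  proof (intro sum.cong refl)
    fix a :: 'n and p assume "p \<in> {p. p permutes (UNIV :: 'n set)}"
    have "(\<Prod>i\<in>UNIV. A $ p i $ i) = A $ p a $ a * (\<Prod>i\<in>UNIV - {a}. A $ p i $ i)"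
      by (rule prod.remove) auto
    then show "of_int (sign p) * ((\<chi> k. l k * A $ k $ a) $ p a * (\<Prod>i\<in>UNIV - {a}. A $ p i $ i)) =
        l (p a) * (of_int (sign p) * (\<Prod>i\<in>UNIV. A $ p i $ i))"
      by (simp add: mult_ac)
  qed
  also have "\<dots> = (\<Sum>p\<in>{p. p permutes UNIV}. (\<Sum>a\<in>UNIV. l (p a)) * (of_int (sign p) * (\<Prod>i\<in>UNIV. A $ p i $ i)))"
    by (subst sum.swap) (simp add: sum_distrib_right)
  also have "\<dots> = (\<Sum>p\<in>{p. p permutes UNIV}. (\<Sum>k\<in>UNIV. l k) * (of_int (sign p) * (\<Prod>i\<in>UNIV. A $ p i $ i)))"
  proof (rule sum.cong[OF refl])
    fix p assume "p \<in> {p. p permutes (UNIV :: 'n set)}"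
    then have "(\<Sum>a\<in>UNIV. l (p a)) = (\<Sum>k\<in>UNIV. l k)"
      using sum.reindex_bij_betw[of p UNIV UNIV l] permutes_imp_bij by blast
    then show "(\<Sum>a\<in>UNIV. l (p a)) * (of_int (sign p) * (\<Prod>i\<in>UNIV. A $ p i $ i)) =
      (\<Sum>k\<in>UNIV. l k) * (of_int (sign p) * (\<Prod>i\<in>UNIV. A $ p i $ i))" by simp
  qed
  also have "\<dots> = (\<Sum>k\<in>UNIV. l k) * det (transpose A)"
    by (simp add: det_def transpose_def sum_distrib_left)
  finally show ?thesis by simp
qed

lemma smooth_map_if_smooth_on_open:
  assumes "smooth_on_open f S" "M \<subseteq> S"
  shows "smooth_map f M"
  using assms unfolding smooth_map_def by blast

locale weighted_torus =
  fixes b :: "'d::finite \<Rightarrow> 'n::finite" and g :: "'d \<Rightarrow> nat" and e :: "'N::finite \<Rightarrow> 'd"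
  assumes weight_pos: "\<And>i. 0 < g i" and bij_e: "bij e"
begin

abbreviation "M \<equiv> torus_times_spheres b"
abbreviation "B k \<equiv> b (e k)"

definition w :: "'N \<Rightarrow> real" where "w k = real (g (e k))"

definition total_weight :: "'n \<Rightarrow> real" where
  "total_weight j = (\<Sum>k | B k = j. w k)"

text \<open>The coefficient of the rotation of the factor \<open>j\<close> in the gradient of the Lagrangian angle.\<close>

definition speed :: "'n \<Rightarrow> (complex^'n) \<times> (real^'d) \<Rightarrow> real" where
  "speed j p = total_weight j / (\<Sum>k | B k = j. w k * (snd p $ e k)\<^sup>2)"

definition weighted_immersion :: "(complex^'n) \<times> (real^'d) \<Rightarrow> complex^'N" where
  "weighted_immersion p = (\<chi> k. fst p $ B k ^ g (e k) * of_real (snd p $ e k / sqrt (w k)))"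

definition phase :: "(complex^'n) \<times> (real^'d) \<Rightarrow> complex" where
  "phase p = (\<Prod>k\<in>UNIV. fst p $ B k ^ g (e k))"

definition angle_field :: "(complex^'n) \<times> (real^'d) \<Rightarrow> complex^'N" where
  "angle_field p = (\<chi> k. \<i> * of_real (speed (B k) p * w k) * weighted_immersion p $ k)"

definition weighted_tangent :: "(complex^'n) \<times> (real^'d) \<Rightarrow> ('n \<Rightarrow> real) \<Rightarrow> ('N \<Rightarrow> real) \<Rightarrow> complex^'N" where
  "weighted_tangent p \<alpha> \<xi> = (\<chi> k. fst p $ B k ^ g (e k) *
     ((\<i> * of_real (\<alpha> (B k) * w k * snd p $ e k) + of_real (\<xi> k)) / of_real (sqrt (w k))))"

lemma w_ge_1: "1 \<le> w k" and w_pos: "0 < w k" and w_nz: "w k \<noteq> 0"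
proof -
  show "1 \<le> w k" using weight_pos[of "e k"] by (simp add: w_def)
  then show "0 < w k" "w k \<noteq> 0" by simp_all
qed

lemma norm_fst: "p \<in> M \<Longrightarrow> norm (fst p $ j) = 1"
  by (auto simp: torus_times_spheres_def)

lemma cnj_mult_power:
  assumes "p \<in> M"
  shows "cnj (fst p $ j ^ n) * fst p $ j ^ n = 1"
proof -
  have "cnj (fst p $ j) * fst p $ j = 1"
    using norm_fst[OF assms, of j] complex_norm_square[of "fst p $ j"] by (simp add: mult.commute)
  then show ?thesis
    unfolding complex_cnj_power power_mult_distrib[symmetric] by simp
qed

lemma sum_squares_fibre:
  assumes "p \<in> M"
  shows "(\<Sum>k | B k = j. (snd p $ e k)\<^sup>2) = 1"
proof -
  have "e ` {k. B k = j} = {i. b i = j}"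
  proof (intro equalityI subsetI)
    fix i assume i: "i \<in> {i. b i = j}"
    obtain k where "i = e k" using bij_e by (meson bij_pointE)
    with i show "i \<in> e ` {k. B k = j}" by simp
  qed auto
  then have "bij_betw e {k. B k = j} {i. b i = j}"
    using bij_is_inj[OF bij_e] by (simp add: bij_betw_def inj_on_def)
  then have "(\<Sum>k | B k = j. (snd p $ e k)\<^sup>2) = (\<Sum>i | b i = j. (snd p $ i)\<^sup>2)"
    by (rule sum.reindex_bij_betw)
  then show ?thesis using assms by (auto simp: torus_times_spheres_def)
qed

lemma weighted_norm_ge_1:
  assumes "p \<in> M"
  shows "1 \<le> (\<Sum>k | B k = j. w k * (snd p $ e k)\<^sup>2)"
proof -
  have "(\<Sum>k | B k = j. (snd p $ e k)\<^sup>2) \<le> (\<Sum>k | B k = j. w k * (snd p $ e k)\<^sup>2)"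
  proof (rule sum_mono)
    fix k
    show "(snd p $ e k)\<^sup>2 \<le> w k * (snd p $ e k)\<^sup>2"
      using mult_right_mono[OF w_ge_1[of k] zero_le_power2[of "snd p $ e k"]] by simp
  qed
  then show ?thesis using sum_squares_fibre[OF assms, of j] by simp
qed

lemma sum_fibres: "(\<Sum>k\<in>UNIV. f (B k) * h k) = (\<Sum>j\<in>UNIV. f j * (\<Sum>k | B k = j. h k))" for f h :: "_ \<Rightarrow> real"
proof -
  have "(\<Sum>k\<in>UNIV. f (B k) * h k) = (\<Sum>j\<in>UNIV. \<Sum>k | k \<in> UNIV \<and> B k = j. f (B k) * h k)"
    by (rule sum.group[symmetric]) auto
  also have "\<dots> = (\<Sum>j\<in>UNIV. f j * (\<Sum>k | B k = j. h k))"
    unfolding sum_distrib_left by (intro sum.cong) auto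
  finally show ?thesis .
qed

subsection \<open>Linear algebra of the tangent spaces\<close>

text \<open>The vectors \<open>weighted_tangent p \<alpha> \<xi>\<close> with this property of \<open>\<xi>\<close> are the images of the tangent vectors
  at \<open>p\<close>: \<open>\<alpha>\<close> holds the angular velocities in the circles and \<open>\<xi>\<close> is tangent to the spheres.\<close>

definition tangent_to_spheres :: "(complex^'n) \<times> (real^'d) \<Rightarrow> ('N \<Rightarrow> real) \<Rightarrow> bool" where
  "tangent_to_spheres p \<xi> \<longleftrightarrow> (\<forall>j. (\<Sum>k | B k = j. snd p $ e k * \<xi> k) = 0)"

lemma hermitian_weighted_tangent:
  assumes "p \<in> M"
  shows "cnj (weighted_tangent p \<alpha> \<xi> $ k) * weighted_tangent p \<alpha>' \<xi>' $ k =
    Complex (\<alpha> (B k) * \<alpha>' (B k) * (w k * (snd p $ e k)\<^sup>2) + \<xi> k * \<xi>' k / w k)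
      (\<alpha>' (B k) * (snd p $ e k * \<xi> k) - \<alpha> (B k) * (snd p $ e k * \<xi>' k))"
proof -
  let ?z = "fst p $ B k ^ g (e k)" and ?x = "snd p $ e k"
  let ?t = "\<i> * of_real (\<alpha> (B k) * w k * ?x) + of_real (\<xi> k)" and ?t' = "\<i> * of_real (\<alpha>' (B k) * w k * ?x) + of_real (\<xi>' k)"
  have s: "of_real (sqrt (w k)) * of_real (sqrt (w k)) = complex_of_real (w k)"
    using w_pos[of k] by (simp flip: of_real_mult)
  have "cnj (weighted_tangent p \<alpha> \<xi> $ k) * weighted_tangent p \<alpha>' \<xi>' $ k =
      (cnj ?z * ?z) * ((cnj ?t * ?t') / (of_real (sqrt (w k)) * of_real (sqrt (w k))))"
    by (simp add: weighted_tangent_def)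
  also have "\<dots> = (cnj ?t * ?t') / of_real (w k)"
    unfolding cnj_mult_power[OF assms] s by simp
  also have "\<dots> = Complex (\<alpha> (B k) * \<alpha>' (B k) * (w k * ?x\<^sup>2) + \<xi> k * \<xi>' k / w k)
      (\<alpha>' (B k) * (?x * \<xi> k) - \<alpha> (B k) * (?x * \<xi>' k))"
    using w_nz[of k] by (simp add: complex_eq_iff field_simps power2_eq_square)
  finally show ?thesis .
qed

lemma symplectic_form_weighted_tangent:
  assumes "p \<in> M" "tangent_to_spheres p \<xi>" "tangent_to_spheres p \<xi>'"
  shows "symplectic_form (weighted_tangent p \<alpha> \<xi>) (weighted_tangent p \<alpha>' \<xi>') = 0"
  using assms(2,3) sum_fibres[of \<alpha>' "\<lambda>k. snd p $ e k * \<xi> k"] sum_fibres[of \<alpha> "\<lambda>k. snd p $ e k * \<xi>' k"]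
  by (simp add: symplectic_form_eq_Im hermitian_weighted_tangent[OF assms(1)] sum_subtractf tangent_to_spheres_def)

lemma inner_weighted_tangent:
  assumes "p \<in> M"
  shows "weighted_tangent p \<alpha> \<xi> \<bullet> weighted_tangent p \<alpha>' \<xi>' =
    (\<Sum>j\<in>UNIV. \<alpha> j * \<alpha>' j * (\<Sum>k | B k = j. w k * (snd p $ e k)\<^sup>2)) + (\<Sum>k\<in>UNIV. \<xi> k * \<xi>' k / w k)"
  using sum_fibres[of "\<lambda>j. \<alpha> j * \<alpha>' j"]
  by (simp add: inner_eq_Re hermitian_weighted_tangent[OF assms] sum.distrib)

lemma weighted_tangent_eqD:
  assumes p: "p \<in> M" and eq: "weighted_tangent p \<alpha> \<xi> = weighted_tangent p \<alpha>' \<xi>'"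
  shows "\<alpha> j = \<alpha>' j" "\<xi> k = \<xi>' k"
proof -
  have 1: "\<alpha> (B k) * w k * snd p $ e k = \<alpha>' (B k) * w k * snd p $ e k \<and> \<xi> k = \<xi>' k" for k
  proof -
    have "fst p $ B k \<noteq> 0" using norm_fst[OF p, of "B k"] by auto
    moreover have "weighted_tangent p \<alpha> \<xi> $ k = weighted_tangent p \<alpha>' \<xi>' $ k" using eq by simp
    ultimately have "\<i> * of_real (\<alpha> (B k) * w k * snd p $ e k) + of_real (\<xi> k) =
        \<i> * of_real (\<alpha>' (B k) * w k * snd p $ e k) + complex_of_real (\<xi>' k)"
      using w_pos[of k] by (simp add: weighted_tangent_def)
    then show ?thesis by (simp add: complex_eq_iff)
  qed
  then show "\<xi> k = \<xi>' k" by simp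
  have "\<exists>k. B k = j \<and> snd p $ e k \<noteq> 0"
  proof (rule ccontr)
    assume "\<not> ?thesis"
    then have "(\<Sum>k | B k = j. (snd p $ e k)\<^sup>2) = 0" by (intro sum.neutral) auto
    then show False using sum_squares_fibre[OF p, of j] by simp
  qed
  then obtain k where "B k = j" "snd p $ e k \<noteq> 0" by blast
  then show "\<alpha> j = \<alpha>' j" using 1[of k] w_nz[of k] by simp
qed

lemma angle_field_eq_weighted_tangent:
  "angle_field p = weighted_tangent p (\<lambda>j. speed j p) (\<lambda>k. 0)"
  by (simp add: angle_field_def weighted_immersion_def weighted_tangent_def vec_eq_iff mult_ac)

lemma tangent_to_spheres_0: "tangent_to_spheres p (\<lambda>k. 0)"
  by (simp add: tangent_to_spheres_def)

text \<open>The product of \<open>\<partial>/\<partial>\<theta>\<^sub>j\<close> with itself cancels the denominator of \<open>speed\<close>, and \<open>d\<beta> = \<Sum>\<^sub>k g\<^sub>k d\<theta>\<close> remains, with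
  the angle \<open>\<theta>\<close> of the factor of \<open>k\<close>.\<close>

lemma inner_angle_field:
  assumes "p \<in> M"
  shows "angle_field p \<bullet> weighted_tangent p \<alpha> \<xi> = (\<Sum>k\<in>UNIV. \<alpha> (B k) * w k)"
proof -
  have "speed j p * (\<Sum>k | B k = j. w k * (snd p $ e k)\<^sup>2) = total_weight j" for j
    using weighted_norm_ge_1[OF assms, of j] by (simp add: speed_def)
  then have "angle_field p \<bullet> weighted_tangent p \<alpha> \<xi> = (\<Sum>j\<in>UNIV. \<alpha> j * total_weight j)"
    unfolding angle_field_eq_weighted_tangent inner_weighted_tangent[OF assms] mult_zero_left div_0 sum.neutral_const
      add_0_right mult.commute[of "speed _ p"] mult.assoc by simp
  then show ?thesis using sum_fibres[of \<alpha> w] by (simp add: total_weight_def)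
qed

lemma inner_angle_field_self:
  assumes "p \<in> M"
  shows "angle_field p \<bullet> angle_field p = (\<Sum>k\<in>UNIV. speed (B k) p * w k)"
  using inner_angle_field[OF assms, of "\<lambda>j. speed j p" "\<lambda>k. 0"]
  by (simp add: angle_field_eq_weighted_tangent[symmetric])

text \<open>The reflection that changes the sign of the \<open>\<alpha>\<close> components and fixes the \<open>\<xi>\<close> components of
  \<open>weighted_tangent p \<alpha> \<xi>\<close>, in the frame rotated by the powers of \<open>fst p\<close>.  It compares the columns of
  the Jacobian matrix with their complex conjugates.\<close>

definition reflection :: "(complex^'n) \<times> (real^'d) \<Rightarrow> real^'N^'N" where
  "reflection p = (\<chi> k l. (if k = l then 1 else 0) - (if B k = B l then
     2 * (sqrt (w k) * snd p $ e k) * (sqrt (w l) * snd p $ e l) / (\<Sum>i | B i = B k. w i * (snd p $ e i)\<^sup>2) else 0))"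

lemma sum_if_fibre: "(\<Sum>l\<in>UNIV. if B k = B l then f l else 0) = (\<Sum>l | B l = B k. f l)" for f :: "'N \<Rightarrow> 'x::comm_monoid_add"
  by (simp add: sum.If_cases Collect_conv_if eq_commute[of "B k"])

lemma reflection_mult_component:
  fixes t :: "'N \<Rightarrow> 'a::real_algebra_1"
  shows "(\<Sum>l\<in>UNIV. of_real (reflection p $ k $ l) * t l) =
    t k - of_real (2 * (sqrt (w k) * snd p $ e k) / (\<Sum>i | B i = B k. w i * (snd p $ e i)\<^sup>2)) *
      (\<Sum>l | B l = B k. of_real (sqrt (w l) * snd p $ e l) * t l)"
proof -
  let ?c = "2 * (sqrt (w k) * snd p $ e k) / (\<Sum>i | B i = B k. w i * (snd p $ e i)\<^sup>2)"
  have "of_real (reflection p $ k $ l) * t l =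
      (if k = l then t l else 0) - (if B k = B l then of_real ?c * (of_real (sqrt (w l) * snd p $ e l) * t l) else 0)" for l
  proof -
    have "reflection p $ k $ l = (if k = l then 1 else 0) - (if B k = B l then ?c * (sqrt (w l) * snd p $ e l) else 0)"
      by (simp only: reflection_def vec_lambda_beta times_divide_eq_left)
    moreover have "of_real ((if P then 1 else 0) - (if Q then c * v else 0)) * s =
        (if P then s else 0) - (if Q then of_real c * (of_real v * s) else 0)" for P Q c v and s :: 'a
      by (cases P; cases Q) (simp_all add: left_diff_distrib mult.assoc)
    ultimately show ?thesis by (simp only:)
  qed
  then have "(\<Sum>l\<in>UNIV. of_real (reflection p $ k $ l) * t l) =
      (\<Sum>l\<in>UNIV. if k = l then t l else 0) -
      (\<Sum>l\<in>UNIV. if B k = B l then of_real ?c * (of_real (sqrt (w l) * snd p $ e l) * t l) else 0)"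
    by (simp only: sum_subtractf)
  also have "(\<Sum>l\<in>UNIV. if k = l then t l else 0) = t k" by simp
  also have "(\<Sum>l\<in>UNIV. if B k = B l then of_real ?c * (of_real (sqrt (w l) * snd p $ e l) * t l) else 0) =
      of_real ?c * (\<Sum>l | B l = B k. of_real (sqrt (w l) * snd p $ e l) * t l)"
    by (simp only: sum_if_fibre sum_distrib_left)
  finally show ?thesis .
qed

lemma reflection_involution:
  assumes "p \<in> M"
  shows "reflection p ** reflection p = mat 1"
proof -
  define v where "v l = sqrt (w l) * snd p $ e l" for l
  define r where "r j = (\<Sum>i | B i = j. w i * (snd p $ e i)\<^sup>2)" for j
  have entry: "reflection p $ k $ l = (if k = l then 1 else 0) - (if B k = B l then 2 * v k * v l / r (B k) else 0)" for k l
    by (simp add: reflection_def v_def r_def)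
  have sum_v: "(\<Sum>l | B l = j. v l * v l) = r j" for j
    unfolding r_def v_def
    by (intro sum.cong refl) (simp add: power2_eq_square[symmetric] power_mult_distrib less_imp_le[OF w_pos])
  have "(\<Sum>l\<in>UNIV. reflection p $ k $ l * reflection p $ l $ m) = (if k = m then 1 else 0)" for k m
  proof -
    have r: "r (B k) \<noteq> 0" using weighted_norm_ge_1[OF assms, of "B k"] by (auto simp: r_def)
    have "(\<Sum>l | B l = B k. v l * reflection p $ l $ m) =
        (\<Sum>l | B l = B k. (if l = m then v m else 0) - (if B k = B m then 2 * v m / r (B k) * (v l * v l) else 0))"
      by (intro sum.cong refl) (auto simp: entry right_diff_distrib)
    also have "\<dots> = (if B m = B k then v m else 0) - (if B k = B m then 2 * v m / r (B k) * r (B k) else 0)"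
    proof -
      have "(\<Sum>l | B l = B k. if P then c * (v l * v l) else 0) = (if P then c * r (B k) else 0)" for P c
        by (cases P) (simp_all only: if_True if_False sum_distrib_left[symmetric] sum_v sum.neutral_const)
      moreover have "(\<Sum>l | B l = B k. if l = m then v m else 0) = (if B m = B k then v m else 0)"
        by simp
      ultimately show ?thesis by (simp only: sum_subtractf)
    qed
    also have "\<dots> = - (if B k = B m then v m else 0)" using r by auto
    finally have "(\<Sum>l | B l = B k. v l * reflection p $ l $ m) = - (if B k = B m then v m else 0)" .
    then have "(\<Sum>l\<in>UNIV. reflection p $ k $ l * reflection p $ l $ m) =
        reflection p $ k $ m + 2 * v k / r (B k) * (if B k = B m then v m else 0)"
      using reflection_mult_component[of p k "\<lambda>l. reflection p $ l $ m"] by (simp add: v_def r_def)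
    then show ?thesis by (simp add: entry)
  qed
  then show ?thesis by (simp add: matrix_matrix_mult_def mat_def vec_eq_iff)
qed

text \<open>In the frame rotated back by the powers of \<open>fst p\<close> the components \<open>\<alpha>\<close> are imaginary and the components
  \<open>\<xi>\<close> are real, so that the reflection acts as complex conjugation.\<close>

lemma cnj_weighted_tangent:
  assumes p: "p \<in> M" and \<xi>: "tangent_to_spheres p \<xi>"
  shows "cnj (weighted_tangent p \<alpha> \<xi> $ k) = cnj (fst p $ B k ^ g (e k)) *
    (\<Sum>l\<in>UNIV. of_real (reflection p $ k $ l) * (cnj (fst p $ B l ^ g (e l)) * weighted_tangent p \<alpha> \<xi> $ l))"
proof -
  let ?r = "\<Sum>i | B i = B k. w i * (snd p $ e i)\<^sup>2"
  let ?t = "\<lambda>l. (\<i> * of_real (\<alpha> (B l) * w l * snd p $ e l) + of_real (\<xi> l)) / complex_of_real (sqrt (w l))"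
  have t: "cnj (fst p $ B l ^ g (e l)) * weighted_tangent p \<alpha> \<xi> $ l = ?t l" for l
    using cnj_mult_power[OF p, of "B l" "g (e l)"]
    by (simp add: weighted_tangent_def mult.assoc[symmetric])
  have "(\<Sum>l | B l = B k. of_real (sqrt (w l) * snd p $ e l) * ?t l) =
      (\<Sum>l | B l = B k. \<i> * of_real (\<alpha> (B k)) * of_real (w l * (snd p $ e l)\<^sup>2) + of_real (snd p $ e l * \<xi> l))"
  proof (intro sum.cong refl)
    fix l assume l: "l \<in> {l. B l = B k}"
    have "complex_of_real (sqrt (w l)) \<noteq> 0" using w_pos[of l] by simp
    then show "of_real (sqrt (w l) * snd p $ e l) * ?t l =
        \<i> * of_real (\<alpha> (B k)) * of_real (w l * (snd p $ e l)\<^sup>2) + of_real (snd p $ e l * \<xi> l)"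
      using l by (simp add: field_simps power2_eq_square)
  qed
  also have "\<dots> = \<i> * of_real (\<alpha> (B k) * ?r)"
  proof -
    have split: "(\<Sum>l | B l = B k. \<i> * of_real (\<alpha> (B k)) * of_real (h l) + of_real (y l)) =
        \<i> * of_real (\<alpha> (B k)) * complex_of_real (\<Sum>l | B l = B k. h l) + of_real (\<Sum>l | B l = B k. y l)" for h y
      by (simp only: sum.distrib sum_distrib_left[symmetric] of_real_sum)
    have "(\<Sum>l | B l = B k. snd p $ e l * \<xi> l) = 0"
      using \<xi> by (simp add: tangent_to_spheres_def)
    then show ?thesis
      unfolding split by (simp del: of_real_sum)
  qed
  finally have s: "(\<Sum>l | B l = B k. of_real (sqrt (w l) * snd p $ e l) * ?t l) = \<i> * of_real (\<alpha> (B k) * ?r)" .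
  have r: "?r \<noteq> 0" using weighted_norm_ge_1[OF p, of "B k"] by linarith
  have "(\<Sum>l\<in>UNIV. of_real (reflection p $ k $ l) * ?t l) =
      ?t k - of_real (2 * (sqrt (w k) * snd p $ e k) / ?r) * (\<i> * of_real (\<alpha> (B k) * ?r))"
    unfolding reflection_mult_component s ..
  also have "\<dots> = ?t k - of_real (2 * (sqrt (w k) * snd p $ e k)) * (\<i> * of_real (\<alpha> (B k)))"
  proof -
    have "complex_of_real (x / R) * (\<i> * of_real (a * R)) = of_real x * (\<i> * of_real a)" if "R \<noteq> 0" for x R a
      using that by simp
    from this[OF r] show ?thesis by (simp only:)
  qed
  also have "\<dots> = cnj (?t k)"
  proof -
    have "sqrt (w k) \<noteq> 0" using w_pos[of k] by simp
    moreover have "w k = sqrt (w k) * sqrt (w k)" using w_pos[of k] by simp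
    ultimately show ?thesis
      by (simp add: complex_eq_iff field_simps)
  qed
  finally have "(\<Sum>l\<in>UNIV. of_real (reflection p $ k $ l) * ?t l) = cnj (?t k)" .
  then show ?thesis
    unfolding t by (simp add: weighted_tangent_def)
qed

end

context weighted_torus
begin

subsection \<open>The immersion in a chart\<close>

lemma smooth_weighted_immersion: "smooth_on_open weighted_immersion UNIV"
  unfolding weighted_immersion_def[abs_def] using w_nz
  by (intro smooth_intros) auto

lemma smooth_phase: "smooth_on_open phase UNIV"
  unfolding phase_def[abs_def] by (intro smooth_intros) auto

lemma smooth_angle_field: "smooth_map angle_field M"
proof (rule smooth_map_if_smooth_on_open)
  let ?r = "\<lambda>j p. \<Sum>k | B k = j. w k * (snd p $ e k)\<^sup>2"
  let ?S = "\<Inter>j. {p :: (complex^'n) \<times> (real^'d). 0 < ?r j p}"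
  have "open {p :: (complex^'n) \<times> (real^'d). 0 < ?r j p}" for j
    by (intro open_Collect_less continuous_intros)
  then have S: "open ?S" by (intro open_INT) auto
  have "smooth_on_open (speed j) ?S" for j
    unfolding speed_def[abs_def] by (intro smooth_intros S) (auto dest: spec[where x = j])
  then show "smooth_on_open angle_field ?S"
    unfolding angle_field_def[abs_def]
    by (intro smooth_intros S smooth_on_open_subset[OF smooth_weighted_immersion])
       auto
  show "M \<subseteq> ?S" using weighted_norm_ge_1 by (fastforce intro: less_le_trans[OF zero_less_one])
qed

context
  fixes U :: "(real^'N) set" and \<phi> :: "real^'N \<Rightarrow> (complex^'n) \<times> (real^'d)"
  assumes c: "local_param M U \<phi>"
begin

definition angular :: "real^'N \<Rightarrow> real^'N \<Rightarrow> 'n \<Rightarrow> real" where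
  "angular u v j = Im (cnj (fst (\<phi> u) $ j) * fst (frechet_derivative \<phi> (at u) v) $ j)"

definition spherical :: "real^'N \<Rightarrow> real^'N \<Rightarrow> 'N \<Rightarrow> real" where
  "spherical u v k = snd (frechet_derivative \<phi> (at u) v) $ e k"

lemma in_M: "u \<in> U \<Longrightarrow> \<phi> u \<in> M"
  using local_paramD(5)[OF c] by blast

lemma has_derivative_fst_chart:
  assumes "u \<in> U"
  shows "((\<lambda>u. fst (\<phi> u) $ j) has_derivative (\<lambda>v. fst (frechet_derivative \<phi> (at u) v) $ j)) (at u)"
  by (rule bounded_linear.has_derivative[OF bounded_linear_vec_nth has_derivative_fst[OF
        smooth_on_open_has_derivative[OF local_paramD(1)[OF c] assms]]])

lemma has_derivative_snd_chart:
  assumes "u \<in> U"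
  shows "((\<lambda>u. snd (\<phi> u) $ i) has_derivative (\<lambda>v. snd (frechet_derivative \<phi> (at u) v) $ i)) (at u)"
  by (rule bounded_linear.has_derivative[OF bounded_linear_vec_nth has_derivative_snd[OF
        smooth_on_open_has_derivative[OF local_paramD(1)[OF c] assms]]])

text \<open>The derivative of \<open>\<bar>z\<^sub>j\<bar>\<^sup>2 = 1\<close> shows that \<open>cnj z\<^sub>j * dz\<^sub>j\<close> is imaginary.\<close>

lemma fst_derivative_chart:
  assumes u: "u \<in> U"
  shows "fst (frechet_derivative \<phi> (at u) v) $ j = \<i> * of_real (angular u v j) * fst (\<phi> u) $ j"
proof -
  let ?z = "\<lambda>u. fst (\<phi> u) $ j" and ?dz = "\<lambda>v. fst (frechet_derivative \<phi> (at u) v) $ j"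
  have one: "cnj (?z y) * ?z y = 1" if "y \<in> U" for y
    using cnj_mult_power[OF in_M[OF that], of j 1] by simp
  have "((\<lambda>u. cnj (?z u) * ?z u) has_derivative (\<lambda>v. cnj (?z u) * ?dz v + cnj (?dz v) * ?z u)) (at u)"
    by (intro has_derivative_mult has_derivative_cnj has_derivative_fst_chart u)
  then have "((\<lambda>u. 1) has_derivative (\<lambda>v. cnj (?z u) * ?dz v + cnj (?dz v) * ?z u)) (at u)"
    by (rule has_derivative_transform_within_open[OF _ local_paramD(2)[OF c] u]) (rule one)
  then have "(\<lambda>v. cnj (?z u) * ?dz v + cnj (?dz v) * ?z u) = (\<lambda>v. 0)"
    using has_derivative_unique has_derivative_const by blast
  from fun_cong[OF this, of v] have "cnj (?z u) * ?dz v + cnj (?dz v) * ?z u = 0" .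
  then have "Re (cnj (?z u) * ?dz v) = 0"
    by (simp add: complex_eq_iff)
  then have *: "cnj (?z u) * ?dz v = \<i> * of_real (angular u v j)"
    by (simp add: complex_eq_iff angular_def)
  have "?dz v = (cnj (?z u) * ?z u) * ?dz v" by (simp add: one[OF u])
  also have "\<dots> = (cnj (?z u) * ?dz v) * ?z u" by (simp only: mult_ac)
  finally show ?thesis unfolding * .
qed

lemma tangent_spherical:
  assumes u: "u \<in> U"
  shows "tangent_to_spheres (\<phi> u) (spherical u v)"
  unfolding tangent_to_spheres_def
proof
  fix j
  let ?x = "\<lambda>k u. snd (\<phi> u) $ e k"
  have "((\<lambda>u. \<Sum>k | B k = j. ?x k u * ?x k u) has_derivative
      (\<lambda>v. \<Sum>k | B k = j. ?x k u * spherical u v k + spherical u v k * ?x k u)) (at u)"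
    unfolding spherical_def by (intro has_derivative_sum has_derivative_mult has_derivative_snd_chart u)
  then have "((\<lambda>u. 1) has_derivative
      (\<lambda>v. \<Sum>k | B k = j. ?x k u * spherical u v k + spherical u v k * ?x k u)) (at u)"
    by (rule has_derivative_transform_within_open[OF _ local_paramD(2)[OF c] u])
       (use sum_squares_fibre[OF in_M] in \<open>simp add: power2_eq_square\<close>)
  then have "(\<lambda>v. \<Sum>k | B k = j. ?x k u * spherical u v k + spherical u v k * ?x k u) = (\<lambda>v. 0)"
    using has_derivative_unique has_derivative_const by blast
  from fun_cong[OF this, of v] show "(\<Sum>k | B k = j. ?x k u * spherical u v k) = 0"
    by (simp add: mult.commute sum_distrib_left[symmetric])
qed

lemma has_derivative_power_chart:
  assumes u: "u \<in> U"
  shows "((\<lambda>u. fst (\<phi> u) $ B k ^ g (e k)) has_derivative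
    (\<lambda>v. \<i> * of_real (angular u v (B k) * w k) * fst (\<phi> u) $ B k ^ g (e k))) (at u)"
proof (rule has_derivative_eq_rhs[OF has_derivative_power[OF has_derivative_fst_chart[OF u]]], rule ext)
  fix v
  have "fst (\<phi> u) $ B k * fst (\<phi> u) $ B k ^ (g (e k) - 1) = fst (\<phi> u) $ B k ^ g (e k)"
    using weight_pos[of "e k"] by (simp add: power_eq_if)
  then show "of_nat (g (e k)) * fst (frechet_derivative \<phi> (at u) v) $ B k * fst (\<phi> u) $ B k ^ (g (e k) - 1) =
    \<i> * of_real (angular u v (B k) * w k) * fst (\<phi> u) $ B k ^ g (e k)"
    unfolding fst_derivative_chart[OF u] by (simp add: w_def mult_ac)
qed

lemma smooth_weighted_immersion_chart: "smooth_on_open (weighted_immersion \<circ> \<phi>) U"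
  unfolding o_def
  by (rule smooth_on_open_compose[OF smooth_weighted_immersion local_paramD(1)[OF c]]) simp

lemma derivative_weighted_immersion:
  assumes u: "u \<in> U"
  shows "frechet_derivative (weighted_immersion \<circ> \<phi>) (at u) v = weighted_tangent (\<phi> u) (angular u v) (spherical u v)"
proof -
  have "frechet_derivative (weighted_immersion \<circ> \<phi>) (at u) v $ k =
      weighted_tangent (\<phi> u) (angular u v) (spherical u v) $ k" for k
  proof -
    have "frechet_derivative (weighted_immersion \<circ> \<phi>) (at u) v $ k =
        frechet_derivative (\<lambda>u. (weighted_immersion \<circ> \<phi>) u $ k) (at u) v"
      by (rule frechet_derivative_linear_compose[OF bounded_linear_vec_nth
            smooth_on_open_differentiable[OF smooth_weighted_immersion_chart u], symmetric])
    also have "(\<lambda>u. (weighted_immersion \<circ> \<phi>) u $ k) =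
        (\<lambda>u. fst (\<phi> u) $ B k ^ g (e k) * of_real (snd (\<phi> u) $ e k * inverse (sqrt (w k))))"
      by (simp add: weighted_immersion_def divide_inverse)
    also have "frechet_derivative \<dots> (at u) = (\<lambda>v. fst (\<phi> u) $ B k ^ g (e k) * of_real (spherical u v k * inverse (sqrt (w k))) +
        \<i> * of_real (angular u v (B k) * w k) * fst (\<phi> u) $ B k ^ g (e k) * of_real (snd (\<phi> u) $ e k * inverse (sqrt (w k))))"
      unfolding spherical_def
      by (intro frechet_derivative_eqI has_derivative_mult has_derivative_power_chart has_derivative_of_real
          has_derivative_mult_left has_derivative_snd_chart u)
    also have "\<dots> v = weighted_tangent (\<phi> u) (angular u v) (spherical u v) $ k"
      using w_pos[of k] by (simp add: weighted_tangent_def field_simps)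
    finally show ?thesis .
  qed
  then show ?thesis by (simp add: vec_eq_iff)
qed

lemma weighted_tangent_0: "weighted_tangent p (\<lambda>j. 0) (\<lambda>k. 0) = 0"
  by (simp add: weighted_tangent_def vec_eq_iff)

text \<open>The angular and spherical components of a tangent vector can be read off from its image, which gives
  injectivity.\<close>

lemma lagrangian_at_weighted_immersion:
  assumes u: "u \<in> U"
  shows "lagrangian_at (weighted_immersion \<circ> \<phi>) u"
  unfolding lagrangian_at_def
proof (intro conjI allI)
  show d: "weighted_immersion \<circ> \<phi> differentiable at u"
    by (rule smooth_on_open_differentiable[OF smooth_weighted_immersion_chart u])
  show "symplectic_form (frechet_derivative (weighted_immersion \<circ> \<phi>) (at u) v)
      (frechet_derivative (weighted_immersion \<circ> \<phi>) (at u) v') = 0" for v v'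
    unfolding derivative_weighted_immersion[OF u]
    by (intro symplectic_form_weighted_tangent in_M tangent_spherical u)
  show "inj (frechet_derivative (weighted_immersion \<circ> \<phi>) (at u))"
  proof (subst linear_injective_0[OF linear_frechet_derivative[OF d]], intro allI impI)
    fix v assume "frechet_derivative (weighted_immersion \<circ> \<phi>) (at u) v = 0"
    then have "weighted_tangent (\<phi> u) (angular u v) (spherical u v) = weighted_tangent (\<phi> u) (\<lambda>j. 0) (\<lambda>k. 0)"
      unfolding derivative_weighted_immersion[OF u] weighted_tangent_0 .
    from weighted_tangent_eqD[OF in_M[OF u] this]
    have 0: "angular u v j = 0" "spherical u v k = 0" for j k by auto
    have "fst (frechet_derivative \<phi> (at u) v) $ j = 0" for j
      unfolding fst_derivative_chart[OF u] 0 by simp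
    moreover have "snd (frechet_derivative \<phi> (at u) v) $ i = 0" for i
    proof -
      obtain k where "i = e k" using bij_e by (meson bij_pointE)
      then show ?thesis using 0(2)[of k] by (simp add: spherical_def)
    qed
    ultimately have "frechet_derivative \<phi> (at u) v = 0"
      by (simp add: prod_eq_iff vec_eq_iff)
    moreover have "linear (frechet_derivative \<phi> (at u))"
      by (rule linear_frechet_derivative[OF smooth_on_open_differentiable[OF local_paramD(1)[OF c] u]])
    ultimately show "v = 0"
      using local_paramD(6)[OF c u] linear_injective_0 by blast
  qed
qed

lemma weighted_tangent_range:
  assumes u: "u \<in> U" and "tangent_to_spheres (\<phi> u) \<xi>"
  shows "weighted_tangent (\<phi> u) \<alpha> \<xi> \<in> range (frechet_derivative (weighted_immersion \<circ> \<phi>) (at u))"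
proof (rule lagrangian_range[OF lagrangian_at_weighted_immersion[OF u]])
  show "symplectic_form (weighted_tangent (\<phi> u) \<alpha> \<xi>) (frechet_derivative (weighted_immersion \<circ> \<phi>) (at u) v) = 0" for v
    unfolding derivative_weighted_immersion[OF u]
    by (intro symplectic_form_weighted_tangent in_M tangent_spherical u assms(2))
qed

lemma derivative_phase:
  assumes u: "u \<in> U"
  shows "frechet_derivative (phase \<circ> \<phi>) (at u) v = \<i> * phase (\<phi> u) *
    of_real (angle_field (\<phi> u) \<bullet> frechet_derivative (weighted_immersion \<circ> \<phi>) (at u) v)"
proof -
  let ?z = "\<lambda>k u. fst (\<phi> u) $ B k ^ g (e k)"
  have "((\<lambda>u. \<Prod>k\<in>UNIV. ?z k u) has_derivative
      (\<lambda>v. \<Sum>k\<in>UNIV. \<i> * of_real (angular u v (B k) * w k) * ?z k u * (\<Prod>l\<in>UNIV - {k}. ?z l u))) (at u)"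
    by (intro has_derivative_prod has_derivative_power_chart u)
  moreover have "phase \<circ> \<phi> = (\<lambda>u. \<Prod>k\<in>UNIV. ?z k u)" by (simp add: phase_def o_def)
  ultimately have "frechet_derivative (phase \<circ> \<phi>) (at u) v =
      (\<Sum>k\<in>UNIV. \<i> * of_real (angular u v (B k) * w k) * (?z k u * (\<Prod>l\<in>UNIV - {k}. ?z l u)))"
    by (simp add: frechet_derivative_eqI mult.assoc)
  also have "\<dots> = (\<Sum>k\<in>UNIV. \<i> * of_real (angular u v (B k) * w k) * phase (\<phi> u))"
    unfolding phase_def by (intro sum.cong refl arg_cong2[where f = "(*)"] prod.remove[symmetric]) auto
  also have "\<dots> = \<i> * phase (\<phi> u) * of_real (\<Sum>k\<in>UNIV. angular u v (B k) * w k)"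
    by (simp add: sum_distrib_left sum_distrib_right mult_ac)
  finally show ?thesis
    unfolding derivative_weighted_immersion[OF u] inner_angle_field[OF in_M[OF u]] .
qed

text \<open>The columns satisfy \<open>cnj A = \<Delta> R \<Delta> A\<close> with the reflection \<open>R\<close> and the diagonal matrix \<open>\<Delta>\<close> of determinant
  \<open>cnj phase\<close>.  As \<open>(det R)\<^sup>2 = 1\<close>, this determines the fourth power of the phase of \<open>det A\<close>, without a choice
  of orientation.\<close>

lemma det_weighted_immersion:
  assumes u: "u \<in> U"
  defines "A \<equiv> jacobian_matrix (weighted_immersion \<circ> \<phi>) u"
  shows "det A ^ 4 = of_real (cmod (det A) ^ 4) * phase (\<phi> u) ^ 4"
proof -
  let ?z = "\<lambda>k. fst (\<phi> u) $ B k ^ g (e k)" and ?p = "phase (\<phi> u)"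
  define \<Delta> where "\<Delta> = (\<chi> k l. if k = l then cnj (?z k) else 0)"
  define R where "R = (\<chi> k l. complex_of_real (reflection (\<phi> u) $ k $ l))"
  note p = in_M[OF u]
  have A: "A $ k $ a = weighted_tangent (\<phi> u) (angular u (axis a 1)) (spherical u (axis a 1)) $ k" for k a
    by (simp add: A_def jacobian_matrix_def partial_def derivative_weighted_immersion[OF u])
  have diag: "(\<Delta> ** X) $ k $ a = cnj (?z k) * X $ k $ a" for X :: "complex^'N^'N" and k a
    by (simp add: \<Delta>_def matrix_matrix_mult_def if_distrib if_distribR cong: if_cong)
  have "(\<chi> k a. cnj (A $ k $ a)) = \<Delta> ** (R ** (\<Delta> ** A))"
  proof (intro vec_eq_iff[THEN iffD2] allI)
    fix k a
    have "(R ** (\<Delta> ** A)) $ k $ a = (\<Sum>l\<in>UNIV. of_real (reflection (\<phi> u) $ k $ l) * (cnj (?z l) * A $ l $ a))"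
      unfolding matrix_matrix_mult_def[of R] by (simp add: R_def diag)
    then show "(\<chi> k a. cnj (A $ k $ a)) $ k $ a = (\<Delta> ** (R ** (\<Delta> ** A))) $ k $ a"
      unfolding diag vec_lambda_beta A cnj_weighted_tangent[OF p tangent_spherical[OF u]] by simp
  qed
  then have "cnj (det A) = det \<Delta> * (det R * (det \<Delta> * det A))"
    unfolding det_cnj[symmetric] by (simp add: det_mul)
  moreover have "det \<Delta> = cnj ?p"
    unfolding \<Delta>_def by (subst det_diagonal) (simp_all add: phase_def)
  moreover have "(det R)\<^sup>2 = 1"
  proof -
    have "det (reflection (\<phi> u)) * det (reflection (\<phi> u)) = 1"
      unfolding det_mul[symmetric] reflection_involution[OF p] by (rule det_I)
    moreover have "det R = of_real (det (reflection (\<phi> u)))"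
      unfolding R_def by (rule det_of_real)
    ultimately show ?thesis by (simp add: power2_eq_square flip: of_real_mult)
  qed
  moreover have "(cnj ?p * ?p) = 1"
  proof -
    have "cnj ?p * ?p = (\<Prod>k\<in>UNIV. cnj (?z k) * ?z k)"
      by (simp add: phase_def prod.distrib)
    also have "\<dots> = 1" by (intro prod.neutral ballI cnj_mult_power p)
    finally show ?thesis .
  qed
  moreover have "of_real (cmod (det A) ^ 4) = (cnj (det A) * det A)\<^sup>2"
  proof -
    have "of_real (cmod (det A) ^ 4) = (complex_of_real ((cmod (det A))\<^sup>2))\<^sup>2" by simp
    then show ?thesis unfolding complex_norm_square by (simp only: mult.commute)
  qed
  ultimately have "of_real (cmod (det A) ^ 4) * ?p ^ 4 = (det R)\<^sup>2 * (cnj ?p * ?p) ^ 4 * det A ^ 4"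
    by (simp add: power_mult_distrib power2_eq_square power4_eq_xxxx mult_ac)
  then show ?thesis
    using \<open>(det R)\<^sup>2 = 1\<close> \<open>cnj ?p * ?p = 1\<close> by simp
qed

text \<open>The speeds depend on the position in the spheres only.\<close>

lemma derivative_speed_eq_0:
  assumes u: "u \<in> U" and "\<And>k. spherical u v k = 0"
  shows "((\<lambda>u. speed j (\<phi> u)) has_derivative frechet_derivative (\<lambda>u. speed j (\<phi> u)) (at u)) (at u)"
    and "frechet_derivative (\<lambda>u. speed j (\<phi> u)) (at u) v = 0"
proof -
  let ?x = "\<lambda>k u. snd (\<phi> u) $ e k" and ?r = "\<lambda>u. \<Sum>k | B k = j. w k * (snd (\<phi> u) $ e k)\<^sup>2"
  have "?r u \<noteq> 0" using weighted_norm_ge_1[OF in_M[OF u], of j] by linarith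
  moreover have "(?r has_derivative (\<lambda>v. \<Sum>k | B k = j. w k * (of_nat 2 * spherical u v k * ?x k u ^ (2 - 1)))) (at u)"
    unfolding spherical_def
    by (intro has_derivative_sum has_derivative_mult_right has_derivative_power has_derivative_snd_chart u)
  ultimately have der: "((\<lambda>u. total_weight j / ?r u) has_derivative
      (\<lambda>v. - total_weight j * (inverse (?r u) * (\<Sum>k | B k = j. w k * (of_nat 2 * spherical u v k * ?x k u ^ (2 - 1))) * inverse (?r u)) +
        0 / ?r u)) (at u)"
    by (intro has_derivative_divide has_derivative_const)
  then have "frechet_derivative (\<lambda>u. speed j (\<phi> u)) (at u) =
      (\<lambda>v. - total_weight j * (inverse (?r u) * (\<Sum>k | B k = j. w k * (of_nat 2 * spherical u v k * ?x k u ^ (2 - 1))) * inverse (?r u)) +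
        0 / ?r u)"
    unfolding speed_def by (rule frechet_derivative_eqI)
  with der assms(2) show "((\<lambda>u. speed j (\<phi> u)) has_derivative frechet_derivative (\<lambda>u. speed j (\<phi> u)) (at u)) (at u)"
    "frechet_derivative (\<lambda>u. speed j (\<phi> u)) (at u) v = 0"
    unfolding speed_def by simp_all
qed

text \<open>The derivative of \<open>\<Sum>\<^sub>j h\<^sub>j rot\<^sub>j\<close>, with the speeds \<open>h\<^sub>j\<close> and the rotation fields \<open>rot\<^sub>j\<close>, has two parts.
  Where \<open>h\<^sub>j\<close> is differentiated, the sum of determinants is the derivative of \<open>h\<^sub>j\<close> in the direction of
  \<open>rot\<^sub>j\<close>, which is zero.  The other part is an imaginary diagonal matrix applied to the columns, and
  contributes its trace.\<close>

lemma divergence_angle_field: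
  assumes u: "u \<in> U"
  defines "A \<equiv> jacobian_matrix (weighted_immersion \<circ> \<phi>) u"
  shows "(\<Sum>a\<in>UNIV. det (replace_column A a (partial a (angle_field \<circ> \<phi>) u))) =
    \<i> * of_real (angle_field (\<phi> u) \<bullet> angle_field (\<phi> u)) * det A"
proof -
  let ?F = "weighted_immersion \<circ> \<phi>" and ?h = "\<lambda>j u. speed j (\<phi> u)"
  let ?dh = "\<lambda>j. frechet_derivative (?h j) (at u)"
  note p = in_M[OF u]
  have dF: "?F differentiable (at u)"
    by (rule smooth_on_open_differentiable[OF smooth_weighted_immersion_chart u])
  \<comment> \<open>The rotation field of the circle \<open>j\<close>.\<close>
  define rot where "rot j = weighted_tangent (\<phi> u) (\<lambda>i. if i = j then 1 else 0) (\<lambda>k. 0)" for j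
  have rot: "rot j $ k = (if B k = j then \<i> * of_real (w k) * ?F u $ k else 0)" for j k
    by (simp add: rot_def weighted_tangent_def weighted_immersion_def mult_ac)
  have "\<exists>t. rot j = frechet_derivative ?F (at u) t" for j
    using weighted_tangent_range[OF u tangent_to_spheres_0] unfolding rot_def by blast
  then obtain t where t: "\<And>j. rot j = frechet_derivative ?F (at u) (t j)" by metis
  have sph: "spherical u (t j) k = 0" for j k
  proof -
    have "weighted_tangent (\<phi> u) (angular u (t j)) (spherical u (t j)) = weighted_tangent (\<phi> u) (\<lambda>i. if i = j then 1 else 0) (\<lambda>k. 0)"
      using t[of j] unfolding derivative_weighted_immersion[OF u] rot_def by (rule sym)
    from weighted_tangent_eqD(2)[OF p this] show ?thesis .
  qed
  have h: "((?h j) has_derivative ?dh j) (at u)" for j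
  proof -
    have "spherical u 0 k = 0" for k
      using linear_0[OF linear_frechet_derivative[OF smooth_on_open_differentiable[OF local_paramD(1)[OF c] u]]]
      by (simp add: spherical_def)
    from derivative_speed_eq_0(1)[OF u this] show ?thesis .
  qed
  have col: "partial a (angle_field \<circ> \<phi>) u = (\<Sum>j\<in>UNIV. of_real (?dh j (axis a 1)) *s rot j) +
      (\<chi> k. \<i> * of_real (?h (B k) u * w k) * A $ k $ a)" for a
  proof -
    have "partial a (angle_field \<circ> \<phi>) u $ k = of_real (?dh (B k) (axis a 1)) * (\<i> * of_real (w k) * ?F u $ k) +
        \<i> * of_real (?h (B k) u * w k) * A $ k $ a" for k
    proof -
      have "(angle_field \<circ> \<phi>) differentiable (at u)"
        using smooth_on_open_differentiable[OF smooth_map_chart[OF smooth_angle_field c] u] by (simp add: o_def)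
      then have "partial a (angle_field \<circ> \<phi>) u $ k = frechet_derivative (\<lambda>u. (angle_field \<circ> \<phi>) u $ k) (at u) (axis a 1)"
        unfolding partial_def by (rule frechet_derivative_linear_compose[OF bounded_linear_vec_nth, symmetric])
      also have "(\<lambda>u. (angle_field \<circ> \<phi>) u $ k) = (\<lambda>u. (\<i> * of_real (w k)) * (of_real (?h (B k) u) * ?F u $ k))"
        by (simp add: angle_field_def fun_eq_iff mult_ac)
      also have "frechet_derivative \<dots> (at u) = (\<lambda>v. (\<i> * of_real (w k)) * (of_real (?h (B k) u) * frechet_derivative ?F (at u) v $ k +
          of_real (?dh (B k) v) * ?F u $ k))"
        by (intro frechet_derivative_eqI has_derivative_mult_right has_derivative_mult has_derivative_of_real h
            bounded_linear.has_derivative[OF bounded_linear_vec_nth] dF[unfolded frechet_derivative_works])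
      finally have *: "partial a (angle_field \<circ> \<phi>) u $ k = (\<i> * of_real (w k)) *
          (of_real (?h (B k) u) * frechet_derivative ?F (at u) (axis a 1) $ k + of_real (?dh (B k) (axis a 1)) * ?F u $ k)" .
      have "A $ k $ a = frechet_derivative ?F (at u) (axis a 1) $ k"
        by (simp add: A_def jacobian_matrix_def partial_def)
      then show ?thesis unfolding * by (simp add: algebra_simps)
    qed
    moreover have "(\<Sum>j\<in>UNIV. of_real (?dh j (axis a 1)) *s rot j) $ k = of_real (?dh (B k) (axis a 1)) * (\<i> * of_real (w k) * ?F u $ k)" for k
      by (simp add: sum_component rot if_distrib cong: if_cong)
    ultimately show ?thesis by (simp add: vec_eq_iff)
  qed
  have "det (replace_column A a (rot j)) = of_real (t j $ a) * det A" for a j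
    unfolding t frechet_derivative_eq_jacobian_matrix[OF dF] A_def
    by (simp add: det_replace_column_cramer)
  then have "(\<Sum>a\<in>UNIV. det (replace_column A a (\<Sum>j\<in>UNIV. of_real (?dh j (axis a 1)) *s rot j))) =
      (\<Sum>a\<in>UNIV. \<Sum>j\<in>UNIV. of_real (t j $ a * ?dh j (axis a 1)) * det A)"
    by (simp add: det_replace_column_sum det_replace_column_scale mult_ac)
  also have "\<dots> = (\<Sum>j\<in>UNIV. of_real (\<Sum>a\<in>UNIV. t j $ a * ?dh j (axis a 1)) * det A)"
    by (subst sum.swap) (simp add: sum_distrib_right)
  also have "\<dots> = 0"
  proof (intro sum.neutral ballI)
    fix j
    have "(\<Sum>a\<in>UNIV. t j $ a * ?dh j (axis a 1)) = ?dh j (t j)"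
      using linear_eq_sum_axis[OF has_derivative_linear[OF h], of j "t j"] by simp
    also have "\<dots> = 0" by (rule derivative_speed_eq_0(2)[OF u sph])
    finally show "of_real (\<Sum>a\<in>UNIV. t j $ a * ?dh j (axis a 1)) * det A = 0" by simp
  qed
  finally have 1: "(\<Sum>a\<in>UNIV. det (replace_column A a (\<Sum>j\<in>UNIV. of_real (?dh j (axis a 1)) *s rot j))) = 0" .
  have 2: "(\<Sum>a\<in>UNIV. det (replace_column A a (\<chi> k. \<i> * of_real (?h (B k) u * w k) * A $ k $ a))) =
      \<i> * of_real (angle_field (\<phi> u) \<bullet> angle_field (\<phi> u)) * det A"
    unfolding sum_det_replace_column_diagonal inner_angle_field_self[OF p] by (simp add: sum_distrib_left)
  show ?thesis
    unfolding col det_replace_column_add sum.distrib 1 2 by simp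
qed

end

subsection \<open>Weighted immersions are Hamiltonian minimal\<close>

lemma lagrangian_weighted_immersion: "lagrangian_immersion M weighted_immersion"
  unfolding lagrangian_immersion_def immersion_def
  using lagrangian_at_weighted_immersion smooth_map_if_smooth_on_open[OF smooth_weighted_immersion]
  unfolding lagrangian_at_def by blast

lemma angle_gradient_weighted_immersion: "angle_gradient M weighted_immersion phase angle_field"
  unfolding angle_gradient_def
proof (intro conjI allI impI ballI)
  show "smooth_map phase M" by (rule smooth_map_if_smooth_on_open[OF smooth_phase]) simp
  show "smooth_map angle_field M" by (rule smooth_angle_field)
  fix U :: "(real^'N) set" and \<phi> u assume c: "local_param M U \<phi>" and u: "u \<in> U"
  show "det (jacobian_matrix (weighted_immersion \<circ> \<phi>) u) ^ 4 =
      of_real (cmod (det (jacobian_matrix (weighted_immersion \<circ> \<phi>) u)) ^ 4) * phase (\<phi> u) ^ 4"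
    by (rule det_weighted_immersion[OF c u])
  show "frechet_derivative (phase \<circ> \<phi>) (at u) v = \<i> * phase (\<phi> u) *
      of_real (angle_field (\<phi> u) \<bullet> frechet_derivative (weighted_immersion \<circ> \<phi>) (at u) v)" for v
    by (rule derivative_phase[OF c u])
  show "angle_field (\<phi> u) \<in> range (frechet_derivative (weighted_immersion \<circ> \<phi>) (at u))"
    unfolding angle_field_eq_weighted_tangent by (rule weighted_tangent_range[OF c u tangent_to_spheres_0])
qed

lemma divergence_free_angle_field: "divergence_free M weighted_immersion angle_field"
  unfolding divergence_free_def using divergence_angle_field by blast

end

subsection \<open>A chart\<close>

locale weighted_torus_chart = weighted_torus b g e
  for b :: "'d::finite \<Rightarrow> 'n::finite" and g :: "'d \<Rightarrow> nat" and e :: "'N::finite \<Rightarrow> 'd" +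
  fixes pole :: "'n \<Rightarrow> 'd"
  assumes b_pole: "b (pole j) = j"
begin

text \<open>The square of the height of a unit sphere over its equatorial plane.  The chart has the angles on the
  circles and, on each sphere, the coordinates other than the one at the pole.\<close>

definition height :: "'n \<Rightarrow> real^'N \<Rightarrow> real" where
  "height j u = 1 - (\<Sum>i | b i = j \<and> i \<noteq> pole j. (u $ inv e i)\<^sup>2)"

definition chart_domain :: "(real^'N) set" where
  "chart_domain = {u. \<forall>j. \<bar>u $ inv e (pole j)\<bar> < pi / 2 \<and> 0 < height j u}"

definition chart :: "real^'N \<Rightarrow> (complex^'n) \<times> (real^'d)" where
  "chart u = (\<chi> j. cis (u $ inv e (pole j)),
     \<chi> i. if i = pole (b i) then sqrt (height (b i) u) else u $ inv e i)"

definition chart_inverse :: "(complex^'n) \<times> (real^'d) \<Rightarrow> real^'N" where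
  "chart_inverse p = (\<chi> k. if e k = pole (B k) then arcsin (Im (fst p $ B k)) else snd p $ e k)"

definition chart_range :: "((complex^'n) \<times> (real^'d)) set" where
  "chart_range = {p. \<forall>j. 0 < Re (fst p $ j) \<and> 0 < snd p $ pole j}"

lemma e_inv [simp]: "e (inv e i) = i"
  using bij_e by (simp add: bij_is_surj surj_f_inv_f)

lemma inv_e [simp]: "inv e (e k) = k"
  using bij_e by (simp add: bij_is_inj)

lemma sum_fibre_split:
  "(\<Sum>i | b i = j. f i) = f (pole j) + (\<Sum>i | b i = j \<and> i \<noteq> pole j. f i)" for f :: "'d \<Rightarrow> real"
proof -
  have "{i. b i = j} - {pole j} = {i. b i = j \<and> i \<noteq> pole j}" by auto
  then show ?thesis using sum.remove[of "{i. b i = j}" "pole j" f] by (simp add: b_pole)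
qed

lemma snd_chart: "snd (chart u) $ pole j = sqrt (height j u)"
    "i \<noteq> pole (b i) \<Longrightarrow> snd (chart u) $ i = u $ inv e i"
  by (simp_all add: chart_def b_pole)

lemma fst_chart: "fst (chart u) $ j = cis (u $ inv e (pole j))"
  by (simp add: chart_def)

lemma weighted_sum_chart:
  assumes "0 \<le> height j u"
  shows "(\<Sum>i | b i = j. c i * (snd (chart u) $ i)\<^sup>2) =
    c (pole j) * height j u + (\<Sum>i | b i = j \<and> i \<noteq> pole j. c i * (u $ inv e i)\<^sup>2)"
proof -
  have "(\<Sum>i | b i = j \<and> i \<noteq> pole j. c i * (snd (chart u) $ i)\<^sup>2) =
      (\<Sum>i | b i = j \<and> i \<noteq> pole j. c i * (u $ inv e i)\<^sup>2)"
    by (intro sum.cong refl) (auto simp: snd_chart(2))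
  then show ?thesis
    unfolding sum_fibre_split[where j = j] snd_chart(1) using assms by simp
qed

lemma chart_in_M:
  assumes "\<And>j. 0 \<le> height j u"
  shows "chart u \<in> M"
proof -
  have "(\<Sum>i | b i = j. (snd (chart u) $ i)\<^sup>2) = 1" for j
    using weighted_sum_chart[OF assms, where c = "\<lambda>i. 1"] by (simp add: height_def)
  moreover have "norm (fst (chart u) $ j) = 1" for j by (simp add: fst_chart)
  ultimately show ?thesis by (cases "chart u") (simp add: torus_times_spheres_def)
qed

lemma open_chart_domain: "open chart_domain"
proof -
  have "chart_domain = (\<Inter>j. {u. \<bar>u $ inv e (pole j)\<bar> < pi / 2} \<inter> {u. 0 < height j u})"
    by (auto simp: chart_domain_def)
  moreover have "open {u. \<bar>u $ inv e (pole j)\<bar> < pi / 2}" "open {u. 0 < height j u}" for j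
    unfolding height_def by (intro open_Collect_less continuous_intros)+
  ultimately show ?thesis by (auto intro!: open_INT)
qed

lemma smooth_chart: "smooth_on_open chart chart_domain"
proof -
  have h: "smooth_on_open (height j) chart_domain" for j
    unfolding height_def[abs_def] by (intro smooth_intros open_chart_domain)
  have "smooth_on_open (\<lambda>u. if i = pole (b i) then sqrt (height (b i) u) else u $ inv e i) chart_domain" for i
  proof (cases "i = pole (b i)")
    case True
    have "smooth_on_open (\<lambda>u. sqrt (height (b i) u)) chart_domain"
      by (intro smooth_on_open_sqrt h) (simp add: chart_domain_def)
    with True show ?thesis by simp
  next
    case False
    then show ?thesis by (simp add: smooth_intros open_chart_domain)
  qed
  then show ?thesis
    unfolding chart_def[abs_def] by (intro smooth_intros open_chart_domain)
qed

lemma chart_inverse_chart: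
  assumes u: "u \<in> chart_domain"
  shows "chart_inverse (chart u) = u"
proof -
  have "chart_inverse (chart u) $ k = u $ k" for k
  proof (cases "e k = pole (B k)")
    case True
    then have "inv e (pole (B k)) = k" by (metis inv_e)
    moreover have "\<bar>u $ inv e (pole (B k))\<bar> < pi / 2" using u by (simp add: chart_domain_def)
    ultimately show ?thesis
      using True by (simp add: chart_inverse_def fst_chart arcsin_sin)
  next
    case False
    then show ?thesis by (simp add: chart_inverse_def snd_chart(2))
  qed
  then show ?thesis by (simp add: vec_eq_iff)
qed

lemma chart_image: "u \<in> chart_domain \<Longrightarrow> chart u \<in> M \<inter> chart_range"
proof (rule IntI)
  assume u: "u \<in> chart_domain"
  then show "chart u \<in> M" by (intro chart_in_M) (simp add: chart_domain_def less_imp_le)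
  have "0 < cos y" if "\<bar>y\<bar> < pi / 2" for y
    using that by (intro cos_gt_zero_pi) linarith+
  then show "chart u \<in> chart_range"
    using u by (simp add: chart_domain_def chart_range_def fst_chart snd_chart)
qed

lemma chart_inverse_image:
  assumes p: "p \<in> M \<inter> chart_range"
  shows "chart_inverse p \<in> chart_domain" "chart (chart_inverse p) = p"
proof -
  have pM: "p \<in> M" and pos: "0 < Re (fst p $ j)" "0 < snd p $ pole j" for j
    using p by (auto simp: chart_range_def)
  have sq: "(Re (fst p $ j))\<^sup>2 + (Im (fst p $ j))\<^sup>2 = 1" for j
    using norm_fst[OF pM, of j] cmod_power2[of "fst p $ j"] by simp
  have im: "\<bar>Im (fst p $ j)\<bar> < 1" for j
  proof -
    have "(Im (fst p $ j))\<^sup>2 < 1" using sq[of j] pos(1)[of j] zero_less_power[of "Re (fst p $ j)" 2] by linarith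
    then show ?thesis by (simp add: abs_square_less_1)
  qed
  have inv1: "chart_inverse p $ inv e (pole j) = arcsin (Im (fst p $ j))" for j
    by (simp add: chart_inverse_def b_pole)
  have inv2: "chart_inverse p $ inv e i = snd p $ i" if "i \<noteq> pole (b i)" for i
    using that by (simp add: chart_inverse_def)
  have h: "height j (chart_inverse p) = (snd p $ pole j)\<^sup>2" for j
  proof -
    have "(\<Sum>i | b i = j \<and> i \<noteq> pole j. (chart_inverse p $ inv e i)\<^sup>2) = (\<Sum>i | b i = j \<and> i \<noteq> pole j. (snd p $ i)\<^sup>2)"
      by (intro sum.cong refl) (auto simp: inv2)
    moreover have "(\<Sum>i | b i = j. (snd p $ i)\<^sup>2) = 1"
      using pM by (auto simp: torus_times_spheres_def)
    ultimately show ?thesis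
      unfolding height_def sum_fibre_split[where j = j and f = "\<lambda>i. (snd p $ i)\<^sup>2"] by simp
  qed
  have "\<bar>arcsin (Im (fst p $ j))\<bar> < pi / 2" for j
    using arcsin_lt_bounded[of "Im (fst p $ j)"] im[of j] by linarith
  moreover have "0 < (snd p $ pole j)\<^sup>2" for j
    using pos(2)[of j] by (rule zero_less_power)
  ultimately show "chart_inverse p \<in> chart_domain"
    by (simp only: chart_domain_def mem_Collect_eq inv1 h simp_thms)
  have "fst (chart (chart_inverse p)) $ j = fst p $ j" for j
  proof -
    have "cos (arcsin (Im (fst p $ j))) = sqrt (1 - (Im (fst p $ j))\<^sup>2)"
      using im[of j] by (intro cos_arcsin) auto
    also have "1 - (Im (fst p $ j))\<^sup>2 = (Re (fst p $ j))\<^sup>2" using sq[of j] by simp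
    finally have "cos (arcsin (Im (fst p $ j))) = Re (fst p $ j)" using pos(1)[of j] by simp
    moreover have "sin (arcsin (Im (fst p $ j))) = Im (fst p $ j)"
      using im[of j] by (intro sin_arcsin) auto
    ultimately show ?thesis by (simp add: fst_chart inv1 complex_eq_iff)
  qed
  moreover have "snd (chart (chart_inverse p)) $ i = snd p $ i" for i
  proof (cases "i = pole (b i)")
    case True
    then have "snd (chart (chart_inverse p)) $ i = sqrt ((snd p $ i)\<^sup>2)"
      using snd_chart(1)[of "chart_inverse p" "b i"] h[of "b i"] by simp
    then show ?thesis using pos(2)[of "b i"] True by simp
  next
    case False
    then show ?thesis by (simp add: snd_chart(2) inv2)
  qed
  ultimately show "chart (chart_inverse p) = p" by (simp add: prod_eq_iff vec_eq_iff)
qed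

lemma chart_image_eq: "chart ` chart_domain = M \<inter> chart_range"
proof (intro equalityI subsetI)
  fix p assume "p \<in> M \<inter> chart_range"
  from chart_inverse_image[OF this] show "p \<in> chart ` chart_domain" by (metis imageI)
qed (use chart_image in blast)

lemma local_param_chart: "local_param M chart_domain chart"
  unfolding local_param_def
proof (intro conjI ballI smooth_chart)
  have "chart_range = (\<Inter>j. {p. 0 < Re (fst p $ j)} \<inter> {p. 0 < snd p $ pole j})"
    by (auto simp: chart_range_def)
  moreover have "open {p :: (complex^'n) \<times> (real^'d). 0 < Re (fst p $ j)}"
    "open {p :: (complex^'n) \<times> (real^'d). 0 < snd p $ pole j}" for j
    by (intro open_Collect_less continuous_intros)+
  ultimately have "open chart_range" by (auto intro!: open_INT)
  then show "openin (top_of_set M) (chart ` chart_domain)"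
    unfolding chart_image_eq openin_open by blast
  have "homeomorphism chart_domain (chart ` chart_domain) chart chart_inverse"
  proof (rule homeomorphismI)
    show "continuous_on chart_domain chart" by (rule smooth_on_open_continuous_on[OF smooth_chart])
    have "continuous_on (chart ` chart_domain) (\<lambda>p. if e k = pole (B k) then arcsin (Im (fst p $ B k)) else snd p $ e k)" for k
    proof (cases "e k = pole (B k)")
      case True
      have "\<bar>Im (fst p $ B k)\<bar> \<le> 1" if "p \<in> chart ` chart_domain" for p
        using that norm_fst[of p "B k"] abs_Im_le_cmod[of "fst p $ B k"] by (auto simp: chart_image_eq)
      then have "continuous_on (chart ` chart_domain) (\<lambda>p. arcsin (Im (fst p $ B k)))"
        by (intro continuous_on_arcsin continuous_intros) (auto simp: abs_le_iff)
      with True show ?thesis by simp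
    next
      case False
      have "continuous_on (chart ` chart_domain) (\<lambda>p. snd p $ e k)" by (intro continuous_intros)
      with False show ?thesis by simp
    qed
    then show "continuous_on (chart ` chart_domain) chart_inverse"
      unfolding chart_inverse_def by (intro continuous_on_vec_lambda)
    show "chart_inverse ` chart ` chart_domain \<subseteq> chart_domain"
      using chart_inverse_chart by auto
  qed (auto simp: chart_inverse_chart)
  then show "\<exists>\<psi>. homeomorphism chart_domain (chart ` chart_domain) chart \<psi>" by (rule exI[where x = chart_inverse])
  fix u assume u: "u \<in> chart_domain"
  have d: "(chart has_derivative frechet_derivative chart (at u)) (at u)"
    by (rule smooth_on_open_has_derivative[OF smooth_chart u])
  show "inj (frechet_derivative chart (at u))"
  proof (subst linear_injective_0[OF has_derivative_linear[OF d]], intro allI impI)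
    fix v assume v: "frechet_derivative chart (at u) v = 0"
    have "v $ k = 0" for k
    proof (cases "e k = pole (B k)")
      case True
      then have k: "inv e (pole (B k)) = k" by (metis inv_e)
      have "((\<lambda>u. fst (chart u) $ B k) has_derivative (\<lambda>v. fst (frechet_derivative chart (at u) v) $ B k)) (at u)"
        by (rule bounded_linear.has_derivative[OF bounded_linear_vec_nth has_derivative_fst[OF d]])
      moreover have "((\<lambda>u. fst (chart u) $ B k) has_derivative (\<lambda>v. v $ k *\<^sub>R (\<i> * cis (u $ k)))) (at u)"
        unfolding fst_chart k by (intro has_derivative_cis bounded_linear_imp_has_derivative bounded_linear_vec_nth)
      ultimately have "(\<lambda>v. fst (frechet_derivative chart (at u) v) $ B k) = (\<lambda>v. v $ k *\<^sub>R (\<i> * cis (u $ k)))"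
        by (rule has_derivative_unique)
      from fun_cong[OF this, of v] show ?thesis by (simp add: v)
    next
      case False
      have "((\<lambda>u. snd (chart u) $ e k) has_derivative (\<lambda>v. snd (frechet_derivative chart (at u) v) $ e k)) (at u)"
        by (rule bounded_linear.has_derivative[OF bounded_linear_vec_nth has_derivative_snd[OF d]])
      moreover have "((\<lambda>u. snd (chart u) $ e k) has_derivative (\<lambda>v. v $ k)) (at u)"
        unfolding snd_chart(2)[OF False] inv_e by (intro bounded_linear_imp_has_derivative bounded_linear_vec_nth)
      ultimately have "(\<lambda>v. snd (frechet_derivative chart (at u) v) $ e k) = (\<lambda>v. v $ k)"
        by (rule has_derivative_unique)
      from fun_cong[OF this, of v] show ?thesis by (simp add: v)
    qed
    then show "v = 0" by (simp add: vec_eq_iff)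
  qed
qed

lemma connected_chart_domain: "connected chart_domain"
proof (rule starlike_imp_connected)
  have h0: "height j 0 = 1" for j by (simp add: height_def)
  have "closed_segment 0 u \<subseteq> chart_domain" if u: "u \<in> chart_domain" for u
  proof
    fix y assume "y \<in> closed_segment 0 u"
    then obtain t where t: "0 \<le> t" "t \<le> 1" "y = t *\<^sub>R u" by (auto simp: in_segment)
    have "t\<^sup>2 \<le> 1" using t(1,2) by (simp add: power_le_one)
    have "\<bar>y $ inv e (pole j)\<bar> < pi / 2" "0 < height j y" for j
    proof -
      have "\<bar>y $ inv e (pole j)\<bar> \<le> \<bar>u $ inv e (pole j)\<bar>"
        using t by (simp add: abs_mult mult_left_le_one_le)
      also have "\<dots> < pi / 2" using u by (simp add: chart_domain_def)
      finally show "\<bar>y $ inv e (pole j)\<bar> < pi / 2" .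
      have "1 - height j y = t\<^sup>2 * (1 - height j u)"
        by (simp add: height_def t(3) power_mult_distrib sum_distrib_left)
      also have "\<dots> \<le> 1 - height j u"
        using \<open>t\<^sup>2 \<le> 1\<close> by (intro mult_left_le_one_le) (auto simp: height_def intro: sum_nonneg)
      also have "\<dots> < 1" using u by (simp add: chart_domain_def)
      finally show "0 < height j y" by simp
    qed
    then show "y \<in> chart_domain" by (simp add: chart_domain_def)
  qed
  moreover have "0 \<in> chart_domain" using pi_gt_zero by (simp add: chart_domain_def h0)
  ultimately show "starlike chart_domain" unfolding starlike_def by blast
qed

text \<open>Moving from the pole of one sphere towards a coordinate direction of different weight changes
  the length of the gradient of the angle.\<close>

theorem nontrivial_weighted_immersion:
  assumes i: "i \<noteq> pole (b i)" "g i \<noteq> g (pole (b i))"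
  shows "nontrivial_H_minimal M weighted_immersion"
proof -
  define x where "x s = axis (inv e i) s" for s :: real
  have x: "x s $ inv e l = (if l = i then s else 0)" for s l
    by (simp add: x_def axis_def) (metis e_inv)
  have sum_x: "(\<Sum>l | b l = j \<and> l \<noteq> pole j. c l * (x s $ inv e l)\<^sup>2) = (if j = b i then c i * s\<^sup>2 else 0)" for c j s
  proof -
    have "(\<Sum>l | b l = j \<and> l \<noteq> pole j. c l * (x s $ inv e l)\<^sup>2) =
        (\<Sum>l | b l = j \<and> l \<noteq> pole j. if l = i then c l * s\<^sup>2 else 0)"
      by (intro sum.cong refl) (simp add: x)
    also have "\<dots> = (if j = b i then c i * s\<^sup>2 else 0)"
      using i(1) by (auto simp: sum.delta)
    finally show ?thesis .
  qed
  have h: "height j (x s) = 1 - (if j = b i then s\<^sup>2 else 0)" for j s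
    using sum_x[where c = "\<lambda>l. 1" and j = j and s = s] by (simp add: height_def)
  have dom: "x s \<in> chart_domain" if "\<bar>s\<bar> < 1" for s
  proof -
    have "s\<^sup>2 < 1" using that by (simp add: abs_square_less_1)
    moreover have "pole j \<noteq> i" for j using i(1) b_pole by metis
    ultimately show ?thesis using pi_gt_zero by (simp add: chart_domain_def h x)
  qed
  have inM: "chart (x s) \<in> M" if "\<bar>s\<bar> < 1" for s
    using chart_image[OF dom[OF that]] by blast
  have norm: "(\<Sum>k | B k = j. w k * (snd (chart (x s)) $ e k)\<^sup>2) =
      g (pole j) + (if j = b i then (real (g i) - real (g (pole j))) * s\<^sup>2 else 0)" if "\<bar>s\<bar> < 1" for j s
  proof -
    have "bij_betw e {k. B k = j} {i. b i = j}"
      by (rule bij_betw_byWitness[where f' = "inv e"]) auto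
    then have "(\<Sum>k | B k = j. w k * (snd (chart (x s)) $ e k)\<^sup>2) =
        (\<Sum>i | b i = j. real (g i) * (snd (chart (x s)) $ i)\<^sup>2)"
      unfolding w_def by (rule sum.reindex_bij_betw)
    also have "\<dots> = real (g (pole j)) * height j (x s) + (if j = b i then real (g i) * s\<^sup>2 else 0)"
      using dom[OF that] unfolding sum_x[where c = "\<lambda>l. real (g l)", symmetric]
      by (intro weighted_sum_chart less_imp_le) (simp add: chart_domain_def)
    finally show ?thesis by (cases "j = b i") (simp_all add: h algebra_simps)
  qed
  let ?W = "\<lambda>s. angle_field (chart (x s)) \<bullet> angle_field (chart (x s))"
  have W: "?W s = (\<Sum>j\<in>UNIV. total_weight j * speed j (chart (x s)))" if "\<bar>s\<bar> < 1" for s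
    unfolding inner_angle_field_self[OF inM[OF that]] total_weight_def
    using sum_fibres[of "\<lambda>j. speed j (chart (x s))" w] by (simp add: mult.commute)
  let ?j = "b i"
  have "total_weight ?j > 0"
    unfolding total_weight_def using w_pos b_pole[of ?j]
    by (intro sum_pos) (auto intro: exI[of _ "inv e i"])
  have sp: "speed j (chart (x s)) = total_weight j / (g (pole j) + (if j = ?j then (real (g i) - real (g (pole j))) * s\<^sup>2 else 0))"
    if "\<bar>s\<bar> < 1" for j s
    unfolding speed_def norm[OF that] ..
  \<comment> \<open>Only the summand of the factor of \<open>i\<close> differs at the two points.\<close>
  have "?W 0 - ?W (1/2) = (\<Sum>j\<in>UNIV. total_weight j * (speed j (chart (x 0)) - speed j (chart (x (1/2)))))"
    by (simp add: W sum_subtractf right_diff_distrib)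
  also have "\<dots> = (\<Sum>j\<in>UNIV. if j = ?j then total_weight j * (speed j (chart (x 0)) - speed j (chart (x (1/2)))) else 0)"
    by (intro sum.cong refl) (simp add: sp)
  also have "\<dots> = total_weight ?j * (speed ?j (chart (x 0)) - speed ?j (chart (x (1/2))))"
    by simp
  also have "\<dots> \<noteq> 0"
  proof -
    have "g (pole ?j) > 0" by (rule weight_pos)
    moreover have "g (pole ?j) + (real (g i) - real (g (pole ?j))) * (1/2)\<^sup>2 \<noteq> g (pole ?j)"
      using i(2) by simp
    moreover have "g (pole ?j) + (real (g i) - real (g (pole ?j))) * (1/2)\<^sup>2 > 0"
      using \<open>g (pole ?j) > 0\<close> by (simp add: power2_eq_square field_simps)
    ultimately show ?thesis
      using \<open>total_weight ?j > 0\<close> by (simp add: sp frac_eq_eq)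
  qed
  finally have "?W 0 \<noteq> ?W (1/2)" by simp
  then show ?thesis
    by (intro nontrivial_H_minimal_criterion[OF lagrangian_weighted_immersion angle_gradient_weighted_immersion
          divergence_free_angle_field local_param_chart connected_chart_domain dom dom]) auto
qed

end


section \<open>Two countable families\<close>

theorem corollary5:
  fixes m :: "'n::finite \<Rightarrow> nat"
    and b :: "'d::finite \<Rightarrow> 'n"
  assumes "\<And>j. 0 < m j"
    and "\<And>j. card {i. b i = j} = m j + 1"
    and "CARD('N::finite) = CARD('n) + (\<Sum>j\<in>UNIV. m j)"
  shows "\<exists>(\<Phi> :: nat \<Rightarrow> (complex^'n) \<times> (real^'d) \<Rightarrow> complex^'N)
          (\<Psi> :: nat \<times> nat \<Rightarrow> (complex^'n) \<times> (real^'d) \<Rightarrow> complex^'N).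
     (\<forall>p. nontrivial_H_minimal (torus_times_spheres b) (\<Phi> p)) \<and>
     (\<forall>q r. 0 < q \<and> q < r \<longrightarrow> nontrivial_H_minimal (torus_times_spheres b) (\<Psi> (q, r))) \<and>
     inj (\<lambda>p. restrict (\<Phi> p) (torus_times_spheres b)) \<and>
     inj_on (\<lambda>qr. restrict (\<Psi> qr) (torus_times_spheres b)) {(q, r). 0 < q \<and> q < r} \<and>
     (\<forall>p q r. 0 < q \<and> q < r \<longrightarrow>
        (\<exists>x\<in>torus_times_spheres b. \<Phi> p x \<noteq> \<Psi> (q, r) x))"
proof -
  have ne: "\<exists>i. b i = j" for j
    using assms(2)[of j] by (metis (mono_tags, lifting) Collect_empty_eq add_is_0 card.empty one_neq_zero)
  define pole where "pole j = (SOME i. b i = j)" for j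
  have pole: "b (pole j) = j" for j
    unfolding pole_def using ne[of j] by (rule someI_ex)
  fix j0 :: 'n
  have "\<exists>i. b i = j0 \<and> i \<noteq> pole j0"
  proof (rule ccontr)
    assume "\<not> ?thesis"
    then have "{i. b i = j0} \<subseteq> {pole j0}" by auto
    then have "card {i. b i = j0} \<le> 1" using card_mono[of "{pole j0}"] by fastforce
    then show False using assms(1)[of j0] assms(2)[of j0] by simp
  qed
  then obtain i0 where i0: "b i0 = j0" "i0 \<noteq> pole j0" by blast
  have "CARD('N) = CARD('d)"
  proof -
    have "CARD('d) = (\<Sum>j\<in>UNIV. card {i \<in> UNIV. b i = j})"
      using sum.group[of UNIV UNIV b "\<lambda>i. 1 :: nat"] by simp
    also have "\<dots> = CARD('n) + (\<Sum>j\<in>UNIV. m j)"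
      by (simp add: assms(2) sum_Suc)
    finally show ?thesis using assms(3) by simp
  qed
  then obtain e :: "'N \<Rightarrow> 'd" where e: "bij e"
    using finite_same_card_bij[of "UNIV :: 'N set" "UNIV :: 'd set"] by auto
  let ?M = "torus_times_spheres b"
  \<comment> \<open>The weight is \<open>c\<close> at the poles and \<open>a\<close> elsewhere.\<close>
  define \<gamma> where "\<gamma> a c i = (if i = pole (b i) then c else a)" for a c :: nat and i
  define \<Theta> :: "nat \<times> nat \<Rightarrow> (complex^'n) \<times> (real^'d) \<Rightarrow> complex^'N"
    where "\<Theta> ac = weighted_torus.weighted_immersion b (\<gamma> (fst ac) (snd ac)) e" for ac
  have loc: "weighted_torus_chart b (\<gamma> a c) e pole" if "0 < a" "0 < c" for a c
    by unfold_locales (use that e pole in \<open>auto simp: \<gamma>_def\<close>)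
  have nontrivial: "nontrivial_H_minimal ?M (\<Theta> (a, c))" if "0 < a" "0 < c" "a \<noteq> c" for a c
    unfolding \<Theta>_def fst_conv snd_conv
    by (rule weighted_torus_chart.nontrivial_weighted_immersion[OF loc[OF that(1,2)], of i0])
       (use i0 that(3) pole in \<open>auto simp: \<gamma>_def\<close>)
  have val: "\<Theta> (a, c) (\<chi> j. 1, x) $ inv e i = of_real (x $ i / sqrt (real (\<gamma> a c i)))" if "0 < a" "0 < c" for a c x i
  proof -
    interpret weighted_torus_chart b "\<gamma> a c" e pole by (rule loc[OF that])
    show ?thesis by (simp add: \<Theta>_def weighted_immersion_def w_def)
  qed
  \<comment> \<open>Two points with \<open>z = 1\<close> at which the values of the immersion are \<open>1 / sqrt c\<close> and \<open>1 / sqrt a\<close>.\<close>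
  define x0 :: "real^'d" where "x0 = (\<chi> i. if i = pole (b i) then 1 else 0)"
  define x1 :: "real^'d" where "x1 = (\<chi> i. if b i = j0 then if i = i0 then 1 else 0 else if i = pole (b i) then 1 else 0)"
  have sum0: "(\<Sum>i | b i = j. (x0 $ i)\<^sup>2) = 1" for j
  proof -
    have "(\<Sum>i | b i = j. (x0 $ i)\<^sup>2) = (\<Sum>i | b i = j. if i = pole j then 1 else 0)"
      by (intro sum.cong refl) (auto simp: x0_def)
    then show ?thesis by (simp add: pole)
  qed
  have sum1: "(\<Sum>i | b i = j. (x1 $ i)\<^sup>2) = 1" for j
  proof -
    have "(\<Sum>i | b i = j. (x1 $ i)\<^sup>2) = (\<Sum>i | b i = j. if i = (if j = j0 then i0 else pole j) then 1 else 0)"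
      by (intro sum.cong refl) (auto simp: x1_def)
    then show ?thesis using i0 by (simp add: pole)
  qed
  have M: "(\<chi> j. 1, x0) \<in> ?M" "(\<chi> j. 1, x1) \<in> ?M"
    by (simp_all add: torus_times_spheres_def sum0 sum1)
  have distinct: "a = a' \<and> c = c'"
    if pos: "0 < a" "0 < c" "0 < a'" "0 < c'" and eq: "\<And>x. x \<in> ?M \<Longrightarrow> \<Theta> (a, c) x = \<Theta> (a', c') x" for a c a' c'
  proof
    have "of_real (1 / sqrt (real a)) = complex_of_real (1 / sqrt (real a'))"
      using arg_cong[OF eq[OF M(2)], of "\<lambda>v. v $ inv e i0"] pos i0
      by (simp only: val) (simp add: x1_def \<gamma>_def)
    then have "1 / sqrt (real a) = 1 / sqrt (real a')" by (simp only: of_real_eq_iff)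
    then show "a = a'" using pos by simp
    have "of_real (1 / sqrt (real c)) = complex_of_real (1 / sqrt (real c'))"
      using arg_cong[OF eq[OF M(1)], of "\<lambda>v. v $ inv e (pole j0)"] pos pole
      by (simp only: val) (simp add: x0_def \<gamma>_def)
    then have "1 / sqrt (real c) = 1 / sqrt (real c')" by (simp only: of_real_eq_iff)
    then show "c = c'" using pos by simp
  qed
  have restrict: "f x = h x" if "restrict f ?M = restrict h ?M" "x \<in> ?M" for f h :: "(complex^'n) \<times> (real^'d) \<Rightarrow> complex^'N" and x
    using fun_cong[OF that(1), of x] that(2) by simp
  show ?thesis
  proof (intro exI[of _ "\<lambda>p. \<Theta> (p + 2, 1)"] exI[of _ \<Theta>] conjI allI impI)
    show "nontrivial_H_minimal ?M (\<Theta> (p + 2, 1))" for p by (rule nontrivial) auto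
    show "nontrivial_H_minimal ?M (\<Theta> (q, r))" if "0 < q \<and> q < r" for q r
      using that by (intro nontrivial) auto
    show "inj (\<lambda>p. restrict (\<Theta> (p + 2, 1)) ?M)"
    proof (rule injI)
      fix p p' assume "restrict (\<Theta> (p + 2, 1)) ?M = restrict (\<Theta> (p' + 2, 1)) ?M"
      from distinct[OF _ _ _ _ restrict[OF this]] show "p = p'" by simp
    qed
    show "inj_on (\<lambda>qr. restrict (\<Theta> qr) ?M) {(q, r). 0 < q \<and> q < r}"
    proof (rule inj_onI, clarify)
      fix q r q' r' :: nat
      assume pos: "0 < q" "q < r" "0 < q'" "q' < r'" and "restrict (\<Theta> (q, r)) ?M = restrict (\<Theta> (q', r')) ?M"
      from distinct[OF _ _ _ _ restrict[OF this(5)]] pos show "q = q' \<and> r = r'" by simp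
    qed
    show "\<exists>x\<in>?M. \<Theta> (p + 2, 1) x \<noteq> \<Theta> (q, r) x" if "0 < q \<and> q < r" for p q r
    proof (rule ccontr)
      assume "\<not> ?thesis"
      then have "p + 2 = q \<and> 1 = r" using that by (intro distinct) auto
      then show False using that by simp
    qed
  qed
qed

end
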